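(* The equivalence classes of extensions of $W$ by $M$ under the action of the group $G^{\text{gen}}$ are classified by the following data: 1. Equivalence classes of codifferentials $\delta$ on $W$ under the action of $\mathbf{GL}(W)$. 2. Equivalence classes of codifferentials $\mu$ on $M$ under the action of $\mathbf{GL}(M)$. 3. Equivalence classes of $D_\mu$-cohomology classes $\bar\lambda\in H_\mu^{1,1}$ which satisfy the MC-equation $$\overline{[\delta+\lambda,\delta+\lambda]}=0\in H_\mu^{1,2}(\ker(D_{\delta+\lambda}))$$ under the action of the group $G_{\delta,\mu}$ on $H_\mu$. 4. Equivalence classes of $D_{\bar\delta+\bar\lambda}$-cohomology classes $[\bar\tau]\in H^{0,2}_{\mu,\delta+\lambda}$ under the action of the group $G_{\delta,\mu,\lambda}$. That is: choose one representative $\delta$, $\mu$ for each class in 1 and 2; for each pair $(\delta,\mu)$ choose one representative $\bar\lambda$ of each orbit in 3, a cochain $\lambda\in\bar\lambda$, and a $\psi$ such that $\delta+\mu+\lambda+\psi$ is an extension (such $\psi$ exists). Then every extension of $W$ by $M$ is $G^{\text{gen}}$-equivalent to $\delta+\mu+\lambda+\psi+\tau$ for exactly one choice of representatives $\delta,\mu,\bar\lambda$ and exactly one $G_{\delta,\mu,\lambda}$-orbit of classes $[\bar\tau]\in H^{0,2}_{\mu,\delta+\lambda}$, and every such choice occurs.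
   Context: Work over a field $\mathbb K$ of characteristic different from 2 and 3. $M,W$ are $\mathbb Z_2$-graded vector spaces and $V=M\oplus W$ (parity-reversed convention: an ordinary ungraded algebra corresponds to a completely odd space). Let $C(V)=\operatorname{Hom}(T(V),V)$, $T(V)=\bigoplus_n V^{\otimes n}$. For $\varphi\in\operatorname{Hom}(V^{\otimes k},V)$ and $\chi\in\operatorname{Hom}(V^{\otimes l},V)$ put $$(\varphi\circ\chi)(v_1,\dots,v_{k+l-1})=\sum_i(-1)^{|\chi|(|v_1|+\dots+|v_{i-1}|)}\varphi(v_1,\dots,v_{i-1},\chi(v_i,\dots,v_{i+l-1}),\dots,v_{k+l-1}),$$ and $[\varphi,\chi]=\varphi\circ\chi-(-1)^{|\varphi||\chi|}\chi\circ\varphi$ (the graded Lie bracket of coderivations of $T(V)$). Maps defined on a summand of $T(V)$ are extended by zero. Here "codifferential" on a space $U$ means an odd $d\in\operatorname{Hom}(U^{\otimes2},U)$ with $[d,d]=0$, i.e. an associative algebra structure. Let $T^{k,l}(M,W)\subseteq V^{\otimes(k+l)}$ be spanned by tensors of $k$ elements of $M$ and $l$ elements of $W$ in any order, $C^{k,l}=\operatorname{Hom}(T^{k,l}(M,W),M)$, and $C^k=\operatorname{Hom}(W^{\otimes k},W)$. An extension of $W$ by $M$ is a codifferential $d=\delta+\mu+\lambda+\psi$ on $V$ with odd $\delta\in C^2$, $\mu\in C^{2,0}$, $\lambda\in C^{1,1}$, $\psi\in C^{0,2}$; equivalently $[\delta,\delta]=0$, $[\mu,\mu]=0$, $[\delta,\lambda]+\tfrac12[\lambda,\lambda]+[\mu,\psi]=0$,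 $[\mu,\lambda]=0$, $[\delta+\lambda,\psi]=0$. Groups (all automorphisms are even linear maps; $g^*(\varphi)=g^{-1}\circ\varphi\circ g^{\otimes n}$ for $\varphi\in\operatorname{Hom}(V^{\otimes n},V)$): - $G_{M,W}=\mathbf{GL}(M)\times\mathbf{GL}(W)$, acting block-diagonally on $V$. - $G^{\text{rest}}=\{\exp(\beta):\beta\in C^{0,1}=\operatorname{Hom}(W,M)\text{ even}\}$, $\exp(\beta)(m,w)=(m+\beta(w),w)$. - $G^{\text{gen}}=G_{M,W}\rtimes G^{\text{rest}}$, the group of automorphisms of $V$ mapping $M$ onto $M$; every $h\in G^{\text{gen}}$ is uniquely $h=g\exp(\beta)$ with $g\in G_{M,W}$. It acts on extensions by $d\mapsto h^*(d)$. - $G_{\delta,\mu}=\{g\in G_{M,W}:g^*(\delta)=\delta,\ g^*(\mu)=\mu\}$, acting on $H_\mu$ by $g^*(\bar\varphi)=\overline{g^*(\varphi)}$. - $G_{\delta,\mu,\lambda}=\{h=g\exp(\beta):g\in G_{\delta,\mu},\ \lambda=g^*(\lambda)+[\mu,\beta]\}$. Given $\psi$ such that $\delta+\mu+\lambda+\psi$ is an extension, it acts on $H^{0,2}_{\mu,\delta+\lambda}$ by $$[\bar\tau]\mapsto\Big[\overline{g^*(\psi)-\psi+g^*(\tau)+[\delta+\lambda-\tfrac12[\mu,\beta],\beta]}\Big].$$ Cohomology. For $\alpha\in C(V)$ put $D_\alpha=[\alpha,\cdot\,]$. - $D_\mu:C^{k,l}\to C^{k+1,l}$ squares to zero; $H_\mu^{k,l}=\ker(D_\mu|_{C^{k,l}})/D_\mu(C^{k-1,l})$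 (with $C^{-1,l}=0$), the class of $\varphi$ being $\bar\varphi$. - For $\lambda\in C^{1,1}$ odd with $[\mu,\lambda]=0$, $D_{\delta+\lambda}:C^{k,l}\to C^{k,l+1}$ anticommutes with $D_\mu$, and $H_\mu^{1,2}(\ker(D_{\delta+\lambda}))=\{\varphi\in C^{1,2}:D_\mu\varphi=0,\ D_{\delta+\lambda}\varphi=0\}/D_\mu\{\psi\in C^{0,2}:D_{\delta+\lambda}\psi=0\}$. The element $[\delta+\lambda,\delta+\lambda]=2[\delta,\lambda]+[\lambda,\lambda]$ lies in the numerator; vanishing of its class depends only on $\bar\lambda$. - If it vanishes, $D_{\bar\delta+\bar\lambda}:H_\mu^{k,l}\to H_\mu^{k,l+1}$, $\bar\varphi\mapsto\overline{[\delta+\lambda,\varphi]}$, squares to zero, and $H_{\mu,\delta+\lambda}^{0,2}=\ker(D_{\bar\delta+\bar\lambda}:H_\mu^{0,2}\to H_\mu^{0,3})/D_{\bar\delta+\bar\lambda}(H_\mu^{0,1})$; the class of $\bar\tau$ is $[\bar\tau]$. Convention: in $H_\mu^{1,1}$ and $H_{\mu,\delta+\lambda}^{0,2}$ only classes of odd cochains are considered (automatic when $V$ is completely odd). *)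

theory Defs
  imports Complex_Main "HOL-Library.Function_Algebras" "HOL-Library.Product_Plus" "HOL-Library.Set_Algebras"
begin

section \<open>Graded spaces\<close>

text \<open>A \<open>\<int>\<^sub>2\<close>-graded vector space lives on a whole type; \<open>evp\<close> and \<open>odp\<close> are its homogeneous
  subspaces.  Parities are natural numbers read modulo 2.\<close>

record ('k, 'v) gspace =
  scl :: "'k \<Rightarrow> 'v \<Rightarrow> 'v"
  evp :: "'v set"
  odp :: "'v set"

definition hpart :: "('k, 'v) gspace \<Rightarrow> nat \<Rightarrow> 'v set" where
  "hpart U p = (if even p then evp U else odp U)"

definition graded_space :: "('k::field, 'v::ab_group_add) gspace \<Rightarrow> bool" where
  "graded_space U \<longleftrightarrow> vector_space (scl U)
     \<and> module.subspace (scl U) (evp U) \<and> module.subspace (scl U) (odp U)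
     \<and> evp U \<inter> odp U = {0} \<and> (\<forall>v. \<exists>a\<in>evp U. \<exists>b\<in>odp U. v = a + b)"

definition hproj :: "('k::field, 'v::ab_group_add) gspace \<Rightarrow> nat \<Rightarrow> 'v \<Rightarrow> 'v" where
  "hproj U p v = (THE a. a \<in> hpart U p \<and> v - a \<in> hpart U (Suc p))"

text \<open>The linear map with \<open>v \<mapsto> (-1)\<^sup>q\<^sup>|\<^sup>v\<^sup>| v\<close> on homogeneous \<open>v\<close>.\<close>

definition koszul :: "('k::field, 'v::ab_group_add) gspace \<Rightarrow> nat \<Rightarrow> 'v \<Rightarrow> 'v" where
  "koszul U q v = hproj U 0 v + scl U ((-1) ^ q) (hproj U 1 v)"

definition dsum :: "('k, 'm) gspace \<Rightarrow> ('k, 'w) gspace \<Rightarrow> ('k, 'm \<times> 'w) gspace" where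
  "dsum M W = \<lparr> scl = (\<lambda>c (m, w). (scl M c m, scl W c w)),
               evp = evp M \<times> evp W, odp = odp M \<times> odp W \<rparr>"


section \<open>Cochains and the bracket\<close>

text \<open>An element of \<open>Hom(T(U), U)\<close> is given by its values on pure tensors, as a function on lists
  that is linear in each entry.\<close>

definition cochains :: "('k::field, 'v::ab_group_add) gspace \<Rightarrow> ('v list \<Rightarrow> 'v) set" where
  "cochains U = {f. \<forall>xs ys. Vector_Spaces.linear (scl U) (scl U) (\<lambda>v. f (xs @ v # ys))}"

definition Hom :: "('k::field, 'v::ab_group_add) gspace \<Rightarrow> nat \<Rightarrow> ('v list \<Rightarrow> 'v) set" where
  "Hom U n = {f \<in> cochains U. \<forall>vs. length vs \<noteq> n \<longrightarrow> f vs = 0}"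

definition has_parity :: "('k, 'v) gspace \<Rightarrow> nat \<Rightarrow> ('v list \<Rightarrow> 'v) \<Rightarrow> bool" where
  "has_parity U p f \<longleftrightarrow>
     (\<forall>es vs. list_all2 (\<lambda>e v. v \<in> hpart U e) es vs \<longrightarrow> f vs \<in> hpart U (p + sum_list es))"

text \<open>Homogeneous component of parity \<open>p\<close> of a cochain: split every argument into its even and its
  odd part and project the value to the parity \<open>p\<close> prescribes.\<close>

definition cpart ::
  "('k::field, 'v::ab_group_add) gspace \<Rightarrow> nat \<Rightarrow> ('v list \<Rightarrow> 'v) \<Rightarrow> 'v list \<Rightarrow> 'v" where
  "cpart U p f vs = (\<Sum>es | set es \<subseteq> {0, 1} \<and> length es = length vs.
     hproj U (p + sum_list es) (f (map2 (hproj U) es vs)))"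

text \<open>\<open>f \<circ> g\<close> for \<open>g\<close> of parity \<open>q\<close>: insert \<open>g\<close>, applied to \<open>l\<close> consecutive entries, after the first
  \<open>i\<close> entries.  By linearity of \<open>f\<close>, the sign \<open>(-1)\<^sup>q\<^sup>|\<^sup>v\<^sup>|\<close> of each entry jumped over sits in \<open>koszul\<close>.\<close>

definition circ ::
  "('k::field, 'v::ab_group_add) gspace \<Rightarrow> nat \<Rightarrow> ('v list \<Rightarrow> 'v) \<Rightarrow> ('v list \<Rightarrow> 'v) \<Rightarrow> 'v list \<Rightarrow> 'v"
where
  "circ U q f g vs = (\<Sum>l\<le>length vs. \<Sum>i\<le>length vs - l.
     f (map (koszul U q) (take i vs) @ g (take l (drop i vs)) # drop (i + l) vs))"

text \<open>\<open>f \<circ> g - (-1)\<^sup>|\<^sup>f\<^sup>|\<^sup>|\<^sup>g\<^sup>| g \<circ> f\<close> for homogeneous \<open>f\<close> and \<open>g\<close>, extended bilinearly.\<close>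

definition bracket ::
  "('k::field, 'v::ab_group_add) gspace \<Rightarrow> ('v list \<Rightarrow> 'v) \<Rightarrow> ('v list \<Rightarrow> 'v) \<Rightarrow> 'v list \<Rightarrow> 'v" where
  "bracket U f g vs = (\<Sum>p\<in>{0, 1}. \<Sum>q\<in>{0, 1}.
      circ U q (cpart U p f) (cpart U q g) vs
      - scl U ((-1) ^ (p * q)) (circ U p (cpart U q g) (cpart U p f) vs))"

definition codifferentials :: "('k::field, 'v::ab_group_add) gspace \<Rightarrow> ('v list \<Rightarrow> 'v) set" where
  "codifferentials U = {d \<in> Hom U 2. has_parity U 1 d \<and> bracket U d d = 0}"


section \<open>Cochains on a direct sum and extensions\<close>

text \<open>Extension by zero from \<open>T(M)\<close>, \<open>T(W)\<close> to \<open>T(M \<oplus> W)\<close>, for cochains of positive arity: an entry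
  in the other summand projects to 0.\<close>

definition inM :: "('m list \<Rightarrow> 'm) \<Rightarrow> ('m \<times> 'w) list \<Rightarrow> 'm \<times> 'w::zero" where
  "inM f vs = (f (map fst vs), 0)"

definition inW :: "('w list \<Rightarrow> 'w) \<Rightarrow> ('m \<times> 'w) list \<Rightarrow> 'm::zero \<times> 'w" where
  "inW f vs = (0, f (map snd vs))"

text \<open>\<open>C\<^sup>k\<^sup>,\<^sup>l = Hom(T\<^sup>k\<^sup>,\<^sup>l(M, W), M)\<close>, extended by zero: \<open>M\<close>-valued and vanishing on every
  tensor of elements of \<open>M\<close> and \<open>W\<close> that does not have exactly \<open>k\<close> entries from \<open>M\<close> and \<open>l\<close> from \<open>W\<close>.\<close>

type_synonym ('m, 'w) cochain = "('m \<times> 'w) list \<Rightarrow> 'm \<times> 'w"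

definition summand :: "'m::zero + 'w::zero \<Rightarrow> 'm \<times> 'w" where
  "summand = case_sum (\<lambda>m. (m, 0)) (\<lambda>w. (0, w))"

definition C :: "('k::field, 'm::ab_group_add) gspace \<Rightarrow> ('k, 'w::ab_group_add) gspace \<Rightarrow>
    nat \<Rightarrow> nat \<Rightarrow> ('m, 'w) cochain set" where
  "C M W k l = {f \<in> cochains (dsum M W). (\<forall>vs. snd (f vs) = 0) \<and>
     (\<forall>xs. \<not> (length (filter isl xs) = k \<and> length (filter (\<lambda>x. \<not> isl x) xs) = l)
        \<longrightarrow> f (map summand xs) = 0)}"

definition C_par :: "('k::field, 'm::ab_group_add) gspace \<Rightarrow> ('k, 'w::ab_group_add) gspace \<Rightarrow>
    nat \<Rightarrow> nat \<Rightarrow> nat \<Rightarrow> ('m, 'w) cochain set" where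
  "C_par M W p k l = {f \<in> C M W k l. has_parity (dsum M W) p f}"

definition extensions :: "('k::field, 'm::ab_group_add) gspace \<Rightarrow> ('k, 'w::ab_group_add) gspace \<Rightarrow>
    ('m, 'w) cochain set" where
  "extensions M W = {d \<in> codifferentials (dsum M W).
     \<exists>\<delta>\<in>{\<delta> \<in> Hom W 2. has_parity W 1 \<delta>}. \<exists>\<mu>\<in>C_par M W 1 2 0. \<exists>lam\<in>C_par M W 1 1 1. \<exists>\<psi>\<in>C_par M W 1 0 2.
       d = inW \<delta> + \<mu> + lam + \<psi>}"


section \<open>Group actions\<close>

definition orbit :: "'g set \<Rightarrow> ('g \<Rightarrow> 'x \<Rightarrow> 'x) \<Rightarrow> 'x \<Rightarrow> 'x set" where
  "orbit G act x = {act g x | g. g \<in> G}"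

definition orbits :: "'g set \<Rightarrow> ('g \<Rightarrow> 'x \<Rightarrow> 'x) \<Rightarrow> 'x set \<Rightarrow> 'x set set" where
  "orbits G act X = orbit G act ` X"

definition representatives :: "'g set \<Rightarrow> ('g \<Rightarrow> 'x \<Rightarrow> 'x) \<Rightarrow> 'x set \<Rightarrow> 'x set \<Rightarrow> bool" where
  "representatives G act X R \<longleftrightarrow> R \<subseteq> X \<and> (\<forall>\<O>\<in>orbits G act X. \<exists>!r. r \<in> R \<and> r \<in> \<O>)"

definition GL :: "('k::field, 'v::ab_group_add) gspace \<Rightarrow> ('v \<Rightarrow> 'v) set" where
  "GL U = {g. Vector_Spaces.linear (scl U) (scl U) g \<and> bij g
            \<and> g ` evp U \<subseteq> evp U \<and> g ` odp U \<subseteq> odp U}"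

text \<open>\<open>g\<^sup>*(f) = g\<^sup>-\<^sup>1 \<circ> f \<circ> g\<^sup>\<otimes>\<^sup>n\<close>\<close>

definition pull :: "('v \<Rightarrow> 'v) \<Rightarrow> ('v list \<Rightarrow> 'v) \<Rightarrow> 'v list \<Rightarrow> 'v" where
  "pull g f vs = inv g (f (map g vs))"

definition G_MW :: "('k::field, 'm::ab_group_add) gspace \<Rightarrow> ('k, 'w::ab_group_add) gspace \<Rightarrow>
    ('m \<times> 'w \<Rightarrow> 'm \<times> 'w) set" where
  "G_MW M W = {map_prod a b | a b. a \<in> GL M \<and> b \<in> GL W}"

definition expo :: "('m::ab_group_add, 'w::ab_group_add) cochain \<Rightarrow> 'm \<times> 'w \<Rightarrow> 'm \<times> 'w"
where
  "expo \<beta> = (\<lambda>(m, w). (m + fst (\<beta> [(0, w)]), w))"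

definition G_gen :: "('k::field, 'm::ab_group_add) gspace \<Rightarrow> ('k, 'w::ab_group_add) gspace \<Rightarrow>
    ('m \<times> 'w \<Rightarrow> 'm \<times> 'w) set" where
  "G_gen M W = {g \<circ> expo \<beta> | g \<beta>. g \<in> G_MW M W \<and> \<beta> \<in> C_par M W 0 0 1}"

text \<open>From here on \<open>\<delta>\<close> and \<open>\<mu>\<close> are already extended by zero to \<open>M \<oplus> W\<close>;
  \<open>lam\<close> is \<open>\<lambda>\<close>.\<close>

definition G_dm :: "('k::field, 'm::ab_group_add) gspace \<Rightarrow> ('k, 'w::ab_group_add) gspace \<Rightarrow>
    ('m, 'w) cochain \<Rightarrow> ('m, 'w) cochain \<Rightarrow> ('m \<times> 'w \<Rightarrow> 'm \<times> 'w) set" where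
  "G_dm M W \<delta> \<mu> = {g \<in> G_MW M W. pull g \<delta> = \<delta> \<and> pull g \<mu> = \<mu>}"

text \<open>The pair \<open>(g, \<beta>)\<close> stands for \<open>h = g \<circ> exp(\<beta>)\<close>, which determines it.\<close>

definition G_dml :: "('k::field, 'm::ab_group_add) gspace \<Rightarrow> ('k, 'w::ab_group_add) gspace \<Rightarrow>
    ('m, 'w) cochain \<Rightarrow> ('m, 'w) cochain \<Rightarrow> ('m, 'w) cochain \<Rightarrow>
    (('m \<times> 'w \<Rightarrow> 'm \<times> 'w) \<times> ('m, 'w) cochain) set" where
  "G_dml M W \<delta> \<mu> lam = {(g, \<beta>). g \<in> G_dm M W \<delta> \<mu> \<and> \<beta> \<in> C_par M W 0 0 1
     \<and> lam = pull g lam + bracket (dsum M W) \<mu> \<beta>}"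


section \<open>Cohomology\<close>

text \<open>\<open>D\<^sub>\<mu>(C\<^sup>k\<^sup>-\<^sup>1\<^sup>,\<^sup>l)\<close>, with \<open>C\<^sup>-\<^sup>1\<^sup>,\<^sup>l = 0\<close>; cohomology classes are cosets.\<close>

definition B_mu :: "('k::field, 'm::ab_group_add) gspace \<Rightarrow> ('k, 'w::ab_group_add) gspace \<Rightarrow>
    ('m, 'w) cochain \<Rightarrow> nat \<Rightarrow> nat \<Rightarrow> ('m, 'w) cochain set" where
  "B_mu M W \<mu> k l = (case k of 0 \<Rightarrow> {0} | Suc k' \<Rightarrow> bracket (dsum M W) \<mu> ` C M W k' l)"

definition cls :: "('k::field, 'm::ab_group_add) gspace \<Rightarrow> ('k, 'w::ab_group_add) gspace \<Rightarrow>
    ('m, 'w) cochain \<Rightarrow> nat \<Rightarrow> nat \<Rightarrow> ('m, 'w) cochain \<Rightarrow>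
    ('m, 'w) cochain set" where
  "cls M W \<mu> k l \<phi> = \<phi> +o B_mu M W \<mu> k l"

definition H_mu :: "('k::field, 'm::ab_group_add) gspace \<Rightarrow> ('k, 'w::ab_group_add) gspace \<Rightarrow>
    ('m, 'w) cochain \<Rightarrow> nat \<Rightarrow> nat \<Rightarrow> ('m, 'w) cochain set set" where
  "H_mu M W \<mu> k l = cls M W \<mu> k l ` {\<phi> \<in> C M W k l. bracket (dsum M W) \<mu> \<phi> = 0}"

definition act_H :: "('k::field, 'm::ab_group_add) gspace \<Rightarrow> ('k, 'w::ab_group_add) gspace \<Rightarrow>
    ('m, 'w) cochain \<Rightarrow> nat \<Rightarrow> nat \<Rightarrow> ('m \<times> 'w \<Rightarrow> 'm \<times> 'w) \<Rightarrow>
    ('m, 'w) cochain set \<Rightarrow> ('m, 'w) cochain set" where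
  "act_H M W \<mu> k l g c = (\<Union>\<phi>\<in>c. cls M W \<mu> k l (pull g \<phi>))"

text \<open>Vanishing of the class of \<open>[\<delta> + \<lambda>, \<delta> + \<lambda>]\<close> in \<open>H\<^sub>\<mu>\<^sup>1\<^sup>,\<^sup>2(ker D\<^sub>\<delta>\<^sub>+\<^sub>\<lambda>)\<close>.\<close>

definition MC_eq :: "('k::field, 'm::ab_group_add) gspace \<Rightarrow> ('k, 'w::ab_group_add) gspace \<Rightarrow>
    ('m, 'w) cochain \<Rightarrow> ('m, 'w) cochain \<Rightarrow> ('m, 'w) cochain \<Rightarrow> bool"
where
  "MC_eq M W \<delta> \<mu> lam \<longleftrightarrow> (let V = dsum M W;
       B = bracket V \<mu> ` {\<psi> \<in> C M W 0 2. bracket V (\<delta> + lam) \<psi> = 0}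
     in bracket V (\<delta> + lam) (\<delta> + lam) +o B = 0 +o B)"

text \<open>Classes in \<open>H\<^sub>\<mu>\<^sup>1\<^sup>,\<^sup>1\<close> of odd cochains that satisfy the MC-equation.\<close>

definition MC_classes :: "('k::field, 'm::ab_group_add) gspace \<Rightarrow> ('k, 'w::ab_group_add) gspace \<Rightarrow>
    ('m, 'w) cochain \<Rightarrow> ('m, 'w) cochain \<Rightarrow>
    ('m, 'w) cochain set set" where
  "MC_classes M W \<delta> \<mu> = cls M W \<mu> 1 1 `
     {lam \<in> C_par M W 1 1 1. bracket (dsum M W) \<mu> lam = 0 \<and> MC_eq M W \<delta> \<mu> lam}"

text \<open>The map that \<open>D\<^sub>\<alpha>\<close>, \<open>\<alpha> = \<delta> + \<lambda>\<close>, induces from \<open>H\<^sub>\<mu>\<^sup>k\<^sup>,\<^sup>l\<close> to \<open>H\<^sub>\<mu>\<^sup>k\<^sup>,\<^sup>l\<^sup>+\<^sup>1\<close>.\<close>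

definition D_bar :: "('k::field, 'm::ab_group_add) gspace \<Rightarrow> ('k, 'w::ab_group_add) gspace \<Rightarrow>
    ('m, 'w) cochain \<Rightarrow> ('m, 'w) cochain \<Rightarrow> nat \<Rightarrow> nat \<Rightarrow>
    ('m, 'w) cochain set \<Rightarrow> ('m, 'w) cochain set" where
  "D_bar M W \<mu> \<alpha> k l c = (\<Union>\<phi>\<in>c. cls M W \<mu> k (Suc l) (bracket (dsum M W) \<alpha> \<phi>))"

text \<open>Odd \<open>\<tau> \<in> C\<^sup>0\<^sup>,\<^sup>2\<close> whose class in \<open>H\<^sub>\<mu>\<^sup>0\<^sup>,\<^sup>2\<close> exists and lies in the kernel of \<open>D_bar\<close>.\<close>

definition Z02 :: "('k::field, 'm::ab_group_add) gspace \<Rightarrow> ('k, 'w::ab_group_add) gspace \<Rightarrow>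
    ('m, 'w) cochain \<Rightarrow> ('m, 'w) cochain \<Rightarrow>
    ('m, 'w) cochain set" where
  "Z02 M W \<mu> \<alpha> = {\<tau> \<in> C_par M W 1 0 2. bracket (dsum M W) \<mu> \<tau> = 0
     \<and> D_bar M W \<mu> \<alpha> 0 2 (cls M W \<mu> 0 2 \<tau>) = cls M W \<mu> 0 3 0}"

text \<open>\<open>[\<tau>]\<close> as a coset of \<open>D_bar(H\<^sub>\<mu>\<^sup>0\<^sup>,\<^sup>1)\<close> in \<open>H\<^sub>\<mu>\<^sup>0\<^sup>,\<^sup>2\<close>; the elements of \<open>H\<^sub>\<mu>\<^sup>0\<^sup>,\<^sup>2\<close> are themselves
  cosets, added elementwise.\<close>

definition cls2 :: "('k::field, 'm::ab_group_add) gspace \<Rightarrow> ('k, 'w::ab_group_add) gspace \<Rightarrow>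
    ('m, 'w) cochain \<Rightarrow> ('m, 'w) cochain \<Rightarrow>
    ('m, 'w) cochain \<Rightarrow> ('m, 'w) cochain set set" where
  "cls2 M W \<mu> \<alpha> \<tau> = cls M W \<mu> 0 2 \<tau> +o (D_bar M W \<mu> \<alpha> 0 1 ` H_mu M W \<mu> 0 1)"

definition H02 :: "('k::field, 'm::ab_group_add) gspace \<Rightarrow> ('k, 'w::ab_group_add) gspace \<Rightarrow>
    ('m, 'w) cochain \<Rightarrow> ('m, 'w) cochain \<Rightarrow>
    ('m, 'w) cochain set set set" where
  "H02 M W \<mu> \<alpha> = cls2 M W \<mu> \<alpha> ` Z02 M W \<mu> \<alpha>"

text \<open>Action of \<open>h = g \<circ> exp(\<beta>)\<close> on \<open>H02\<close>, computed on odd representatives \<open>\<tau>\<close> of a class.\<close>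

definition act_H02 :: "('k::field, 'm::ab_group_add) gspace \<Rightarrow> ('k, 'w::ab_group_add) gspace \<Rightarrow>
    ('m, 'w) cochain \<Rightarrow> ('m, 'w) cochain \<Rightarrow>
    ('m, 'w) cochain \<Rightarrow> ('m, 'w) cochain \<Rightarrow>
    ('m \<times> 'w \<Rightarrow> 'm \<times> 'w) \<times> ('m, 'w) cochain \<Rightarrow>
    ('m, 'w) cochain set set \<Rightarrow> ('m, 'w) cochain set set" where
  "act_H02 M W \<delta> \<mu> lam \<psi> = (\<lambda>(g, \<beta>) c. let V = dsum M W in
     \<Union>\<tau>\<in>{\<tau> \<in> Z02 M W \<mu> (\<delta> + lam). cls2 M W \<mu> (\<delta> + lam) \<tau> = c}.
       cls2 M W \<mu> (\<delta> + lam) (pull g \<psi> - \<psi> + pull g \<tau>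
         + bracket V (\<delta> + lam - (\<lambda>vs. scl V (1 / 2) (bracket V \<mu> \<beta> vs))) \<beta>))"

definition H02_orbits :: "('k::field, 'm::ab_group_add) gspace \<Rightarrow> ('k, 'w::ab_group_add) gspace \<Rightarrow>
    ('m, 'w) cochain \<Rightarrow> ('m, 'w) cochain \<Rightarrow>
    ('m, 'w) cochain \<Rightarrow> ('m, 'w) cochain \<Rightarrow>
    ('m, 'w) cochain set set set set" where
  "H02_orbits M W \<delta> \<mu> lam \<psi> =
     orbits (G_dml M W \<delta> \<mu> lam) (act_H02 M W \<delta> \<mu> lam \<psi>) (H02 M W \<mu> (\<delta> + lam))"

end

theory Submission
  imports Defs
begin

text \<open>An automorphism \<open>h = g exp(\<beta>)\<close> of \<open>M \<oplus> W\<close> that preserves \<open>M\<close> moves the components of an extension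
  triangularly: \<open>\<delta>\<close> and \<open>\<mu>\<close> become \<open>g\<^sup>*\<delta>\<close> and \<open>g\<^sup>*\<mu>\<close>, then \<open>\<lambda>\<close> becomes \<open>g\<^sup>*\<lambda> + [\<mu>, \<beta>]\<close>, and finally \<open>\<psi>\<close>
  becomes \<open>g\<^sup>*\<psi> + [\<delta> + \<lambda>' - [\<mu>, \<beta>]/2, \<beta>]\<close> for the new \<open>\<lambda>'\<close>.  So one normalises \<open>\<delta>\<close> and \<open>\<mu>\<close> by \<open>g\<close>, then the class
  of \<open>\<lambda>\<close> by the stabiliser of \<open>(\<delta>, \<mu>)\<close>, then \<open>\<lambda>\<close> itself by \<open>\<beta>\<close>; what remains is the stabiliser of
  \<open>(\<delta>, \<mu>, \<lambda>)\<close>, which acts on the differences \<open>\<tau>\<close> of two admissible \<open>\<psi>\<close> by the formula that defines its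
  action on cohomology.  The elements \<open>exp(\<beta>)\<close> with \<open>[\<mu>, \<beta>] = 0\<close> account for the coboundaries of \<open>\<tau>\<close>.

  The coboundaries in the definitions range over inhomogeneous cochains.  A bracket with an odd
  cochain respects the parity decomposition, so the even part of \<open>\<beta>\<close> already produces an odd
  coboundary.\<close>

text \<open>Two encodings keep signs and bookkeeping manageable. Parity is read off from the
  involution v -> (-1)^|v| v: a cochain is homogeneous iff conjugation by it multiplies the cochain
  by a sign, so parity claims become equations to which naturality of the bracket applies. Bidegree
  is tested only on tensors with entries in M or in W; composition then amounts to counting letters,
  which kills most terms of [d, d] and ends the exponential series.

  The factor 1/2 comes from conjugation by exp(\<beta>): it sends d to d + [d, \<beta>] +
  [[d, \<beta>], \<beta>]/2, where only \<mu> contributes to the last term. Written with \<lambda>'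
  = \<lambda> + [\<mu>, \<beta>] in place of \<lambda>, the coefficient +1/2 of [[\<mu>, \<beta>],
  \<beta>] becomes -1/2.

  Each cohomological condition is translated once into the existence of a codifferential with given
  components. That moved components solve their equations then follows because automorphisms
  preserve codifferentials, and orbits in H^{0,2} are handled through the equivalence of
  extensions.\<close>

declare One_nat_def [simp del]

section \<open>Graded spaces and homogeneous cochains\<close>

text \<open>Division by 2 separates the two eigenspaces of the parity involution and gives the
  half-sums that project onto homogeneous parts.\<close>

locale graded =
  fixes U :: "('k::field, 'v::ab_group_add) gspace"
  assumes graded: "graded_space U" and two: "(2::'k) \<noteq> 0"
begin

sublocale vector_space "scl U"
  using graded by (simp add: graded_space_def)

sublocale vector_space_pair "scl U" "scl U" ..

abbreviation lin :: "('v \<Rightarrow> 'v) \<Rightarrow> bool" where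
  "lin \<equiv> Vector_Spaces.linear (scl U) (scl U)"

lemma linI: "(\<And>a b. f (a + b) = f a + f b) \<Longrightarrow> (\<And>c a. f (scl U c a) = scl U c (f a)) \<Longrightarrow> lin f"
  by (simp add: Vector_Spaces.linear_iff vector_space_axioms)

lemma hpart_subspace: "subspace (hpart U p)"
  using graded by (simp add: graded_space_def hpart_def)

lemma hpart_Suc_Suc [simp]: "hpart U (Suc (Suc p)) = hpart U p"
  by (simp add: hpart_def)

lemma hpart_Int_Suc: "a \<in> hpart U p \<Longrightarrow> a \<in> hpart U (Suc p) \<Longrightarrow> a = 0"
  using graded by (auto simp: graded_space_def hpart_def split: if_splits)

lemma hpart_decomp: "\<exists>a. a \<in> hpart U p \<and> v - a \<in> hpart U (Suc p)"
proof -
  obtain a b where "a \<in> evp U" "b \<in> odp U" "v = a + b"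
    using graded unfolding graded_space_def by blast
  then show ?thesis
    by (cases "even p") (auto simp: hpart_def intro: exI[of _ a] exI[of _ b])
qed

text \<open>Two candidates differ by an element of both parities, hence by 0. Projections are
  computed through this rule instead of the definite description.\<close>

lemma hproj_eqI:
  assumes "a \<in> hpart U p" "v - a \<in> hpart U (Suc p)"
  shows "hproj U p v = a"
  unfolding hproj_def
proof (rule the_equality)
  fix b assume b: "b \<in> hpart U p \<and> v - b \<in> hpart U (Suc p)"
  have "b - a \<in> hpart U p" "(v - a) - (v - b) \<in> hpart U (Suc p)"
    using assms b hpart_subspace subspace_diff by blast+
  then show "b = a"
    using hpart_Int_Suc[of "b - a" p] by simp
qed (use assms in simp)

lemma hproj_in: "hproj U p v \<in> hpart U p"
  and hproj_rest: "v - hproj U p v \<in> hpart U (Suc p)"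
  using hpart_decomp[of p v] hproj_eqI by metis+

lemma hproj_Suc: "hproj U (Suc p) v = v - hproj U p v"
  by (rule hproj_eqI) (simp_all add: hproj_in hproj_rest)

lemma hproj_1: "hproj U 1 v = v - hproj U 0 v"
  using hproj_Suc[of 0 v] by (simp add: One_nat_def)

lemma hproj_parity: "hproj U p v = (if even p then hproj U 0 v else hproj U 1 v)"
  by (induction p) (simp_all add: hproj_Suc hproj_1)

lemma hproj_id: "v \<in> hpart U p \<Longrightarrow> hproj U p v = v"
  by (rule hproj_eqI) (simp_all add: subspace_0 hpart_subspace)

lemma hproj_zero: "v \<in> hpart U (Suc p) \<Longrightarrow> hproj U p v = 0"
  by (rule hproj_eqI) (simp_all add: subspace_0 hpart_subspace)

lemma hproj_linear: "lin (hproj U p)"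
proof (rule linI)
  show "hproj U p (a + b) = hproj U p a + hproj U p b" for a b
  proof (rule hproj_eqI)
    have "(a - hproj U p a) + (b - hproj U p b) \<in> hpart U (Suc p)"
      by (intro subspace_add hpart_subspace hproj_rest)
    then show "a + b - (hproj U p a + hproj U p b) \<in> hpart U (Suc p)"
      by (simp add: algebra_simps)
  qed (intro subspace_add hpart_subspace hproj_in)
  show "hproj U p (scl U c a) = scl U c (hproj U p a)" for c a
  proof (rule hproj_eqI)
    have "scl U c (a - hproj U p a) \<in> hpart U (Suc p)"
      by (intro subspace_scale hpart_subspace hproj_rest)
    then show "scl U c a - scl U c (hproj U p a) \<in> hpart U (Suc p)"
      by (simp add: algebra_simps)
  qed (intro subspace_scale hpart_subspace hproj_in)
qed

lemmas hproj_add = linear_add[OF hproj_linear]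
  and hproj_scale = linear_scale[OF hproj_linear]

section \<open>The parity involution\<close>

definition K :: "'v \<Rightarrow> 'v" where
  "K = koszul U 1"

lemma K_eq: "K v = hproj U 0 v + hproj U 0 v - v"
  by (simp add: K_def koszul_def hproj_1)

lemma koszul_parity: "koszul U q = (if even q then id else K)"
  by (rule ext) (simp add: K_eq koszul_def hproj_1)

lemma K_linear: "lin K"
  by (rule linI) (simp_all add: K_eq hproj_add hproj_scale algebra_simps)

lemma koszul_linear: "lin (koszul U q)"
  using K_linear linear_id by (simp add: koszul_parity id_def)

lemma K_hpart: "v \<in> hpart U p \<Longrightarrow> K v = scl U ((-1) ^ p) v"
  using hproj_id[of v p] hproj_zero[of v "Suc p"]
  by (cases "even p") (simp_all add: K_eq hproj_parity[of p] hproj_Suc hproj_1)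

lemma double_eq_0: "(v::'v) + v = 0 \<Longrightarrow> v = 0"
proof -
  assume "v + v = 0"
  then have "scl U 2 v = 0"
    using scale_left_distrib[of 1 1 v] by simp
  then show "v = 0" using two by simp
qed

lemma double_eq: "(v::'v) + v = w + w \<Longrightarrow> v = w"
  using double_eq_0[of "v - w"] by (simp add: algebra_simps)

lemma K_invol [simp]: "K (K v) = v"
  by (simp add: K_eq linear_diff[OF hproj_linear] linear_add[OF hproj_linear] hproj_id[OF hproj_in])

text \<open>From right to left the equation fixes twice the even component, and 2 can be cancelled.
  Parity is thereby an eigenvalue condition, which linear maps commuting with \<open>K\<close>
  respect.\<close>

lemma hpart_iff_K: "v \<in> hpart U p \<longleftrightarrow> K v = scl U ((-1) ^ p) v"
proof
  assume *: "K v = scl U ((-1) ^ p) v"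
  show "v \<in> hpart U p"
  proof (cases "even p")
    case True
    then have "hproj U 0 v + hproj U 0 v = v + v"
      using * by (simp add: K_eq diff_eq_eq)
    then have "hproj U 0 v = v" by (rule double_eq)
    with hproj_in[of 0 v] True show ?thesis by (simp add: hpart_def)
  next
    case False
    then have "hproj U 0 v + hproj U 0 v = 0"
      using * by (simp add: K_eq)
    then have "hproj U 0 v = 0" by (rule double_eq_0)
    with hproj_rest[of v 0] False show ?thesis by (simp add: hpart_def)
  qed
qed (rule K_hpart)

section \<open>Multilinear maps on lists and their parity\<close>

lemma cochain_linear: "f \<in> cochains U \<Longrightarrow> lin (\<lambda>v. f (xs @ v # ys))"
  by (simp add: cochains_def)

lemma cochain_add: "f \<in> cochains U \<Longrightarrow> f (xs @ (a + b) # ys) = f (xs @ a # ys) + f (xs @ b # ys)"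
  using linear_add[OF cochain_linear] .

lemma cochain_scale: "f \<in> cochains U \<Longrightarrow> f (xs @ scl U c a # ys) = scl U c (f (xs @ a # ys))"
  using linear_scale[OF cochain_linear] .

lemma cochain_0: "f \<in> cochains U \<Longrightarrow> f (xs @ 0 # ys) = 0"
  using linear_0[OF cochain_linear] .

lemma zero_cochain: "0 \<in> cochains U"
  by (simp add: cochains_def zero_fun_def linear_zero)

lemma add_cochain: "f \<in> cochains U \<Longrightarrow> g \<in> cochains U \<Longrightarrow> f + g \<in> cochains U"
  by (simp add: cochains_def linear_compose_add)

lemma scale_cochain: "f \<in> cochains U \<Longrightarrow> (\<lambda>vs. scl U c (f vs)) \<in> cochains U"
  by (simp add: cochains_def linear_compose_scale_right)

lemma minus_cochain: "f \<in> cochains U \<Longrightarrow> - f \<in> cochains U"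
  using scale_cochain[of f "-1"] by (simp add: fun_Compl_def)

lemma diff_cochain: "f \<in> cochains U \<Longrightarrow> g \<in> cochains U \<Longrightarrow> f - g \<in> cochains U"
  using add_cochain[of f "- g"] minus_cochain[of g] by simp

text \<open>Entries are split one at a time, \<open>us\<close> being the part already split. The set
  \<open>S\<close> consists of the homogeneous vectors when parities are compared, and of M together
  with W inside the direct sum when bidegrees are.\<close>

lemma cochain_eqI:
  assumes f: "f \<in> cochains U" and g: "g \<in> cochains U"
    and S: "\<And>v. \<exists>a\<in>S. \<exists>b\<in>S. v = a + b"
    and eq: "\<And>vs. set vs \<subseteq> S \<Longrightarrow> f vs = g vs"
  shows "f = g"
proof
  have "set us \<subseteq> S \<Longrightarrow> f (us @ vs) = g (us @ vs)" for us vs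
  proof (induction vs arbitrary: us)
    case (Cons v vs)
    obtain a b where "a \<in> S" "b \<in> S" "v = a + b" using S by blast
    then show ?case
      using Cons.IH[of "us @ [a]"] Cons.IH[of "us @ [b]"] Cons.prems
      by (simp add: cochain_add f g)
  qed (simp add: eq)
  from this[of "[]"] show "f vs = g vs" for vs by simp
qed

lemma homogeneous_sum: "\<exists>a\<in>evp U \<union> odp U. \<exists>b\<in>evp U \<union> odp U. v = a + b"
  using graded unfolding graded_space_def by blast

lemma homogeneous_list:
  "set vs \<subseteq> evp U \<union> odp U \<Longrightarrow> \<exists>es. list_all2 (\<lambda>e v. v \<in> hpart U e) es vs"
proof (induction vs)
  case (Cons v vs)
  then obtain es where es: "list_all2 (\<lambda>e v. v \<in> hpart U e) es vs" by auto
  from Cons.prems have "v \<in> hpart U 0 \<or> v \<in> hpart U 1" by (auto simp: hpart_def)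
  with es show ?case
    by (metis list_all2_Cons)
qed simp

lemma cochain_map_K:
  assumes f: "f \<in> cochains U" and "list_all2 (\<lambda>e v. v \<in> hpart U e) es vs"
  shows "f (us @ map K vs) = scl U ((-1) ^ sum_list es) (f (us @ vs))"
  using assms(2)
proof (induction es vs arbitrary: us rule: list_all2_induct)
  case (Cons e es v vs)
  have "f (us @ map K (v # vs)) = scl U ((-1) ^ e) (f ((us @ [v]) @ map K vs))"
    using Cons.hyps(1) by (simp add: K_hpart cochain_scale f)
  also have "\<dots> = scl U ((-1) ^ e) (scl U ((-1) ^ sum_list es) (f ((us @ [v]) @ vs)))"
    unfolding Cons.IH ..
  finally show ?case by (simp add: power_add)
qed simp

lemma bij_K: "bij K"
  by (rule bijI') (metis K_invol)+

lemma inv_K [simp]: "inv K = K"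
  by (rule inv_equality) simp_all

lemma pull_K: "pull K f vs = K (f (map K vs))"
  by (simp add: pull_def)

lemma pull_K_cochain: "f \<in> cochains U \<Longrightarrow> pull K f \<in> cochains U"
proof -
  assume f: "f \<in> cochains U"
  have "lin (K \<circ> (\<lambda>v. f (map K xs @ v # map K ys)) \<circ> K)" for xs ys
    by (intro Vector_Spaces.linear_compose[where ?s2.0 = "scl U"] K_linear cochain_linear f)
  then show ?thesis by (simp add: cochains_def pull_K comp_def)
qed

text \<open>On homogeneous arguments the inner \<open>K\<close> contributes the sign of the
  arguments and the outer one the sign of the value, which leaves the sign of f itself;
  multilinearity extends the equation to all arguments. In this form closure under sums, scalars and
  automorphisms is formal.\<close>

lemma has_parity_iff:
  assumes f: "f \<in> cochains U"
  shows "has_parity U p f \<longleftrightarrow> pull K f = (\<lambda>vs. scl U ((-1) ^ p) (f vs))"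
proof
  assume hp: "has_parity U p f"
  show "pull K f = (\<lambda>vs. scl U ((-1) ^ p) (f vs))"
  proof (rule cochain_eqI[OF pull_K_cochain[OF f] scale_cochain[OF f] homogeneous_sum])
    fix vs assume "set vs \<subseteq> evp U \<union> odp U"
    then obtain es where es: "list_all2 (\<lambda>e v. v \<in> hpart U e) es vs"
      using homogeneous_list by blast
    with hp have "K (f vs) = scl U ((-1) ^ (p + sum_list es)) (f vs)"
      unfolding has_parity_def using K_hpart by blast
    then show "pull K f vs = scl U ((-1) ^ p) (f vs)"
      using cochain_map_K[OF f es, of "[]"]
      by (simp add: pull_K linear_scale[OF K_linear] power_add flip: power_mult_distrib)
  qed
next
  assume *: "pull K f = (\<lambda>vs. scl U ((-1) ^ p) (f vs))"
  show "has_parity U p f"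
    unfolding has_parity_def
  proof (intro allI impI)
    fix es vs assume es: "list_all2 (\<lambda>e v. v \<in> hpart U e) es vs"
    have "scl U ((-1) ^ sum_list es) (K (f vs)) = scl U ((-1) ^ p) (f vs)"
      using fun_cong[OF *, of vs] cochain_map_K[OF f es, of "[]"]
      by (simp add: pull_K linear_scale[OF K_linear])
    then have "scl U ((-1) ^ sum_list es) (scl U ((-1) ^ sum_list es) (K (f vs)))
        = scl U ((-1) ^ sum_list es) (scl U ((-1) ^ p) (f vs))"
      by simp
    then have "K (f vs) = scl U ((-1) ^ (p + sum_list es)) (f vs)"
      by (simp add: power_add mult.commute flip: power_mult_distrib)
    then show "f vs \<in> hpart U (p + sum_list es)"
      by (simp add: hpart_iff_K)
  qed
qed

definition hcochains :: "nat \<Rightarrow> ('v list \<Rightarrow> 'v) set" where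
  "hcochains p = {f \<in> cochains U. has_parity U p f}"

lemma hcochains_cochain: "f \<in> hcochains p \<Longrightarrow> f \<in> cochains U"
  by (simp add: hcochains_def)

lemma hcochains_iff: "f \<in> hcochains p \<longleftrightarrow> f \<in> cochains U \<and> pull K f = (\<lambda>vs. scl U ((-1) ^ p) (f vs))"
  by (auto simp: hcochains_def has_parity_iff)

lemma even_cochain: "f \<in> hcochains 0 \<longleftrightarrow> f \<in> cochains U \<and> pull K f = f"
  by (simp add: hcochains_iff)

lemma odd_cochain: "f \<in> hcochains 1 \<longleftrightarrow> f \<in> cochains U \<and> pull K f = - f"
  by (simp add: hcochains_iff fun_Compl_def)

lemma pull_K_linear: "pull K (f + g) = pull K f + pull K g"
   "pull K (- f) = - pull K f" "pull K (\<lambda>vs. scl U c (f vs)) = (\<lambda>vs. scl U c (pull K f vs))"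
  by (auto simp: pull_K linear_add[OF K_linear] linear_neg[OF K_linear] linear_scale[OF K_linear])

lemma add_hcochain: "f \<in> hcochains p \<Longrightarrow> g \<in> hcochains p \<Longrightarrow> f + g \<in> hcochains p"
  by (auto simp: hcochains_iff pull_K_linear add_cochain scale_right_distrib)

lemma minus_hcochain: "f \<in> hcochains p \<Longrightarrow> - f \<in> hcochains p"
  by (auto simp: hcochains_iff pull_K_linear minus_cochain)

lemma diff_hcochain: "f \<in> hcochains p \<Longrightarrow> g \<in> hcochains p \<Longrightarrow> f - g \<in> hcochains p"
  using add_hcochain[of f p "- g"] minus_hcochain[of g] by simp

lemma scale_hcochain: "f \<in> hcochains p \<Longrightarrow> (\<lambda>vs. scl U c (f vs)) \<in> hcochains p"
  by (auto simp: hcochains_iff pull_K_linear scale_cochain mult.commute)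

lemma zero_hcochain: "0 \<in> hcochains p"
  by (auto simp: hcochains_iff zero_cochain pull_K linear_0[OF K_linear])

text \<open>The eigenprojection of conjugation by \<open>K\<close>. Unlike the expansion in
  \<open>cpart\<close>, it is a combination of f and \<open>pull K f\<close> alone, so it stays
  inside every subspace stable under \<open>pull K\<close>.\<close>

definition homog_part :: "nat \<Rightarrow> ('v list \<Rightarrow> 'v) \<Rightarrow> 'v list \<Rightarrow> 'v" where
  "homog_part p f = (\<lambda>vs. scl U (1 / 2) (f vs + scl U ((-1) ^ p) (pull K f vs)))"

lemma homog_part_sum: "f = homog_part 0 f + homog_part 1 f"
proof
  fix vs
  have "homog_part 0 f vs + homog_part 1 f vs = scl U (1/2) (scl U 2 (f vs))"
    unfolding homog_part_def scale_right_distrib[symmetric]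
    using scale_left_distrib[of 1 1 "f vs"] by (simp add: algebra_simps)
  then show "f vs = (homog_part 0 f + homog_part 1 f) vs"
    using two by simp
qed

lemma homog_part_hcochain: "f \<in> cochains U \<Longrightarrow> homog_part p f \<in> hcochains p"
proof -
  assume f: "f \<in> cochains U"
  have c: "(\<lambda>vs. f vs + scl U ((-1) ^ p) (pull K f vs)) \<in> cochains U"
    using add_cochain[OF f scale_cochain[OF pull_K_cochain[OF f]]] by (simp add: plus_fun_def)
  have "pull K (homog_part p f) = (\<lambda>vs. scl U ((-1) ^ p) (homog_part p f vs))"
    by (rule ext) (simp add: homog_part_def pull_K linear_scale[OF K_linear] linear_add[OF K_linear]
        comp_def scale_right_distrib mult.assoc add.commute mult.left_commute flip: power_mult_distrib)
  then show ?thesis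
    using scale_cochain[OF c] by (simp add: hcochains_iff homog_part_def)
qed

lemma cochain_split:
  assumes "f \<in> cochains U"
  obtains f0 f1 where "f = f0 + f1" "f0 \<in> hcochains 0" "f1 \<in> hcochains 1"
  using homog_part_sum homog_part_hcochain[OF assms] by blast

lemma sum_bits_Cons:
  "(\<Sum>es | set es \<subseteq> {0, 1::nat} \<and> length es = Suc n. F es) =
   (\<Sum>es | set es \<subseteq> {0, 1} \<and> length es = n. F (0 # es)) +
   (\<Sum>es | set es \<subseteq> {0, 1} \<and> length es = n. F (1 # es) :: 'v)"
proof -
  let ?L = "\<lambda>n. {es. set es \<subseteq> {0, 1::nat} \<and> length es = n}"
  have L: "?L (Suc n) = Cons 0 ` ?L n \<union> Cons 1 ` ?L n"
    by (auto simp: length_Suc_conv)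
  have fin: "finite (?L n)"
    using finite_lists_length_eq[of "{0, 1::nat}" n] by simp
  show ?thesis
    unfolding L using fin by (subst sum.union_disjoint) (auto simp: sum.reindex)
qed

text \<open>Induction on the entries: summing over the parity of the first one rebuilds it by
  additivity. The prefix \<open>us\<close> carries the components already chosen.\<close>

lemma cochain_expand:
  assumes f: "f \<in> cochains U"
  shows "(\<Sum>es | set es \<subseteq> {0, 1} \<and> length es = length vs. f (us @ map2 (hproj U) es vs)) = f (us @ vs)"
proof (induction vs arbitrary: us)
  case (Cons v vs)
  have "(\<Sum>es | set es \<subseteq> {0, 1} \<and> length es = length (v # vs). f (us @ map2 (hproj U) es (v # vs)))
      = f (us @ hproj U 0 v # vs) + f (us @ hproj U 1 v # vs)"
    using Cons.IH[of "us @ [hproj U 0 v]"] Cons.IH[of "us @ [hproj U 1 v]"]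
    unfolding length_Cons sum_bits_Cons by simp
  also have "\<dots> = f (us @ v # vs)"
    by (simp add: hproj_1 flip: cochain_add[OF f])
  finally show ?case .
next
  case Nil
  have "{es. es = [] \<and> set es \<subseteq> {0, 1::nat}} = {[]}" by auto
  then show ?case by (simp add: conj_commute)
qed

text \<open>In each summand the value has the single parity prescribed by q, so the projection in
  \<open>cpart\<close> keeps all summands or none. This reduces \<open>bracket\<close> on
  homogeneous cochains to two compositions.\<close>

lemma cpart_hcochain:
  assumes f: "f \<in> hcochains q"
  shows "cpart U p f = (if even p \<longleftrightarrow> even q then f else 0)"
proof
  fix vs
  have "hproj U (p + sum_list es) (f (map2 (hproj U) es vs))
      = (if even p \<longleftrightarrow> even q then f (map2 (hproj U) es vs) else 0)"
    if "length es = length vs" for es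
  proof -
    have "list_all2 (\<lambda>e v. v \<in> hpart U e) es (map2 (hproj U) es vs)"
      using that by (auto simp: list_all2_conv_all_nth hproj_in)
    then have "f (map2 (hproj U) es vs) \<in> hpart U (q + sum_list es)"
      using f by (simp add: hcochains_def has_parity_def)
    then show ?thesis
      using hproj_id[of _ "p + sum_list es"] hproj_zero[of _ "p + sum_list es"]
      by (cases "even p"; cases "even q") (auto simp: hpart_def)
  qed
  then have "cpart U p f vs = (\<Sum>es | set es \<subseteq> {0, 1} \<and> length es = length vs.
      if even p \<longleftrightarrow> even q then f (map2 (hproj U) es vs) else 0)"
    unfolding cpart_def by (intro sum.cong) auto
  then show "cpart U p f vs = (if even p \<longleftrightarrow> even q then f else 0) vs"
    using cochain_expand[OF hcochains_cochain[OF f], where us = "[]" and vs = vs] by simp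
qed

lemma cpart_add: "cpart U p (f + g) = cpart U p f + cpart U p g"
  by (rule ext) (simp add: cpart_def hproj_add sum.distrib)

section \<open>Composition and the bracket\<close>

lemma lin_comp: "lin f \<Longrightarrow> lin g \<Longrightarrow> lin (\<lambda>v. g (f v))"
  using Vector_Spaces.linear_compose[of "scl U" "scl U" f "scl U" g] by (simp add: comp_def)

lemma circ_cochain:
  assumes f: "f \<in> cochains U" and g: "g \<in> cochains U"
  shows "circ U q f g \<in> cochains U"
proof -
  let ?k = "koszul U q"
  have "lin (\<lambda>v. f (map ?k (take i (xs @ v # ys)) @ g (take l (drop i (xs @ v # ys))) # drop (i + l) (xs @ v # ys)))"
    (is "lin ?F") for xs ys i l
  proof -
    \<comment> \<open>The varied entry is jumped over by g, fed to g, or stands after the block fed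
      to g. In the first two cases \<open>j\<close> is the number of entries of \<open>ys\<close>
      that share its fate.\<close>
    consider "length xs < i" | "i \<le> length xs" "length xs < i + l" | "i + l \<le> length xs"
      by linarith
    then show ?thesis
    proof cases
      case 1
      define j where "j = i - Suc (length xs)"
      have i: "i = length xs + Suc j" using 1 by (simp add: j_def)
      have "?F = (\<lambda>v. f (map ?k xs @ ?k v # map ?k (take j ys) @ g (take l (drop j ys)) # drop (j + l) ys))"
        by (simp add: i)
      then show ?thesis by (simp add: lin_comp[OF koszul_linear cochain_linear[OF f]])
    next
      case 2
      define j where "j = i + l - Suc (length xs)"
      have l: "l = length (drop i xs) + Suc j" and il: "i + l = length xs + Suc j"
        using 2 by (simp_all add: j_def)
      have "?F = (\<lambda>v. f (map ?k (take i xs) @ g (drop i xs @ v # take j ys) # drop j ys))"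
        unfolding il using 2(1) by (simp add: l)
      then show ?thesis by (simp add: lin_comp[OF cochain_linear[OF g] cochain_linear[OF f]])
    next
      case 3
      have "?F = (\<lambda>v. f ((map ?k (take i xs) @ g (take l (drop i xs)) # drop (i + l) xs) @ v # ys))"
        using 3 by simp
      then show ?thesis by (metis cochain_linear[OF f])
    qed
  qed
  then have "lin (\<lambda>v. circ U q f g (xs @ v # ys))" for xs ys
    unfolding circ_def length_append length_Cons
    by (intro linear_compose_sum ballI)
  then show ?thesis
    by (simp add: cochains_def)
qed

lemma circ_add_left: "circ U q (f + f') g = circ U q f g + circ U q f' g"
  by (rule ext) (simp add: circ_def sum.distrib)

lemma circ_add_right: "f \<in> cochains U \<Longrightarrow> circ U q f (g + g') = circ U q f g + circ U q f g'"
  by (rule ext) (simp add: circ_def sum.distrib cochain_add)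

lemma circ_scale_left: "circ U q (\<lambda>vs. scl U c (f vs)) g = (\<lambda>vs. scl U c (circ U q f g vs))"
  by (rule ext) (simp add: circ_def scale_sum_right)

lemma circ_scale_right:
  "f \<in> cochains U \<Longrightarrow> circ U q f (\<lambda>vs. scl U c (g vs)) = (\<lambda>vs. scl U c (circ U q f g vs))"
  by (rule ext) (simp add: circ_def scale_sum_right cochain_scale)

lemma circ_0_left: "circ U q 0 g = 0"
  by (rule ext) (simp add: circ_def)

lemma circ_0_right: "f \<in> cochains U \<Longrightarrow> circ U q f 0 = 0"
  by (rule ext) (simp add: circ_def cochain_0)

lemma bracket_hcochains:
  assumes f: "f \<in> hcochains p" and g: "g \<in> hcochains q" and pq: "p \<in> {0, 1}" "q \<in> {0, 1}"
  shows "bracket U f g = (\<lambda>vs. circ U q f g vs - scl U ((-1) ^ (p * q)) (circ U p g f vs))"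
proof
  fix vs
  note c = circ_0_left circ_0_right[OF hcochains_cochain[OF f]] circ_0_right[OF hcochains_cochain[OF g]]
    circ_0_right[OF zero_cochain]
  show "bracket U f g vs = circ U q f g vs - scl U ((-1) ^ (p * q)) (circ U p g f vs)"
    using pq by (auto simp: bracket_def cpart_hcochain[OF f] cpart_hcochain[OF g] c)
qed

text \<open>Additivity across the two parities is kept apart from additivity within one: the sign
  formula for the bracket presupposes homogeneous arguments, so here the definition by
  \<open>cpart\<close> is used directly.\<close>

lemma bracket_odd_split:
  assumes f: "f \<in> hcochains 1" and g: "g0 \<in> hcochains 0" "g1 \<in> hcochains 1"
  shows "bracket U f (g0 + g1) = bracket U f g0 + bracket U f g1"
proof
  fix vs
  note c = circ_0_left circ_0_right[OF hcochains_cochain[OF f]] circ_0_right[OF hcochains_cochain[OF g(1)]]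
    circ_0_right[OF hcochains_cochain[OF g(2)]]  circ_0_right[OF zero_cochain]
  show "bracket U f (g0 + g1) vs = (bracket U f g0 + bracket U f g1) vs"
    by (simp add: bracket_def cpart_add cpart_hcochain[OF f] cpart_hcochain[OF g(1)] cpart_hcochain[OF g(2)] c)
qed

lemma bracket_odd_odd:
  "f \<in> hcochains 1 \<Longrightarrow> g \<in> hcochains 1 \<Longrightarrow> bracket U f g = circ U 1 f g + circ U 1 g f"
  by (rule ext) (simp add: bracket_hcochains)

lemma bracket_odd_even:
  "f \<in> hcochains 1 \<Longrightarrow> g \<in> hcochains 0 \<Longrightarrow> bracket U f g = circ U 0 f g - circ U 1 g f"
  by (rule ext) (simp add: bracket_hcochains)

lemma bracket_add_left:
  assumes "f \<in> hcochains 1" "f' \<in> hcochains 1" "g \<in> hcochains q" "q \<in> {0, 1}"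
  shows "bracket U (f + f') g = bracket U f g + bracket U f' g"
  using assms by (auto simp: bracket_hcochains[of _ 1 _ q] add_hcochain circ_add_left
      circ_add_right hcochains_cochain fun_eq_iff scale_right_distrib algebra_simps)

lemma bracket_hadd_right:
  assumes "f \<in> hcochains 1" "g \<in> hcochains q" "g' \<in> hcochains q" "q \<in> {0, 1}"
  shows "bracket U f (g + g') = bracket U f g + bracket U f g'"
  using assms by (auto simp: bracket_hcochains[of _ 1 _ q] add_hcochain circ_add_left
      circ_add_right hcochains_cochain fun_eq_iff scale_right_distrib algebra_simps)

lemma bracket_scale_right_h:
  assumes "f \<in> hcochains 1" "g \<in> hcochains q" "q \<in> {0, 1}"
  shows "bracket U f (\<lambda>vs. scl U c (g vs)) = (\<lambda>vs. scl U c (bracket U f g vs))"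
  using assms by (auto simp: bracket_hcochains[of _ 1 _ q] scale_hcochain circ_scale_left
      circ_scale_right hcochains_cochain fun_eq_iff scale_right_diff_distrib mult.commute)

lemma bracket_scale_left:
  assumes "f \<in> hcochains 1" "g \<in> hcochains q" "q \<in> {0, 1}"
  shows "bracket U (\<lambda>vs. scl U c (f vs)) g = (\<lambda>vs. scl U c (bracket U f g vs))"
  using assms by (auto simp: bracket_hcochains[of _ 1 _ q] scale_hcochain circ_scale_left
      circ_scale_right hcochains_cochain fun_eq_iff scale_right_diff_distrib mult.commute)

text \<open>Inhomogeneous second arguments occur because coboundaries are taken over all of
  \<open>C\<close>. Both summands are split by parity and regrouped.\<close>

lemma bracket_add_right:
  assumes f: "f \<in> hcochains 1" and "g \<in> cochains U" "g' \<in> cochains U"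
  shows "bracket U f (g + g') = bracket U f g + bracket U f g'"
proof -
  obtain g0 g1 g0' g1' where g: "g = g0 + g1" "g0 \<in> hcochains 0" "g1 \<in> hcochains 1"
    and g': "g' = g0' + g1'" "g0' \<in> hcochains 0" "g1' \<in> hcochains 1"
    using assms(2,3) cochain_split by metis
  have "bracket U f (g + g') = bracket U f ((g0 + g0') + (g1 + g1'))"
    by (simp only: g(1) g'(1) ac_simps)
  also have "\<dots> = bracket U f (g0 + g0') + bracket U f (g1 + g1')"
    by (intro bracket_odd_split f add_hcochain g g')
  also have "\<dots> = (bracket U f g0 + bracket U f g0') + (bracket U f g1 + bracket U f g1')"
    by (simp only: bracket_hadd_right[OF f g(2) g'(2)] bracket_hadd_right[OF f g(3) g'(3)] insert_iff simp_thms)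
  also have "\<dots> = (bracket U f g0 + bracket U f g1) + (bracket U f g0' + bracket U f g1')"
    by (simp only: ac_simps)
  finally show ?thesis
    by (simp only: g(1) g'(1) bracket_odd_split[OF f g(2,3)] bracket_odd_split[OF f g'(2,3)])
qed

lemma bracket_scale_right:
  assumes f: "f \<in> hcochains 1" and "g \<in> cochains U"
  shows "bracket U f (\<lambda>vs. scl U c (g vs)) = (\<lambda>vs. scl U c (bracket U f g vs))"
proof -
  obtain g0 g1 where g: "g = g0 + g1" "g0 \<in> hcochains 0" "g1 \<in> hcochains 1"
    using assms(2) cochain_split by metis
  have "bracket U f (\<lambda>vs. scl U c (g vs)) = bracket U f ((\<lambda>vs. scl U c (g0 vs)) + (\<lambda>vs. scl U c (g1 vs)))"
    by (simp add: g(1) scale_right_distrib plus_fun_def)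
  also have "\<dots> = bracket U f (\<lambda>vs. scl U c (g0 vs)) + bracket U f (\<lambda>vs. scl U c (g1 vs))"
    by (intro bracket_odd_split f scale_hcochain g)
  also have "\<dots> = (\<lambda>vs. scl U c (bracket U f g0 vs)) + (\<lambda>vs. scl U c (bracket U f g1 vs))"
    by (simp only: bracket_scale_right_h[OF f g(2)] bracket_scale_right_h[OF f g(3)] insert_iff simp_thms)
  also have "\<dots> = (\<lambda>vs. scl U c (bracket U f g vs))"
    by (simp add: g(1) bracket_odd_split[OF f g(2,3)] scale_right_distrib fun_eq_iff)
  finally show ?thesis .
qed

lemma bracket_minus_right:
  "f \<in> hcochains 1 \<Longrightarrow> g \<in> cochains U \<Longrightarrow> bracket U f (- g) = - bracket U f g"
  using bracket_scale_right[of f g "-1"] by (simp add: fun_Compl_def)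

lemma bracket_minus_left:
  "f \<in> hcochains 1 \<Longrightarrow> g \<in> hcochains q \<Longrightarrow> q \<in> {0, 1} \<Longrightarrow> bracket U (- f) g = - bracket U f g"
  using bracket_scale_left[of f g q "-1"] by (simp add: fun_Compl_def)

lemma bracket_diff_right:
  "f \<in> hcochains 1 \<Longrightarrow> g \<in> cochains U \<Longrightarrow> g' \<in> cochains U \<Longrightarrow>
    bracket U f (g - g') = bracket U f g - bracket U f g'"
  using bracket_add_right[of f g "- g'"] by (simp add: bracket_minus_right minus_cochain)

lemma bracket_diff_left:
  "f \<in> hcochains 1 \<Longrightarrow> f' \<in> hcochains 1 \<Longrightarrow> g \<in> hcochains q \<Longrightarrow> q \<in> {0, 1} \<Longrightarrow>
    bracket U (f - f') g = bracket U f g - bracket U f' g"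
  using bracket_add_left[of f "- f'" g q] by (simp add: bracket_minus_left minus_hcochain)

lemma bracket_0_right: "f \<in> hcochains 1 \<Longrightarrow> bracket U f 0 = 0"
  using bracket_diff_right[of f 0 0] by (simp add: zero_cochain)

lemma bracket_cochain:
  assumes f: "f \<in> hcochains 1" and g: "g \<in> cochains U"
  shows "bracket U f g \<in> cochains U"
proof -
  obtain g0 g1 where g: "g = g0 + g1" "g0 \<in> hcochains 0" "g1 \<in> hcochains 1"
    using assms(2) cochain_split by metis
  then show ?thesis
    by (simp add: bracket_odd_split f bracket_odd_odd bracket_odd_even add_cochain diff_cochain
        circ_cochain hcochains_cochain[OF f] hcochains_cochain[OF g(2)] hcochains_cochain[OF g(3)])
qed

section \<open>Automorphisms and naturality of the bracket\<close>

lemma GL_K: "h \<in> GL U \<Longrightarrow> h (K v) = K (h v)"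
proof -
  assume h: "h \<in> GL U"
  then have l: "lin h" by (simp add: GL_def)
  have "h (hproj U 0 v) = hproj U 0 (h v)"
  proof (rule hproj_eqI[symmetric])
    show "h (hproj U 0 v) \<in> hpart U 0"
      using h hproj_in[of 0 v] by (auto simp: GL_def hpart_def)
    have "h (v - hproj U 0 v) \<in> hpart U (Suc 0)"
      using h hproj_rest[of v 0] by (auto simp: GL_def hpart_def)
    then show "h v - h (hproj U 0 v) \<in> hpart U (Suc 0)"
      by (simp add: linear_diff[OF l])
  qed
  then show ?thesis
    by (simp add: K_eq linear_diff[OF l] linear_add[OF l])
qed

text \<open>Commutation with \<open>K\<close> passes to composites and to the inverse at once,
  whereas the definition of \<open>GL\<close> asks only for inclusions of the homogeneous
  subspaces.\<close>

lemma GL_iff: "h \<in> GL U \<longleftrightarrow> lin h \<and> bij h \<and> (\<forall>v. h (K v) = K (h v))"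
proof (intro iffI conjI allI)
  assume *: "lin h \<and> bij h \<and> (\<forall>v. h (K v) = K (h v))"
  then have l: "lin h" by simp
  have "v \<in> hpart U p \<Longrightarrow> h v \<in> hpart U p" for v p
    using * unfolding hpart_iff_K by (metis linear_scale[OF l])
  from this[of _ 0] this[of _ 1] show "h \<in> GL U"
    using * by (auto simp: GL_def hpart_def)
qed (auto simp: GL_K GL_def)

lemma id_GL: "id \<in> GL U"
  by (simp add: GL_iff linear_id)

lemma comp_GL: "g \<in> GL U \<Longrightarrow> h \<in> GL U \<Longrightarrow> g \<circ> h \<in> GL U"
  unfolding GL_iff by (auto simp: bij_comp intro: Vector_Spaces.linear_compose)

lemma inv_GL: "h \<in> GL U \<Longrightarrow> inv h \<in> GL U"
proof -
  assume h: "h \<in> GL U"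
  then have l: "lin h" and b: "bij h" by (auto simp: GL_iff)
  have i: "h (inv h v) = v" "inv h (h v) = v" for v
    using b by (simp_all add: bij_is_surj surj_f_inv_f bij_is_inj)
  have "lin (inv h)"
  proof (rule linI)
    show "inv h (a + b) = inv h a + inv h b" for a b
      using i(2)[of "inv h a + inv h b"] by (simp add: linear_add[OF l] i)
    show "inv h (scl U c a) = scl U c (inv h a)" for c a
      using i(2)[of "scl U c (inv h a)"] by (simp add: linear_scale[OF l] i)
  qed
  moreover have "inv h (K v) = K (inv h v)" for v
    by (metis GL_K h i)
  ultimately show ?thesis
    by (simp add: GL_iff b bij_imp_bij_inv)
qed

lemma GL_koszul: "h \<in> GL U \<Longrightarrow> h (koszul U q v) = koszul U q (h v)"
  by (simp add: koszul_parity GL_K)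

lemma pull_cochain:
  assumes "h \<in> GL U" "f \<in> cochains U"
  shows "pull h f \<in> cochains U"
  unfolding cochains_def pull_def
proof (intro CollectI allI)
  fix xs ys
  have "lin h" "lin (inv h)" using assms inv_GL by (auto simp: GL_def)
  then show "lin (\<lambda>v. inv h (f (map h (xs @ v # ys))))"
    using lin_comp[of "\<lambda>v. f (map h xs @ h v # map h ys)" "inv h"]
      lin_comp[OF _ cochain_linear[OF assms(2)], of h] by simp
qed

lemma pull_hcochain: "h \<in> GL U \<Longrightarrow> f \<in> hcochains p \<Longrightarrow> pull h f \<in> hcochains p"
proof -
  assume h: "h \<in> GL U" and f: "f \<in> hcochains p"
  have l: "lin (inv h)" using h inv_GL by (auto simp: GL_def)
  have "pull K (pull h f) = pull h (pull K f)"
    using h GL_K[OF inv_GL[OF h]] by (simp add: pull_def[of h] pull_K fun_eq_iff GL_K comp_def)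
  then show ?thesis
    using h f by (simp add: hcochains_iff pull_cochain) (simp add: fun_eq_iff pull_def linear_scale[OF l])
qed

lemma pull_add: "h \<in> GL U \<Longrightarrow> pull h (f + g) = pull h f + pull h g"
  and pull_diff: "h \<in> GL U \<Longrightarrow> pull h (f - g) = pull h f - pull h g"
  and pull_0: "h \<in> GL U \<Longrightarrow> pull h 0 = 0"
proof -
  assume "h \<in> GL U"
  then have l: "lin (inv h)" using inv_GL by (auto simp: GL_def)
  show "pull h (f + g) = pull h f + pull h g" "pull h (f - g) = pull h f - pull h g" "pull h 0 = 0"
    by (auto simp: pull_def linear_add[OF l] linear_diff[OF l] linear_0[OF l])
qed

text \<open>Between the outer and the inner cochain h meets its inverse and cancels; over the
  entries jumped it commutes with the Koszul twist because it is even.\<close>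

lemma pull_circ:
  assumes h: "h \<in> GL U"
  shows "pull h (circ U q f g) = circ U q (pull h f) (pull h g)"
proof
  fix vs
  have l: "lin (inv h)" using h inv_GL by (auto simp: GL_def)
  have i: "h (inv h v) = v" for v
    using h by (simp add: GL_def bij_is_surj surj_f_inv_f)
  have c: "h \<circ> koszul U q = koszul U q \<circ> h"
    using h by (auto simp: GL_koszul)
  show "pull h (circ U q f g) vs = circ U q (pull h f) (pull h g) vs"
    by (simp add: pull_def circ_def linear_sum[OF l] i c take_map drop_map)
qed

lemma pull_bracket:
  assumes h: "h \<in> GL U" and f: "f \<in> hcochains 1" and g: "g \<in> hcochains q" "q \<in> {0, 1}"
  shows "pull h (bracket U f g) = bracket U (pull h f) (pull h g)"
  using g h f by (auto simp: bracket_odd_odd bracket_odd_even pull_hcochain pull_add pull_diff pull_circ)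

text \<open>The involution \<open>K\<close> is itself an automorphism, so naturality applied to it
  gives the eigenvalue of the bracket as the product of those of f and g. The parity 1 + q modulo 2
  is written 1 - q.\<close>

lemma bracket_hcochain:
  assumes f: "f \<in> hcochains 1" and g: "g \<in> hcochains q" "q \<in> {0, 1}"
  shows "bracket U f g \<in> hcochains (1 - q)"
proof -
  have K: "K \<in> GL U"
    using GL_iff K_linear bij_K by blast
  show ?thesis
    using g bracket_cochain[OF f hcochains_cochain[OF g(1)]] pull_bracket[OF K f g] f
      bracket_minus_left[OF f g(1)] bracket_minus_right[OF minus_hcochain[OF f] hcochains_cochain[OF g(1)]]
    by (auto simp: odd_cochain even_cochain)
qed

text \<open>The two components of the bracket have different parities, so one of them vanishes.\<close>

lemma bracket_odd_part:
  assumes f: "f \<in> hcochains 1" and g: "g = g0 + g1" "g0 \<in> hcochains 0" "g1 \<in> hcochains 1"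
  shows "bracket U f g \<in> hcochains 1 \<Longrightarrow> bracket U f g = bracket U f g0"
    and "bracket U f g \<in> hcochains 0 \<Longrightarrow> bracket U f g = bracket U f g1"
proof -
  have K: "K \<in> GL U"
    using GL_iff K_linear bij_K by blast
  let ?a = "bracket U f g0" and ?b = "bracket U f g1"
  have e: "bracket U f g = ?a + ?b" by (simp add: f g bracket_odd_split)
  have "?a \<in> hcochains 1" "?b \<in> hcochains 0"
    using bracket_hcochain[OF f g(2)] bracket_hcochain[OF f g(3)] by simp_all
  then have p: "pull K (bracket U f g) = - ?a + ?b"
    unfolding e pull_add[OF K] odd_cochain even_cochain by simp
  show "bracket U f g = ?a" if "bracket U f g \<in> hcochains 1"
  proof -
    have "?b = 0"
    proof
      fix vs
      \<comment> \<open>Conjugation by \<open>K\<close> negates the odd component only, so adding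
        the conjugate to the bracket doubles the even one.\<close>
      have "?b vs + ?b vs = bracket U f g vs + pull K (bracket U f g) vs"
        unfolding p unfolding e by simp
      also have "\<dots> = 0"
        using that by (simp add: odd_cochain)
      finally show "?b vs = 0 vs"
        using double_eq_0[of "?b vs"] by simp
    qed
    then show ?thesis using e by simp
  qed
  show "bracket U f g = ?b" if "bracket U f g \<in> hcochains 0"
  proof -
    have "?a = 0"
    proof
      fix vs
      have "?a vs + ?a vs = bracket U f g vs - pull K (bracket U f g) vs"
        unfolding p unfolding e by simp
      also have "\<dots> = 0"
        using that by (simp add: even_cochain)
      finally show "?a vs = 0 vs"
        using double_eq_0[of "?a vs"] by simp
    qed
    then show ?thesis using e by simp
  qed
qed

lemma cochain_zero_entry: "f \<in> cochains U \<Longrightarrow> 0 \<in> set vs \<Longrightarrow> f vs = 0"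
  by (auto dest!: split_list simp: cochain_0)

lemma pull_bracket_cochain:
  assumes h: "h \<in> GL U" and f: "f \<in> hcochains 1" and g: "g \<in> cochains U"
  shows "pull h (bracket U f g) = bracket U (pull h f) (pull h g)"
proof -
  obtain g0 g1 where s: "g = g0 + g1" "g0 \<in> hcochains 0" "g1 \<in> hcochains 1"
    using g cochain_split by metis
  note p = pull_hcochain[OF h]
  show ?thesis
    unfolding s(1) pull_add[OF h] bracket_odd_split[OF f s(2,3)] bracket_odd_split[OF p[OF f] p[OF s(2)] p[OF s(3)]]
    using pull_bracket[OF h f s(2)] pull_bracket[OF h f s(3)] by simp
qed

text \<open>Naturality carries [d, d] = 0 along. Thus the component equations of an extension hold
  after any change of coordinates without being recomputed.\<close>

lemma pull_codifferential:
  assumes h: "h \<in> GL U" and d: "d \<in> codifferentials U"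
  shows "pull h d \<in> codifferentials U"
proof -
  have d1: "d \<in> hcochains 1" and len: "length vs \<noteq> 2 \<Longrightarrow> d vs = 0" and b: "bracket U d d = 0" for vs
    using d by (auto simp: codifferentials_def Hom_def hcochains_def)
  have "inv h 0 = 0"
    using inv_GL[OF h] linear_0[of "inv h"] by (simp add: GL_def)
  then have "length vs \<noteq> 2 \<Longrightarrow> pull h d vs = 0" for vs
    using len by (simp add: pull_def)
  moreover have "bracket U (pull h d) (pull h d) = 0"
    using pull_bracket[OF h d1 d1] by (simp add: b pull_0[OF h])
  ultimately show ?thesis
    using pull_hcochain[OF h d1] by (auto simp: codifferentials_def Hom_def hcochains_def)
qed

end


section \<open>Bigraded cochains on a direct sum\<close>

lemma dsum_simps [simp]:
  "scl (dsum M W) c v = (scl M c (fst v), scl W c (snd v))"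
  "evp (dsum M W) = evp M \<times> evp W" "odp (dsum M W) = odp M \<times> odp W"
  by (simp_all add: dsum_def split_beta)

lemma hpart_dsum: "hpart (dsum M W) p = hpart M p \<times> hpart W p"
  by (simp add: hpart_def)

lemma graded_space_dsum:
  assumes "graded_space M" "graded_space W"
  shows "graded_space (dsum M W)"
proof -
  have m: "vector_space (scl M)" "vector_space (scl W)"
    using assms by (simp_all add: graded_space_def)
  note ms = m[THEN vector_space.vector_space_assms(1)] m[THEN vector_space.vector_space_assms(2)]
      m[THEN vector_space.vector_space_assms(3)] m[THEN vector_space.vector_space_assms(4)]
  have v: "vector_space (scl (dsum M W))"
    by unfold_locales (simp_all add: ms)
  have mod: "module (scl M)" "module (scl W)" "module (scl (dsum M W))"
    using m v by (simp_all add: module_iff_vector_space)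
  have "\<exists>a\<in>evp M \<times> evp W. \<exists>b\<in>odp M \<times> odp W. v = a + b" for v
  proof -
    obtain a b a' b' where "a \<in> evp M" "b \<in> odp M" "fst v = a + b"
      "a' \<in> evp W" "b' \<in> odp W" "snd v = a' + b'"
      using assms unfolding graded_space_def by metis
    then show ?thesis
      by (intro bexI[of _ "(a, a')"] bexI[of _ "(b, b')"]) (simp_all add: prod_eq_iff)
  qed
  then show ?thesis
    using assms v unfolding graded_space_def dsum_simps(2,3)
    by (auto simp: mod[THEN module.subspace_def] zero_prod_def)
qed

abbreviation nM :: "('m + 'w) list \<Rightarrow> nat" where
  "nM xs \<equiv> length (filter isl xs)"

abbreviation nW :: "('m + 'w) list \<Rightarrow> nat" where
  "nW xs \<equiv> length (filter (\<lambda>x. \<not> isl x) xs)"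

lemma fst_sum: "fst (sum f A) = (\<Sum>x\<in>A. fst (f x))"
  and snd_sum: "snd (sum f A) = (\<Sum>x\<in>A. snd (f x))"
  by (induction A rule: infinite_finite_induct) auto

lemma fst_summand: "\<not> isl x \<Longrightarrow> fst (summand x) = 0"
  and snd_summand: "isl x \<Longrightarrow> snd (summand x) = 0"
  by (cases x; simp add: summand_def)+

lemma inv_map_prod: "bij a \<Longrightarrow> bij b \<Longrightarrow> inv (map_prod a b) = map_prod (inv a) (inv b)"
  by (rule inv_unique_comp) (simp_all add: map_prod.comp surj_iff[THEN iffD1] inj_iff[THEN iffD1]
      bij_is_surj bij_is_inj map_prod.id)

lemma bij_map_prod: "bij a \<Longrightarrow> bij b \<Longrightarrow> bij (map_prod a b)"
  by (simp add: bij_def prod.inj_map map_prod_surj)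

section \<open>Pullback, cosets and orbit representatives\<close>

lemma pull_comp: "bij g \<Longrightarrow> bij h \<Longrightarrow> pull (g \<circ> h) f = pull h (pull g f)"
  by (rule ext) (simp add: pull_def o_inv_distrib)

lemma pull_id: "pull id f = f"
  by (rule ext) (simp add: pull_def)

lemma pull_inv: "bij h \<Longrightarrow> pull (inv h) (pull h f) = f"
  by (rule ext) (simp add: pull_def bij_is_surj surj_f_inv_f inv_inv_eq comp_def)

lemma coset_eq_iff:
  fixes B :: "'a::ab_group_add set"
  assumes "0 \<in> B" "\<And>x y. x \<in> B \<Longrightarrow> y \<in> B \<Longrightarrow> x - y \<in> B"
  shows "a +o B = b +o B \<longleftrightarrow> b - a \<in> B"
proof
  assume "a +o B = b +o B"
  moreover have "b \<in> b +o B" using assms(1) by (auto simp: elt_set_plus_def)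
  ultimately have "b \<in> a +o B" by simp
  then show "b - a \<in> B" by (auto simp: elt_set_plus_def)
next
  assume ba: "b - a \<in> B"
  then have ab: "- (b - a) \<in> B" using assms(2)[OF assms(1) ba] by simp
  show "a +o B = b +o B"
  proof (intro set_eqI iffI)
    fix x assume "x \<in> a +o B"
    then have "x - b \<in> B" using assms(2)[of "x - a" "b - a"] ba by (auto simp: elt_set_plus_def)
    then show "x \<in> b +o B" unfolding elt_set_plus_def by (auto intro!: bexI[of _ "x - b"])
  next
    fix x assume "x \<in> b +o B"
    then have "x - a \<in> B" using assms(2)[of "x - b" "- (b - a)"] ab by (auto simp: elt_set_plus_def)
    then show "x \<in> a +o B" unfolding elt_set_plus_def by (auto intro!: bexI[of _ "x - a"])
  qed
qed

lemma orbitI: "g \<in> G \<Longrightarrow> act g x = y \<Longrightarrow> y \<in> orbit G act x"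
  by (auto simp: orbit_def)

lemma representatives_unique:
  assumes "representatives G act X R" "r \<in> R" "r' \<in> R" "r \<in> orbit G act r" "r' \<in> orbit G act r"
  shows "r = r'"
proof -
  have "orbit G act r \<in> orbits G act X"
    using assms(1,2) by (auto simp: representatives_def orbits_def)
  then have "\<exists>!s. s \<in> R \<and> s \<in> orbit G act r"
    using assms(1) unfolding representatives_def by blast
  with assms(2-5) show ?thesis by blast
qed

lemma representatives_obtain:
  assumes "representatives G act X R" "x \<in> X"
  obtains g where "g \<in> G" "act g x \<in> R"
proof -
  have "orbit G act x \<in> orbits G act X"
    using assms(2) by (simp add: orbits_def)
  then obtain r where "r \<in> R" "r \<in> orbit G act x"
    using assms(1) unfolding representatives_def by blast
  with that show ?thesis by (auto simp: orbit_def)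
qed

lemma representatives_subset: "representatives G act X R \<Longrightarrow> r \<in> R \<Longrightarrow> r \<in> X"
  by (auto simp: representatives_def)

locale graded_pair = M: graded M + W: graded W
  for M :: "('k::field, 'm::ab_group_add) gspace" and W :: "('k, 'w::ab_group_add) gspace"
begin

abbreviation V :: "('k, 'm \<times> 'w) gspace" where
  "V \<equiv> dsum M W"

sublocale V: graded V
  using graded_space_dsum[OF M.graded W.graded] M.two by unfold_locales

lemma V_linear_iff: "V.lin f \<longleftrightarrow> (\<forall>a b. f (a + b) = f a + f b) \<and> (\<forall>c a. f (scl V c a) = scl V c (f a))"
  by (simp add: Vector_Spaces.linear_iff V.vector_space_axioms)

lemma hproj_dsum: "hproj V p v = (hproj M p (fst v), hproj W p (snd v))"
proof (rule V.hproj_eqI)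
  show "(hproj M p (fst v), hproj W p (snd v)) \<in> hpart V p"
    "v - (hproj M p (fst v), hproj W p (snd v)) \<in> hpart V (Suc p)"
    using M.hproj_in W.hproj_in M.hproj_rest W.hproj_rest
    by (auto simp: hpart_dsum minus_prod_def)
qed

lemma koszul_dsum: "koszul V q v = (koszul M q (fst v), koszul W q (snd v))"
  by (simp add: koszul_def hproj_dsum)

lemma koszul_summand: "koszul V q (summand x) = summand (map_sum (koszul M q) (koszul W q) x)"
  using M.linear_0[OF M.koszul_linear] W.linear_0[OF W.koszul_linear]
  by (cases x) (simp_all add: summand_def koszul_dsum)

text \<open>\<open>C\<^sup>k\<^sup>,\<^sup>l\<close> if \<open>s\<close>, and \<open>Hom(T\<^sup>k\<^sup>,\<^sup>l(M, W), W)\<close> otherwise, so that \<open>\<delta>\<close> has a type as well.\<close>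

definition typed :: "bool \<Rightarrow> nat \<Rightarrow> nat \<Rightarrow> ('m, 'w) cochain set" where
  "typed s k l = {f \<in> cochains V. (\<forall>vs. if s then snd (f vs) = 0 else fst (f vs) = 0) \<and>
     (\<forall>xs. \<not> (nM xs = k \<and> nW xs = l) \<longrightarrow> f (map summand xs) = 0)}"

lemma C_typed: "C M W k l = typed True k l"
  by (simp add: C_def typed_def)

lemma C_par_typed: "C_par M W p k l = typed True k l \<inter> V.hcochains p"
  by (auto simp: C_par_def C_typed V.hcochains_def typed_def)

lemma typed_cochain: "f \<in> typed s k l \<Longrightarrow> f \<in> cochains V"
  by (simp add: typed_def)

lemma typed_apply: "f \<in> typed s k l \<Longrightarrow> \<not> (nM xs = k \<and> nW xs = l) \<Longrightarrow> f (map summand xs) = 0"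
  unfolding typed_def by blast

lemma typed_value: "f \<in> typed s k l \<Longrightarrow> if s then snd (f vs) = 0 else fst (f vs) = 0"
  unfolding typed_def by blast

lemma typed_subspace:
  "0 \<in> typed s k l"
  "f \<in> typed s k l \<Longrightarrow> g \<in> typed s k l \<Longrightarrow> f + g \<in> typed s k l"
  "f \<in> typed s k l \<Longrightarrow> (\<lambda>vs. scl V c (f vs)) \<in> typed s k l"
  "f \<in> typed s k l \<Longrightarrow> - f \<in> typed s k l"
  "f \<in> typed s k l \<Longrightarrow> g \<in> typed s k l \<Longrightarrow> f - g \<in> typed s k l"
  using V.zero_cochain V.add_cochain[of f g] V.scale_cochain[of f c] V.minus_cochain[of f] V.diff_cochain[of f g]
  by (cases s; auto simp: typed_def prod_eq_iff)+

lemma summand_sum: "\<exists>a\<in>range summand. \<exists>b\<in>range summand. (v :: 'm \<times> 'w) = a + b"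
proof -
  have "v = summand (Inl (fst v)) + summand (Inr (snd v))"
    by (simp add: summand_def prod_eq_iff)
  then show ?thesis by blast
qed

lemma cochain_eq_summand:
  assumes "f \<in> cochains V" "g \<in> cochains V" "\<And>xs. f (map summand xs) = g (map summand xs)"
  shows "f = g"
proof (rule V.cochain_eqI[OF assms(1,2) summand_sum])
  fix vs :: "('m \<times> 'w) list" assume "set vs \<subseteq> range summand"
  then obtain xs where "vs = map summand xs"
    using ex_map_conv[of vs summand] by blast
  then show "f vs = g vs" using assms(3) by simp
qed

text \<open>The bidegree condition only speaks of tensors with entries in the summands. Cutting f
  off outside arity k + l gives a multilinear map that agrees with f on these, hence equals
  f.\<close>

lemma typed_length:
  assumes f: "f \<in> typed s k l" and len: "length vs \<noteq> k + l"
  shows "f vs = 0"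
proof -
  let ?f = "\<lambda>vs. if length vs = k + l then f vs else 0"
  have "?f \<in> cochains V"
    unfolding cochains_def
  proof (intro CollectI allI)
    show "V.lin (\<lambda>v. ?f (xs @ v # ys))" for xs ys
      using V.cochain_linear[OF typed_cochain[OF f], of xs ys] V.linear_zero
      by (cases "length (xs @ undefined # ys) = k + l") simp_all
  qed
  moreover have "f (map summand xs) = ?f (map summand xs)" for xs
    using typed_apply[OF f, of xs] sum_length_filter_compl[of isl xs] by auto
  ultimately have "f = ?f"
    using cochain_eq_summand[OF typed_cochain[OF f]] by blast
  with len show ?thesis by metis
qed

text \<open>Counting letters: g consumes k' letters from M and l' from W and returns one letter, in
  M or W according to \<open>s'\<close>, while the Koszul twist keeps each jumped letter in its
  summand. A nonzero term forces the counts to fit.\<close>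

lemma circ_summand:
  assumes f: "f \<in> typed s k l" and g: "g \<in> typed s' k' l'"
    and nz: "circ V q f g (map summand xs) \<noteq> 0"
  shows "if s' then 0 < k \<and> Suc (nM xs) = k + k' \<and> nW xs = l + l'
    else 0 < l \<and> nM xs = k + k' \<and> Suc (nW xs) = l + l'"
proof -
  obtain n i where nz: "f (map (koszul V q) (take i (map summand xs)) @ g (take n (drop i (map summand xs)))
      # drop (i + n) (map summand xs)) \<noteq> 0"
    using nz unfolding circ_def by (metis (no_types, lifting) sum.neutral)
  define y where "y = g (map summand (take n (drop i xs)))"
  \<comment> \<open>The value of g, read as a letter of the summand it belongs to.\<close>
  let ?y = "if s' then Inl (fst y) else Inr (snd y)"
  let ?zs = "map (map_sum (koszul M q) (koszul W q)) (take i xs)"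
  have y: "y = summand ?y"
    using typed_value[OF g, of "map summand (take n (drop i xs))"]
    by (cases s') (simp_all add: y_def summand_def prod_eq_iff)
  have t: "f (map summand (?zs @ ?y # drop (i + n) xs)) \<noteq> 0"
    using nz y by (simp add: y_def take_map drop_map koszul_summand comp_def)
  have "y \<noteq> 0"
    using t y V.cochain_0[OF typed_cochain[OF f]] by (metis list.simps(9) map_append)
  then have c': "nM (take n (drop i xs)) = k' \<and> nW (take n (drop i xs)) = l'"
    using typed_apply[OF g] y_def by blast
  have c: "nM (?zs @ ?y # drop (i + n) xs) = k \<and> nW (?zs @ ?y # drop (i + n) xs) = l"
    using t typed_apply[OF f] by blast
  have xs: "xs = take i xs @ take n (drop i xs) @ drop (i + n) xs"
    by (metis add.commute append_take_drop_id drop_drop)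
  have m: "nM ?zs = nM (take i xs)" "nW ?zs = nW (take i xs)"
    by (simp_all add: filter_map comp_def isl_map_sum)
  have "nM xs = nM (take i xs) + nM (take n (drop i xs)) + nM (drop (i + n) xs)"
    "nW xs = nW (take i xs) + nW (take n (drop i xs)) + nW (drop (i + n) xs)"
    by (subst xs, simp only: filter_append length_append)+
  then show ?thesis
    using c c' m by (auto split: if_splits)
qed

lemma circ_value:
  assumes "f \<in> typed s k l"
  shows "if s then snd (circ V q f g vs) = 0 else fst (circ V q f g vs) = 0"
  using typed_value[OF assms] by (cases s) (simp_all add: circ_def fst_sum snd_sum)

lemma circ_typed:
  assumes f: "f \<in> typed s k l" and g: "g \<in> typed s' k' l'"
    and "if s' then Suc a = k + k' \<and> b = l + l' else a = k + k' \<and> Suc b = l + l'"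
  shows "circ V q f g \<in> typed s a b"
  unfolding typed_def
proof (intro CollectI conjI allI impI)
  show "circ V q f g \<in> cochains V"
    using f g typed_cochain V.circ_cochain by blast
  show "if s then snd (circ V q f g vs) = 0 else fst (circ V q f g vs) = 0" for vs
    by (rule circ_value[OF f])
  show "circ V q f g (map summand xs) = 0" if "\<not> (nM xs = a \<and> nW xs = b)" for xs
  proof (rule ccontr)
    assume "circ V q f g (map summand xs) \<noteq> 0"
    from circ_summand[OF f g this] show False
      using assms(3) that by (auto split: if_splits)
  qed
qed

text \<open>The values of g lie in a summand for which f has no slot.\<close>

lemma circ_typed_0:
  assumes f: "f \<in> typed s k l" and g: "g \<in> typed s' k' l'" and "if s' then k = 0 else l = 0"
  shows "circ V q f g = 0"
proof (rule cochain_eq_summand)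
  show "circ V q f g \<in> cochains V"
    using f g typed_cochain V.circ_cochain by blast
  show "circ V q f g (map summand xs) = 0 (map summand xs)" for xs
    using circ_summand[OF f g, of q xs] assms(3) by (auto split: if_splits)
qed (rule V.zero_cochain)

text \<open>The W-component isolates D, whatever its bidegree; evaluation on tensors of one bidegree
  then isolates each of the other terms. Both [d, d] and the difference of two extensions are taken
  apart this way.\<close>

lemma direct_sum_zero:
  assumes D: "D \<in> typed False k l"
    and f: "f1 \<in> typed True k1 l1" "f2 \<in> typed True k2 l2" "f3 \<in> typed True k3 l3" "f4 \<in> typed True k4 l4"
    and dist: "distinct [(k1, l1), (k2, l2), (k3, l3), (k4, l4)]"
    and sum: "D + f1 + f2 + f3 + f4 = 0"
  shows "D = 0 \<and> f1 = 0 \<and> f2 = 0 \<and> f3 = 0 \<and> f4 = 0"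
proof -
  have c: "fst (D vs) = 0" "snd (f1 vs) = 0" "snd (f2 vs) = 0" "snd (f3 vs) = 0" "snd (f4 vs) = 0" for vs
    using typed_value[OF D] f[THEN typed_value] by simp_all
  have *: "D vs + f1 vs + f2 vs + f3 vs + f4 vs = 0" for vs
    using fun_cong[OF sum, of vs] by simp
  have "D = 0"
  proof
    show "D vs = 0 vs" for vs
      using arg_cong[OF *[of vs], of snd] c by (simp add: prod_eq_iff)
  qed
  then have **: "f1 vs + f2 vs + f3 vs + f4 vs = 0" for vs
    using *[of vs] by simp
  have "f1 = 0" "f2 = 0" "f3 = 0" "f4 = 0"
  proof -
    show "f1 = 0"
      using **[of "map summand _"] f[THEN typed_apply] dist
      by (intro cochain_eq_summand V.zero_cochain typed_cochain[OF f(1)])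
        (metis (no_types, lifting) add.right_neutral distinct_length_2_or_more zero_fun_apply)
    show "f2 = 0"
      using **[of "map summand _"] f[THEN typed_apply] dist
      by (intro cochain_eq_summand V.zero_cochain typed_cochain[OF f(2)])
        (metis (no_types, lifting) add.right_neutral add.left_neutral distinct_length_2_or_more zero_fun_apply)
    show "f3 = 0"
      using **[of "map summand _"] f[THEN typed_apply] dist
      by (intro cochain_eq_summand V.zero_cochain typed_cochain[OF f(3)])
        (metis (no_types, lifting) add.right_neutral add.left_neutral distinct_length_2_or_more zero_fun_apply)
    show "f4 = 0"
      using **[of "map summand _"] f[THEN typed_apply] dist
      by (intro cochain_eq_summand V.zero_cochain typed_cochain[OF f(4)])
        (metis (no_types, lifting) add.right_neutral add.left_neutral distinct_length_2_or_more zero_fun_apply)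
  qed
  with \<open>D = 0\<close> show ?thesis by simp
qed

section \<open>Structures on the summands as cochains on the sum\<close>

lemma inM_typed:
  assumes f: "f \<in> Hom M n"
  shows "inM f \<in> typed True n 0"
proof -
  have c: "f \<in> cochains M" and len: "length vs \<noteq> n \<Longrightarrow> f vs = 0" for vs
    using f by (auto simp: Hom_def)
  have "inM f (map summand xs) = 0" if "\<not> (nM xs = n \<and> nW xs = 0)" for xs
  proof (cases "\<exists>x\<in>set xs. \<not> isl x")
    case True
    then have "0 \<in> set (map fst (map summand xs))"
      using fst_summand by fastforce
    then show ?thesis using M.cochain_zero_entry[OF c] by (simp add: inM_def zero_prod_def)
  next
    case False
    then have "filter isl xs = xs" "filter (\<lambda>x. \<not> isl x) xs = []"
      by (auto simp: filter_id_conv filter_empty_conv)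
    then show ?thesis using that len by (simp add: inM_def zero_prod_def)
  qed
  moreover have "inM f \<in> cochains V"
    unfolding cochains_def V_linear_iff
    by (simp add: inM_def M.cochain_add[OF c] M.cochain_scale[OF c])
  moreover have "snd (inM f vs) = (0 :: 'w)" for vs
    by (simp add: inM_def)
  ultimately show ?thesis
    unfolding typed_def if_True if_False by blast
qed

lemma inW_typed:
  assumes f: "f \<in> Hom W n"
  shows "inW f \<in> typed False 0 n"
proof -
  have c: "f \<in> cochains W" and len: "length vs \<noteq> n \<Longrightarrow> f vs = 0" for vs
    using f by (auto simp: Hom_def)
  have "inW f (map summand xs) = 0" if "\<not> (nM xs = 0 \<and> nW xs = n)" for xs
  proof (cases "\<exists>x\<in>set xs. isl x")
    case True
    then have "0 \<in> set (map snd (map summand xs))"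
      using snd_summand by fastforce
    then show ?thesis using W.cochain_zero_entry[OF c] by (simp add: inW_def zero_prod_def)
  next
    case False
    then have "filter isl xs = []" "filter (\<lambda>x. \<not> isl x) xs = xs"
      by (auto simp: filter_id_conv filter_empty_conv)
    then show ?thesis using that len by (simp add: inW_def zero_prod_def)
  qed
  moreover have "inW f \<in> cochains V"
    unfolding cochains_def V_linear_iff
    by (simp add: inW_def W.cochain_add[OF c] W.cochain_scale[OF c])
  moreover have "fst (inW f vs) = (0 :: 'm)" for vs
    by (simp add: inW_def)
  ultimately show ?thesis
    unfolding typed_def if_True if_False by blast
qed

lemma inM_parity: "has_parity M p f \<Longrightarrow> has_parity V p (inM f)"
  unfolding has_parity_def inM_def
proof (intro allI impI)
  fix es vs
  assume f: "\<forall>es vs. list_all2 (\<lambda>e v. v \<in> hpart M e) es vs \<longrightarrow> f vs \<in> hpart M (p + sum_list es)"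
    and "list_all2 (\<lambda>e v. v \<in> hpart V e) es vs"
  then have "list_all2 (\<lambda>e v. v \<in> hpart M e) es (map fst vs)"
    by (auto simp: list_all2_conv_all_nth hpart_dsum)
  with f show "(f (map fst vs), 0) \<in> hpart V (p + sum_list es)"
    by (simp add: hpart_dsum W.subspace_0[OF W.hpart_subspace])
qed

lemma inW_parity: "has_parity W p f \<Longrightarrow> has_parity V p (inW f)"
  unfolding has_parity_def inW_def
proof (intro allI impI)
  fix es vs
  assume f: "\<forall>es vs. list_all2 (\<lambda>e v. v \<in> hpart W e) es vs \<longrightarrow> f vs \<in> hpart W (p + sum_list es)"
    and "list_all2 (\<lambda>e v. v \<in> hpart V e) es vs"
  then have "list_all2 (\<lambda>e v. v \<in> hpart W e) es (map snd vs)"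
    by (auto simp: list_all2_conv_all_nth hpart_dsum)
  with f show "(0, f (map snd vs)) \<in> hpart V (p + sum_list es)"
    by (simp add: hpart_dsum M.subspace_0[OF M.hpart_subspace])
qed

lemma inM_inject: "inM f = (inM g :: ('m, 'w) cochain) \<Longrightarrow> f = g"
proof
  fix vs assume "inM f = (inM g :: ('m, 'w) cochain)"
  then have "inM f (map (\<lambda>m. (m, 0 :: 'w)) vs) = inM g (map (\<lambda>m. (m, 0)) vs)" by simp
  then show "f vs = g vs" by (simp add: inM_def comp_def)
qed

lemma inW_inject: "inW f = (inW g :: ('m, 'w) cochain) \<Longrightarrow> f = g"
proof
  fix vs assume "inW f = (inW g :: ('m, 'w) cochain)"
  then have "inW f (map (\<lambda>w. (0 :: 'm, w)) vs) = inW g (map (\<lambda>w. (0, w)) vs)" by simp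
  then show "f vs = g vs" by (simp add: inW_def comp_def)
qed

lemma inM_circ: "circ V q (inM f) (inM g) = inM (circ M q f g)"
  by (rule ext) (auto simp: circ_def inM_def prod_eq_iff fst_sum snd_sum take_map drop_map comp_def koszul_dsum)

lemma inW_circ: "circ V q (inW f) (inW g) = inW (circ W q f g)"
  by (rule ext) (auto simp: circ_def inW_def prod_eq_iff fst_sum snd_sum take_map drop_map comp_def koszul_dsum)

lemma inM_hcochain: "f \<in> Hom M n \<Longrightarrow> has_parity M p f \<Longrightarrow> inM f \<in> V.hcochains p"
  using inM_typed[THEN typed_cochain] inM_parity by (auto simp: V.hcochains_def)

lemma inW_hcochain: "f \<in> Hom W n \<Longrightarrow> has_parity W p f \<Longrightarrow> inW f \<in> V.hcochains p"
  using inW_typed[THEN typed_cochain] inW_parity by (auto simp: V.hcochains_def)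

lemma inM_bracket:
  assumes "f \<in> Hom M n" "has_parity M 1 f"
  shows "bracket V (inM f) (inM f) = inM (bracket M f f)"
proof -
  have "f \<in> M.hcochains 1" using assms by (simp add: M.hcochains_def Hom_def)
  then show ?thesis
    using assms by (simp add: V.bracket_odd_odd M.bracket_odd_odd inM_hcochain inM_circ)
      (simp add: inM_def fun_eq_iff)
qed

lemma inW_bracket:
  assumes "f \<in> Hom W n" "has_parity W 1 f"
  shows "bracket V (inW f) (inW f) = inW (bracket W f f)"
proof -
  have "f \<in> W.hcochains 1" using assms by (simp add: W.hcochains_def Hom_def)
  then show ?thesis
    using assms by (simp add: V.bracket_odd_odd W.bracket_odd_odd inW_hcochain inW_circ)
      (simp add: inW_def fun_eq_iff)
qed

lemma inM_eq_0: "inM f = (0 :: ('m, 'w) cochain) \<longleftrightarrow> f = 0"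
proof -
  have "inM 0 = (0 :: ('m, 'w) cochain)" by (simp add: inM_def fun_eq_iff zero_prod_def)
  then show ?thesis using inM_inject[of f 0] by auto
qed

lemma inW_eq_0: "inW f = (0 :: ('m, 'w) cochain) \<longleftrightarrow> f = 0"
proof -
  have "inW 0 = (0 :: ('m, 'w) cochain)" by (simp add: inW_def fun_eq_iff zero_prod_def)
  then show ?thesis using inW_inject[of f 0] by auto
qed

lemma inM_codifferential:
  "f \<in> codifferentials M \<longleftrightarrow> f \<in> Hom M 2 \<and> has_parity M 1 f \<and> bracket V (inM f) (inM f) = 0"
  by (auto simp: codifferentials_def inM_bracket inM_eq_0)

lemma inW_codifferential:
  "f \<in> codifferentials W \<longleftrightarrow> f \<in> Hom W 2 \<and> has_parity W 1 f \<and> bracket V (inW f) (inW f) = 0"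
  by (auto simp: codifferentials_def inW_bracket inW_eq_0)

text \<open>In \<open>extensions\<close> the component \<delta> is given on W, but \<mu> only as a
  cochain on the direct sum; restriction to the vectors (m, 0) recovers the structure on M.\<close>

lemma inM_surj:
  assumes f: "f \<in> typed True n 0" and p: "f \<in> V.hcochains p"
  obtains g where "g \<in> Hom M n" "has_parity M p g" "f = inM g"
proof
  define g where "g = (\<lambda>ms. fst (f (map (\<lambda>m. (m, 0)) ms)))"
  note c = typed_cochain[OF f]
  have gc: "g \<in> cochains M"
    unfolding cochains_def
  proof (intro CollectI allI M.linI)
    fix xs ys
    show "g (xs @ (a + b) # ys) = g (xs @ a # ys) + g (xs @ b # ys)" for a b
      using V.cochain_add[OF c, of "map (\<lambda>m. (m, 0)) xs" "(a, 0)" "(b, 0)" "map (\<lambda>m. (m, 0)) ys"]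
      by (simp add: g_def)
    show "g (xs @ scl M k a # ys) = scl M k (g (xs @ a # ys))" for k a
      using V.cochain_scale[OF c, of "map (\<lambda>m. (m, 0)) xs" k "(a, 0)" "map (\<lambda>m. (m, 0)) ys"]
      by (simp add: g_def)
  qed
  show "g \<in> Hom M n"
    using gc typed_length[OF f] by (simp add: Hom_def g_def)
  show "has_parity M p g"
    unfolding has_parity_def
  proof (intro allI impI)
    fix es vs assume "list_all2 (\<lambda>e v. v \<in> hpart M e) es vs"
    then have "list_all2 (\<lambda>e v. v \<in> hpart V e) es (map (\<lambda>m. (m, 0)) vs)"
      by (auto simp: list_all2_conv_all_nth hpart_dsum W.subspace_0[OF W.hpart_subspace])
    then have "f (map (\<lambda>m. (m, 0)) vs) \<in> hpart V (p + sum_list es)"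
      using p by (simp add: V.hcochains_def has_parity_def)
    then show "g vs \<in> hpart M (p + sum_list es)"
      by (auto simp: hpart_dsum g_def)
  qed
  show "f = inM g"
  proof (rule cochain_eq_summand[OF c typed_cochain[OF inM_typed[OF \<open>g \<in> Hom M n\<close>]]])
    fix xs :: "('m + 'w) list"
    show "f (map summand xs) = inM g (map summand xs)"
    proof (cases "\<exists>x\<in>set xs. \<not> isl x")
      case True
      then have "nW xs \<noteq> 0" by (auto simp: filter_empty_conv)
      moreover have "0 \<in> set (map (\<lambda>m. (m, 0::'w)) (map fst (map summand xs)))"
        using True fst_summand by (fastforce simp: zero_prod_def)
      ultimately show ?thesis
        using V.cochain_zero_entry[OF c] typed_apply[OF f, of xs]
        by (simp add: inM_def g_def comp_def zero_prod_def)
    next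
      case False
      then have "map (\<lambda>m. (m, 0)) (map fst (map summand xs)) = map summand xs"
        using snd_summand by (auto simp: prod_eq_iff intro!: map_idI)
      then show ?thesis
        using typed_value[OF f] unfolding inM_def g_def by (simp add: prod_eq_iff del: map_map)
    qed
  qed
qed

text \<open>The square of d splits into a W-valued part and M-valued parts of bidegrees (3,0),
  (2,1), (1,2) and (0,3), which give the equations in this order. The fourth is twice the usual
  equation with [D, D] added, which the first one removes.\<close>

lemma ext_codifferential_iff:
  assumes D: "D \<in> typed False 0 2" "D \<in> V.hcochains 1"
    and mu: "\<mu> \<in> typed True 2 0" "\<mu> \<in> V.hcochains 1"
    and la: "l \<in> typed True 1 1" "l \<in> V.hcochains 1"
    and ps: "\<psi> \<in> typed True 0 2" "\<psi> \<in> V.hcochains 1"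
  shows "D + \<mu> + l + \<psi> \<in> codifferentials V \<longleftrightarrow>
    bracket V D D = 0 \<and> bracket V \<mu> \<mu> = 0 \<and> bracket V \<mu> l = 0 \<and>
    bracket V (D + l) (D + l) + bracket V \<mu> \<psi> + bracket V \<mu> \<psi> = 0 \<and> bracket V (D + l) \<psi> = 0"
proof -
  let ?d = "D + \<mu> + l + \<psi>"
  let ?c = "circ V 1"
  have d: "?d \<in> V.hcochains 1" "D + l \<in> V.hcochains 1"
    using D mu la ps by (intro V.add_hcochain; simp)+
  have len: "?d vs = 0" if "length vs \<noteq> 2" for vs
    using typed_length[OF D(1), of vs] typed_length[OF mu(1), of vs] typed_length[OF la(1), of vs]
      typed_length[OF ps(1), of vs] that by simp
  \<comment> \<open>The inserted value finds no slot: D and \<psi> take entries from W only, \<mu>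
    from M only.\<close>
  have z: "?c D \<mu> = 0" "?c D l = 0" "?c D \<psi> = 0" "?c \<mu> D = 0" "?c \<psi> \<mu> = 0" "?c \<psi> l = 0" "?c \<psi> \<psi> = 0"
    using D mu la ps by (auto intro!: circ_typed_0)
  have t: "?c D D \<in> typed False 0 3" "?c \<mu> \<mu> \<in> typed True 3 0"
    "?c \<mu> l \<in> typed True 2 1" "?c l \<mu> \<in> typed True 2 1"
    "?c \<mu> \<psi> \<in> typed True 1 2" "?c l D \<in> typed True 1 2" "?c l l \<in> typed True 1 2"
    "?c l \<psi> \<in> typed True 0 3" "?c \<psi> D \<in> typed True 0 3"
    using D mu la ps by (auto intro!: circ_typed)
  have coch: "D \<in> cochains V" "\<mu> \<in> cochains V" "l \<in> cochains V" "\<psi> \<in> cochains V"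
    using D mu la ps typed_cochain by auto
  have ddc: "?c ?d ?d = ?c D D + ?c \<mu> \<mu> + (?c \<mu> l + ?c l \<mu>) + (?c \<mu> \<psi> + ?c l D + ?c l l) + (?c l \<psi> + ?c \<psi> D)"
    by (simp only: V.circ_add_left V.circ_add_right coch V.add_cochain z add_0_left add_0_right) (simp only: ac_simps)
  have dd: "bracket V f f = 0 \<longleftrightarrow> ?c f f = 0" if "f \<in> V.hcochains 1" for f
    using V.double_eq_0 that by (fastforce simp: V.bracket_odd_odd fun_eq_iff)
  have al: "bracket V (D + l) (D + l) + bracket V \<mu> \<psi> + bracket V \<mu> \<psi>
      = (?c D D + (?c \<mu> \<psi> + ?c l D + ?c l l)) + (?c D D + (?c \<mu> \<psi> + ?c l D + ?c l l))"
    unfolding V.bracket_odd_odd[OF d(2) d(2)] V.bracket_odd_odd[OF mu(2) ps(2)]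
    by (simp only: V.circ_add_left V.circ_add_right coch V.add_cochain z add_0_left add_0_right) (simp only: ac_simps)
  have al0: "bracket V (D + l) (D + l) + bracket V \<mu> \<psi> + bracket V \<mu> \<psi> = 0 \<longleftrightarrow>
      ?c D D + (?c \<mu> \<psi> + ?c l D + ?c l l) = 0"
    unfolding al using V.double_eq_0 by (fastforce simp: fun_eq_iff)
  have ml: "bracket V \<mu> l = ?c \<mu> l + ?c l \<mu>"
    by (rule V.bracket_odd_odd[OF mu(2) la(2)])
  have ap: "bracket V (D + l) \<psi> = ?c l \<psi> + ?c \<psi> D"
    unfolding V.bracket_odd_odd[OF d(2) ps(2)]
    by (simp only: V.circ_add_left V.circ_add_right coch V.add_cochain z add_0_left add_0_right)
  have "?d \<in> codifferentials V \<longleftrightarrow> ?c ?d ?d = 0"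
    using d(1) len by (auto simp: codifferentials_def Hom_def V.hcochains_def dd)
  also have "\<dots> \<longleftrightarrow> ?c D D = 0 \<and> ?c \<mu> \<mu> = 0 \<and> ?c \<mu> l + ?c l \<mu> = 0 \<and>
      ?c \<mu> \<psi> + ?c l D + ?c l l = 0 \<and> ?c l \<psi> + ?c \<psi> D = 0" (is "_ \<longleftrightarrow> ?R")
  proof
    assume "?c ?d ?d = 0"
    then show ?R
      unfolding ddc
      by (intro direct_sum_zero[of _ 0 3 _ 3 0 _ 2 1 _ 1 2 _ 0 3] typed_subspace t) simp_all
  qed (simp only: ddc add_0_left add_0_right)
  also have "\<dots> \<longleftrightarrow> bracket V D D = 0 \<and> bracket V \<mu> \<mu> = 0 \<and> bracket V \<mu> l = 0 \<and>
    bracket V (D + l) (D + l) + bracket V \<mu> \<psi> + bracket V \<mu> \<psi> = 0 \<and> bracket V (D + l) \<psi> = 0"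
    unfolding dd[OF D(2)] dd[OF mu(2)] ml al0 ap by auto
  finally show ?thesis .
qed

section \<open>The groups acting on the direct sum\<close>

lemma G_MW_GL: "g \<in> G_MW M W \<Longrightarrow> g \<in> GL V"
proof -
  assume "g \<in> G_MW M W"
  then obtain a b where g: "g = map_prod a b" and ab: "a \<in> GL M" "b \<in> GL W"
    by (auto simp: G_MW_def)
  from ab have l: "M.lin a" "W.lin b" by (simp_all add: GL_def)
  have "V.lin g"
    unfolding V_linear_iff g
    by (simp add: prod_eq_iff M.linear_add[OF l(1)] W.linear_add[OF l(2)] M.linear_scale[OF l(1)] W.linear_scale[OF l(2)])
  then show ?thesis
    using ab by (auto simp: GL_def g bij_map_prod)
qed

lemma id_G_MW: "id \<in> G_MW M W"
  unfolding G_MW_def using M.id_GL W.id_GL map_prod.id by (metis (mono_tags, lifting) mem_Collect_eq)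

lemma comp_G_MW: "g \<in> G_MW M W \<Longrightarrow> h \<in> G_MW M W \<Longrightarrow> g \<circ> h \<in> G_MW M W"
  unfolding G_MW_def using M.comp_GL W.comp_GL by (fastforce simp: map_prod.comp)

lemma inv_G_MW: "g \<in> G_MW M W \<Longrightarrow> inv g \<in> G_MW M W"
proof -
  assume "g \<in> G_MW M W"
  then obtain a b where g: "g = map_prod a b" and ab: "a \<in> GL M" "b \<in> GL W"
    by (auto simp: G_MW_def)
  moreover from ab have "bij a" "bij b" by (simp_all add: GL_def)
  ultimately show ?thesis
    unfolding G_MW_def using M.inv_GL W.inv_GL inv_map_prod by blast
qed

lemma GL_linear: "g \<in> GL V \<Longrightarrow> V.lin g"
  by (simp add: GL_def)

lemma GL_bij: "g \<in> GL V \<Longrightarrow> bij g"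
  by (simp add: GL_def)

lemma pull_typed:
  assumes g: "g \<in> G_MW M W" and f: "f \<in> typed s k l"
  shows "pull g f \<in> typed s k l"
proof -
  obtain a b where ab: "g = map_prod a b" "a \<in> GL M" "b \<in> GL W"
    using g by (auto simp: G_MW_def)
  then have bij: "bij a" "bij b" and l: "M.lin a" "W.lin b" "M.lin (inv a)" "W.lin (inv b)"
    using M.inv_GL W.inv_GL by (auto simp: GL_def)
  have 0: "a 0 = 0" "b 0 = 0" "inv a 0 = 0" "inv b 0 = 0"
    by (simp_all add: M.linear_0[OF l(1)] M.linear_0[OF l(3)] W.linear_0[OF l(2)] W.linear_0[OF l(4)])
  have s: "g (summand x) = summand (map_sum a b x)" for x
    by (cases x) (simp_all add: ab summand_def 0)
  have inv: "inv g = map_prod (inv a) (inv b)"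
    using ab bij by (simp add: inv_map_prod)
  have "pull g f (map summand xs) = 0" if "\<not> (nM xs = k \<and> nW xs = l)" for xs
  proof -
    have "f (map summand (map (map_sum a b) xs)) = 0"
      using that by (intro typed_apply[OF f]) (simp add: filter_map comp_def isl_map_sum)
    then show ?thesis
      by (simp add: pull_def comp_def s inv prod_eq_iff 0)
  qed
  then show ?thesis
    using typed_value[OF f] V.pull_cochain[OF G_MW_GL[OF g] typed_cochain[OF f]]
    by (auto simp: typed_def pull_def inv 0 split: if_splits)
qed

lemma pull_inM: "a \<in> GL M \<Longrightarrow> b \<in> GL W \<Longrightarrow> pull (map_prod a b) (inM f) = inM (pull a f)"
proof
  fix vs
  assume ab: "a \<in> GL M" "b \<in> GL W"
  then have "bij a" "bij b" "inv b 0 = 0"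
    using W.inv_GL W.linear_0[of "inv b"] by (auto simp: GL_def)
  then show "pull (map_prod a b) (inM f) vs = inM (pull a f) vs"
    by (simp add: pull_def inM_def inv_map_prod comp_def)
qed

lemma pull_inW: "a \<in> GL M \<Longrightarrow> b \<in> GL W \<Longrightarrow> pull (map_prod a b) (inW f) = inW (pull b f)"
proof
  fix vs
  assume ab: "a \<in> GL M" "b \<in> GL W"
  then have "bij a" "bij b" "inv a 0 = 0"
    using M.inv_GL M.linear_0[of "inv a"] by (auto simp: GL_def)
  then show "pull (map_prod a b) (inW f) vs = inW (pull b f) vs"
    by (simp add: pull_def inW_def inv_map_prod comp_def)
qed

abbreviation Beta :: "('m, 'w) cochain set" where
  "Beta \<equiv> C_par M W 0 0 1"

lemma Beta_typed: "\<beta> \<in> Beta \<Longrightarrow> \<beta> \<in> typed True 0 1"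
  and Beta_even: "\<beta> \<in> Beta \<Longrightarrow> \<beta> \<in> V.hcochains 0"
  and Beta_cochain: "\<beta> \<in> Beta \<Longrightarrow> \<beta> \<in> cochains V"
  by (auto simp: C_par_typed typed_def)

lemma C_par_subspace:
  "0 \<in> C_par M W p k l"
  "f \<in> C_par M W p k l \<Longrightarrow> g \<in> C_par M W p k l \<Longrightarrow> f + g \<in> C_par M W p k l"
  "f \<in> C_par M W p k l \<Longrightarrow> - f \<in> C_par M W p k l"
  "f \<in> C_par M W p k l \<Longrightarrow> g \<in> C_par M W p k l \<Longrightarrow> f - g \<in> C_par M W p k l"
  "f \<in> C_par M W p k l \<Longrightarrow> (\<lambda>vs. scl V c (f vs)) \<in> C_par M W p k l"
  unfolding C_par_typed Int_iff
  by (intro conjI V.zero_hcochain V.add_hcochain V.minus_hcochain V.diff_hcochain V.scale_hcochain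
      typed_subspace; elim conjE; assumption)+

lemma pull_C_par: "g \<in> G_MW M W \<Longrightarrow> f \<in> C_par M W p k l \<Longrightarrow> pull g f \<in> C_par M W p k l"
  by (simp add: C_par_typed pull_typed V.pull_hcochain G_MW_GL)

lemma Beta_snd: "\<beta> \<in> Beta \<Longrightarrow> snd (\<beta> vs) = 0"
  using typed_value[OF Beta_typed] by auto

lemma Beta_0: "\<beta> \<in> Beta \<Longrightarrow> length vs \<noteq> 1 \<Longrightarrow> \<beta> vs = 0"
  using typed_length[OF Beta_typed] by simp

lemma Beta_linear: "\<beta> \<in> Beta \<Longrightarrow> V.lin (\<lambda>v. \<beta> [v])"
  using V.cochain_linear[OF Beta_cochain, of \<beta> "[]" "[]"] by simp

lemma typed_Inl: "f \<in> typed s 0 (Suc l) \<Longrightarrow> snd v = 0 \<Longrightarrow> f [v] = 0"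
  using typed_apply[of f s 0 "Suc l" "[Inl (fst v)]"] by (cases v) (simp add: summand_def)

lemma Beta_M: "\<beta> \<in> Beta \<Longrightarrow> snd v = 0 \<Longrightarrow> \<beta> [v] = 0"
  using typed_Inl[of \<beta> True 0 v, folded One_nat_def] Beta_typed by blast

lemma Beta_add: "\<beta> \<in> Beta \<Longrightarrow> \<beta> [v + w] = \<beta> [v] + \<beta> [w]"
  using V.linear_add[OF Beta_linear] .

lemma expo_eq: "\<beta> \<in> Beta \<Longrightarrow> expo \<beta> v = v + \<beta> [v]"
proof -
  assume b: "\<beta> \<in> Beta"
  have "\<beta> [v] = \<beta> [(0, snd v)]"
    using Beta_add[OF b, of "(fst v, 0)" "(0, snd v)"] Beta_M[OF b] by simp
  then show ?thesis
    using Beta_snd[OF b] by (simp add: expo_def split_beta prod_eq_iff)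
qed

text \<open>The values of \<beta>' lie in M, where \<beta> vanishes, so the mixed term is 0. In
  particular exp(\<beta>) = 1 + \<beta> has the inverse exp(-\<beta>).\<close>

lemma expo_add:
  assumes "\<beta> \<in> Beta" "\<beta>' \<in> Beta"
  shows "expo (\<beta> + \<beta>') = expo \<beta> \<circ> expo \<beta>'"
proof
  fix v
  have "\<beta> [v + \<beta>' [v]] = \<beta> [v]"
    using assms Beta_snd by (simp add: Beta_add Beta_M)
  then show "expo (\<beta> + \<beta>') v = (expo \<beta> \<circ> expo \<beta>') v"
    using assms by (simp add: expo_eq C_par_subspace ac_simps)
qed

lemma expo_0: "expo (0 :: ('m, 'w) cochain) = id"
  by (rule ext) (simp add: expo_eq[OF C_par_subspace(1)])

lemma expo_inverse: "\<beta> \<in> Beta \<Longrightarrow> expo \<beta> \<circ> expo (- \<beta>) = id" "\<beta> \<in> Beta \<Longrightarrow> expo (- \<beta>) \<circ> expo \<beta> = id"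
  using expo_add[of \<beta> "- \<beta>"] expo_add[of "- \<beta>" \<beta>] by (simp_all add: C_par_subspace expo_0)

lemma expo_bij: "\<beta> \<in> Beta \<Longrightarrow> bij (expo \<beta>)"
  using expo_inverse o_bij by blast

lemma inv_expo: "\<beta> \<in> Beta \<Longrightarrow> inv (expo \<beta>) = expo (- \<beta>)"
  using expo_inverse inv_unique_comp by blast

lemma expo_GL:
  assumes b: "\<beta> \<in> Beta"
  shows "expo \<beta> \<in> GL V"
proof -
  have e: "expo \<beta> = (\<lambda>v. v + \<beta> [v])"
    by (rule ext) (rule expo_eq[OF b])
  have "V.lin (expo \<beta>)"
    unfolding e by (rule V.linear_compose_add[OF V.linear_ident Beta_linear[OF b]])
  moreover have "expo \<beta> (V.K v) = V.K (expo \<beta> v)" for v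
  proof -
    have "pull V.K \<beta> = \<beta>"
      using Beta_even[OF b] by (simp add: V.even_cochain)
    from fun_cong[OF this, of "[V.K v]"] have "\<beta> [V.K v] = V.K (\<beta> [v])"
      by (simp add: V.pull_K)
    then show ?thesis
      by (simp only: expo_eq[OF b] V.linear_add[OF V.K_linear])
  qed
  ultimately show ?thesis
    unfolding V.GL_iff using expo_bij[OF b] by blast
qed

text \<open>The commutation rule of the semidirect product: it moves the exponential past g, so that
  products and inverses regain the form g exp(\<beta>).\<close>

lemma expo_conj:
  assumes b: "\<beta> \<in> Beta" and g: "g \<in> G_MW M W"
  shows "expo \<beta> \<circ> g = g \<circ> expo (pull g \<beta>)"
proof
  fix v
  note GL = G_MW_GL[OF g]
  have "(expo \<beta> \<circ> g) v = g v + \<beta> [g v]"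
    by (simp only: comp_apply expo_eq[OF b])
  also have "\<dots> = g v + g (pull g \<beta> [v])"
    using GL_bij[OF GL] by (simp add: pull_def bij_is_surj surj_f_inv_f)
  also have "\<dots> = (g \<circ> expo (pull g \<beta>)) v"
    by (simp only: comp_apply expo_eq[OF pull_C_par[OF g b]] V.linear_add[OF GL_linear[OF GL]])
  finally show "(expo \<beta> \<circ> g) v = (g \<circ> expo (pull g \<beta>)) v" .
qed

lemma G_gen_GL: "h \<in> G_gen M W \<Longrightarrow> h \<in> GL V"
  using V.comp_GL G_MW_GL expo_GL by (auto simp: G_gen_def)

lemma G_genI: "g \<in> G_MW M W \<Longrightarrow> \<beta> \<in> Beta \<Longrightarrow> g \<circ> expo \<beta> \<in> G_gen M W"
  by (auto simp: G_gen_def)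

lemma id_G_gen: "id \<in> G_gen M W"
  using G_genI[OF id_G_MW C_par_subspace(1)] by (simp add: expo_0)

lemma expo_G_gen: "\<beta> \<in> Beta \<Longrightarrow> expo \<beta> \<in> G_gen M W"
  using G_genI[OF id_G_MW] by fastforce

lemma G_MW_G_gen: "g \<in> G_MW M W \<Longrightarrow> g \<in> G_gen M W"
  using G_genI[OF _ C_par_subspace(1)] by (fastforce simp: expo_0)

lemma comp_G_gen:
  assumes "h \<in> G_gen M W" "h' \<in> G_gen M W"
  shows "h \<circ> h' \<in> G_gen M W"
proof -
  obtain g \<beta> g' \<beta>' where h: "h = g \<circ> expo \<beta>" "g \<in> G_MW M W" "\<beta> \<in> Beta"
    and h': "h' = g' \<circ> expo \<beta>'" "g' \<in> G_MW M W" "\<beta>' \<in> Beta"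
    using assms unfolding G_gen_def by auto
  have "h \<circ> h' = g \<circ> (expo \<beta> \<circ> g') \<circ> expo \<beta>'"
    by (simp add: h h' comp_assoc)
  also have "\<dots> = (g \<circ> g') \<circ> expo (pull g' \<beta> + \<beta>')"
    by (simp add: expo_conj expo_add pull_C_par h h' comp_assoc)
  finally show ?thesis
    by (simp add: G_genI comp_G_MW h h' C_par_subspace pull_C_par)
qed

lemma inv_G_gen:
  assumes "h \<in> G_gen M W"
  shows "inv h \<in> G_gen M W"
proof -
  obtain g \<beta> where h: "h = g \<circ> expo \<beta>" "g \<in> G_MW M W" "\<beta> \<in> Beta"
    using assms unfolding G_gen_def by auto
  then have "inv h = expo (- \<beta>) \<circ> inv g"
    by (simp add: o_inv_distrib GL_bij G_MW_GL expo_bij inv_expo)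
  then show ?thesis
    by (simp add: comp_G_gen h expo_G_gen G_MW_G_gen inv_G_MW C_par_subspace)
qed

section \<open>Equivalence of cochains under the full group\<close>

abbreviation equivalent :: "('m, 'w) cochain \<Rightarrow> ('m, 'w) cochain \<Rightarrow> bool" where
  "equivalent d d' \<equiv> d' \<in> orbit (G_gen M W) pull d"

lemma equivalent_refl: "equivalent d d"
  unfolding orbit_def using id_G_gen pull_id by (metis (mono_tags, lifting) mem_Collect_eq)

lemma equivalent_trans:
  assumes "equivalent d d'" "equivalent d' d''"
  shows "equivalent d d''"
proof -
  obtain h h' where h: "h \<in> G_gen M W" "d' = pull h d" and h': "h' \<in> G_gen M W" "d'' = pull h' d'"
    using assms by (auto simp: orbit_def)
  then have "d'' = pull (h \<circ> h') d"
    using pull_comp[OF GL_bij[OF G_gen_GL] GL_bij[OF G_gen_GL]] by simp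
  with comp_G_gen[OF h(1) h'(1)] show ?thesis
    by (auto simp: orbit_def)
qed

lemma equivalent_sym:
  assumes "equivalent d d'"
  shows "equivalent d' d"
proof -
  obtain h where h: "h \<in> G_gen M W" "d' = pull h d"
    using assms by (auto simp: orbit_def)
  then have "d = pull (inv h) d'"
    using pull_inv[OF GL_bij[OF G_gen_GL]] by simp
  with inv_G_gen[OF h(1)] show ?thesis
    by (auto simp: orbit_def)
qed

section \<open>The action of exp(\<beta>) on the components\<close>

lemma bracket_beta:
  assumes f: "f \<in> V.hcochains 1" "\<And>vs. length vs \<noteq> 2 \<Longrightarrow> f vs = 0" and b: "\<beta> \<in> Beta"
  shows "bracket V f \<beta> [v, w] = f [\<beta> [v], w] + f [v, \<beta> [w]] - \<beta> [f [v, w]]"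
  \<comment> \<open>No sign survives: \<beta> is even, and its single slot leaves nothing for f to
    jump over.\<close>
  using f(2) Beta_0[OF b] V.cochain_0[OF V.hcochains_cochain[OF f(1)], of "[]"]
     V.cochain_0[OF Beta_cochain[OF b], of "[]" "[]"]
  by (simp add: V.bracket_odd_even[OF f(1) Beta_even[OF b]] circ_def numeral_2_eq_2 V.koszul_parity)

text \<open>Inserting \<beta> turns an M-slot into a W-slot, and the other composition vanishes
  since \<beta> kills M. For W-valued f without M-slots, as in \<open>bracket_beta_W\<close>, the
  two compositions exchange roles.\<close>

lemma bracket_beta_M:
  assumes f: "f \<in> typed True (Suc k) l" "f \<in> V.hcochains 1" and b: "\<beta> \<in> Beta"
  shows "bracket V f \<beta> \<in> typed True k (Suc l)"
proof -
  have "circ V 1 \<beta> f = 0"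
    by (rule circ_typed_0[OF Beta_typed[OF b] f(1)]) simp
  moreover have "circ V 0 f \<beta> \<in> typed True k (Suc l)"
    by (rule circ_typed[OF f(1) Beta_typed[OF b]]) simp
  ultimately show ?thesis
    by (simp add: V.bracket_odd_even[OF f(2) Beta_even[OF b]])
qed

lemma bracket_beta_W:
  assumes f: "f \<in> typed False 0 l" "f \<in> V.hcochains 1" and b: "\<beta> \<in> Beta"
  shows "bracket V f \<beta> \<in> typed True 0 l"
proof -
  have "circ V 0 f \<beta> = 0"
    by (rule circ_typed_0[OF f(1) Beta_typed[OF b]]) simp
  moreover have "circ V 1 \<beta> f \<in> typed True 0 l"
    by (rule circ_typed[OF Beta_typed[OF b] f(1)]) simp
  ultimately show ?thesis
    using typed_subspace(4) by (simp add: V.bracket_odd_even[OF f(2) Beta_even[OF b]])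
qed

lemma bracket_beta_odd: "f \<in> V.hcochains 1 \<Longrightarrow> \<beta> \<in> Beta \<Longrightarrow> bracket V f \<beta> \<in> V.hcochains 1"
  using V.bracket_hcochain[OF _ Beta_even] by fastforce

text \<open>The argument \<alpha> is \<delta> plus the value of \<lambda> after the move. In a
  stabiliser that value is the fixed \<lambda>, which gives the term in the action on
  H^{0,2}.\<close>

definition psi_shift :: "('m, 'w) cochain \<Rightarrow> ('m, 'w) cochain \<Rightarrow> ('m, 'w) cochain \<Rightarrow> ('m, 'w) cochain" where
  "psi_shift \<mu> \<alpha> \<beta> = bracket V (\<alpha> - (\<lambda>vs. scl V (1 / 2) (bracket V \<mu> \<beta> vs))) \<beta>"

lemma half_add: "scl V (1 / 2) v + scl V (1 / 2) v = v"
proof -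
  have "(1 / 2 + 1 / 2 :: 'k) = 1"
    using M.two by (simp flip: add_divide_distrib)
  then show ?thesis
    using V.scale_left_distrib[of "1 / 2" "1 / 2" v] by (metis V.scale_one)
qed

text \<open>Every cochain here is bilinear, so the identity is checked on two vectors by expanding
  (1 - \<beta>) d(v + \<beta> v, w + \<beta> w). A product of two values of \<beta> survives only in
  \<mu>.\<close>

lemma pull_expo:
  assumes D: "D \<in> typed False 0 2" "D \<in> V.hcochains 1"
    and mu: "\<mu> \<in> typed True 2 0" "\<mu> \<in> V.hcochains 1"
    and la: "l \<in> typed True 1 1" "l \<in> V.hcochains 1"
    and ps: "\<psi> \<in> typed True 0 2" "\<psi> \<in> V.hcochains 1" and b: "\<beta> \<in> Beta"
  shows "pull (expo \<beta>) (D + \<mu> + l + \<psi>) =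
    D + \<mu> + (l + bracket V \<mu> \<beta>) + (\<psi> + psi_shift \<mu> (D + (l + bracket V \<mu> \<beta>)) \<beta>)"
    and "l + bracket V \<mu> \<beta> \<in> typed True 1 1" "l + bracket V \<mu> \<beta> \<in> V.hcochains 1"
    and "psi_shift \<mu> (D + (l + bracket V \<mu> \<beta>)) \<beta> \<in> typed True 0 2"
    and "psi_shift \<mu> (D + (l + bracket V \<mu> \<beta>)) \<beta> \<in> V.hcochains 1"
proof -
  let ?m = "bracket V \<mu> \<beta>"
  let ?h = "\<lambda>vs. scl V (1 / 2) (?m vs)"
  have m: "?m \<in> typed True 1 1" "?m \<in> V.hcochains 1"
    using bracket_beta_M[of \<mu> 1 0 \<beta>] bracket_beta_odd mu b by (simp_all add: numeral_2_eq_2 One_nat_def)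
  then show l': "l + ?m \<in> typed True 1 1" "l + ?m \<in> V.hcochains 1"
    using typed_subspace(2) V.add_hcochain la by auto
  have r: "l + ?m - ?h \<in> typed True 1 1" "l + ?m - ?h \<in> V.hcochains 1"
    using typed_subspace(3,5) V.diff_hcochain V.scale_hcochain l' m by blast+
  have e: "D + (l + ?m) - ?h = D + (l + ?m - ?h)" by simp
  have s: "psi_shift \<mu> (D + (l + ?m)) \<beta> = bracket V D \<beta> + bracket V (l + ?m - ?h) \<beta>"
    unfolding psi_shift_def e by (rule V.bracket_add_left[OF D(2) r(2) Beta_even[OF b]]) simp
  show t: "psi_shift \<mu> (D + (l + ?m)) \<beta> \<in> typed True 0 2"
    unfolding s using bracket_beta_W[OF D b] bracket_beta_M[of "l + ?m - ?h" 0 1 \<beta>] r b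
    by (intro typed_subspace) (simp_all add: numeral_2_eq_2 One_nat_def)
  show "psi_shift \<mu> (D + (l + ?m)) \<beta> \<in> V.hcochains 1"
    unfolding s using bracket_beta_odd D(2) r(2) b V.add_hcochain by blast
  show "pull (expo \<beta>) (D + \<mu> + l + \<psi>) = D + \<mu> + (l + ?m) + (\<psi> + psi_shift \<mu> (D + (l + ?m)) \<beta>)"
  proof
    fix vs
    let ?X = "D + \<mu> + l + \<psi>"
    have inv: "inv (expo \<beta>) v = v - \<beta> [v]" for v
      using expo_eq[of "- \<beta>"] C_par_subspace(3)[OF b] by (simp add: inv_expo[OF b])
    have len: "D vs = 0" "\<mu> vs = 0" "l vs = 0" "\<psi> vs = 0" "?m vs = 0" if "length vs \<noteq> 2" for vs
      using typed_length[OF D(1), of vs] typed_length[OF mu(1), of vs] typed_length[OF la(1), of vs]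
        typed_length[OF ps(1), of vs] typed_length[OF m(1), of vs] that by simp_all
    show "pull (expo \<beta>) ?X vs = (D + \<mu> + (l + ?m) + (\<psi> + psi_shift \<mu> (D + (l + ?m)) \<beta>)) vs"
    proof (cases "length vs = 2")
      case False
      then show ?thesis
        using len[of vs] len[of "map (expo \<beta>) vs"] typed_length[OF t, of vs] V.linear_0[OF Beta_linear[OF b]]
        by (simp add: pull_def inv)
    next
      case True
      then obtain v w where vs: "vs = [v, w]"
        by (auto simp: numeral_2_eq_2 length_Suc_conv)
      have add: "f [x + x', y] = f [x, y] + f [x', y]" "f [x, y + y'] = f [x, y] + f [x, y']"
        if "f \<in> cochains V" for f and x x' y y' :: "'m \<times> 'w"
        using V.cochain_add[OF that, of "[]" x x' "[y]"] V.cochain_add[OF that, of "[x]" y y' "[]"] by simp_all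
      note c = D(1)[THEN typed_cochain] mu(1)[THEN typed_cochain] la(1)[THEN typed_cochain] ps(1)[THEN typed_cochain]
      \<comment> \<open>A cochain of bidegree (0,2) sees only the W-components of its
        arguments.\<close>
      have W0: "f [x, y] = 0" if f: "f \<in> typed s 0 2" and "snd x = 0 \<or> snd y = 0" for f s x y
      proof -
        have *: "f [summand x, summand y] = 0" if "isl x \<or> isl y" for x y
          using typed_apply[OF f, of "[x, y]"] that by (auto simp: numeral_2_eq_2)
        have "f [x, y] = f [summand (Inl (fst x)) + summand (Inr (snd x)), summand (Inl (fst y)) + summand (Inr (snd y))]"
          by (simp add: summand_def)
        also have "\<dots> = f [summand (Inr (snd x)), summand (Inr (snd y))]"
          by (simp only: add[OF typed_cochain[OF f]]) (simp add: *)
        finally have "f [x, y] = f [summand (Inr (snd x)), summand (Inr (snd y))]" .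
        moreover have "summand (Inr 0) = (0 :: 'm \<times> 'w)" by (simp add: summand_def zero_prod_def)
        ultimately show ?thesis
          using that(2) V.cochain_zero_entry[OF typed_cochain[OF f]] by auto
      qed
      have l0: "f [\<beta> [x], \<beta> [y]] = 0" if f: "f \<in> typed True 1 1" for f x y
        using typed_apply[OF f, of "[Inl (fst (\<beta> [x])), Inl (fst (\<beta> [y]))]"] Beta_snd[OF b]
        by (simp add: summand_def) (metis prod.collapse)
      have bb: "\<beta> [\<beta> [x]] = 0" for x
        by (simp add: Beta_M b Beta_snd)
      have bf: "\<beta> [f vs] = 0" if f: "f \<in> typed True k l" for f k l vs
        using typed_value[OF f, of vs] by (simp add: Beta_M b)
      have bm: "?m [x, y] = \<mu> [\<beta> [x], y] + \<mu> [x, \<beta> [y]]" for x y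
        using bracket_beta[OF mu(2) len(2) b] bf[OF mu(1)] by simp
      have m0: "\<mu> [0, y] = 0" "\<mu> [x, 0] = 0" for x y
        using V.cochain_zero_entry[OF c(2)] by simp_all
      \<comment> \<open>At (\<beta> v, w) and at (v, \<beta> w) the cochain [\<mu>, \<beta>] takes
        the value \<mu>(\<beta> v, \<beta> w), as \<beta> squares to zero. Half of each is
        subtracted, and the two remaining halves add up to one copy.\<close>
      have "psi_shift \<mu> (D + (l + ?m)) \<beta> [v, w] =
          - \<beta> [D [v, w]] + l [\<beta> [v], w] + l [v, \<beta> [w]] + \<mu> [\<beta> [v], \<beta> [w]]"
      proof -
        let ?q = "\<mu> [\<beta> [v], \<beta> [w]]"
        have q: "scl V (1 / 2) ?q + scl V (1 / 2) ?q = ?q" by (rule half_add)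
        have "bracket V D \<beta> [v, w] = - \<beta> [D [v, w]]"
          using bracket_beta[OF D(2) len(1) b] W0[OF D(1)] Beta_snd[OF b] by simp
        moreover have "bracket V (l + ?m - ?h) \<beta> [v, w] =
            (l + ?m - ?h) [\<beta> [v], w] + (l + ?m - ?h) [v, \<beta> [w]]"
          using bracket_beta[OF r(2) _ b, of v w] len bf[OF r(1)] by (simp del: dsum_simps)
        ultimately show ?thesis
          using q by (simp add: s bm bb m0 del: dsum_simps) (simp add: algebra_simps del: dsum_simps)
      qed
      moreover have "D [\<beta> [x], y] = 0" "D [x, \<beta> [y]] = 0" "\<psi> [\<beta> [x], y] = 0" "\<psi> [x, \<beta> [y]] = 0" for x y
        using W0[OF D(1)] W0[OF ps(1)] Beta_snd[OF b] by simp_all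
      ultimately show ?thesis
        by (simp add: vs pull_def inv expo_eq[OF b] Beta_add[OF b] bf[OF mu(1)] bf[OF la(1)] bf[OF ps(1)]
            bm add c l0[OF la(1)] del: dsum_simps)
    qed
  qed
qed

text \<open>Conjugation by \<open>K\<close> preserves bidegrees, since the involution of the direct
  sum acts on M and W separately. Hence the eigenprojections stay inside \<open>C\<close>.\<close>

lemma C_split:
  assumes f: "f \<in> C M W k l"
  obtains f0 f1 where "f = f0 + f1" "f0 \<in> C_par M W 0 k l" "f1 \<in> C_par M W 1 k l"
proof
  have fc: "f \<in> cochains V" using f by (simp add: C_def)
  have "V.K (summand x) = summand (map_sum M.K W.K x)" for x
    unfolding V.K_def M.K_def W.K_def by (rule koszul_summand)
  then have K: "pull V.K f (map summand xs) = V.K (f (map summand (map (map_sum M.K W.K) xs)))" for xs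
    by (simp add: V.pull_K comp_def)
  have sK: "snd (V.K v) = 0" if "snd v = 0" for v
    using that W.linear_0[OF W.K_linear] unfolding V.K_def W.K_def by (simp add: koszul_dsum)
  have "pull V.K f (map summand xs) = 0" if "\<not> (nM xs = k \<and> nW xs = l)" for xs
    using typed_apply[of f True k l "map (map_sum M.K W.K) xs"] that f V.linear_0[OF V.K_linear]
    unfolding K by (simp add: C_typed filter_map comp_def isl_map_sum)
  moreover have "snd (pull V.K f vs) = 0" for vs
    using f by (simp add: V.pull_K sK C_def)
  ultimately have "pull V.K f \<in> typed True k l"
    using V.pull_K_cochain[OF fc] unfolding typed_def if_True by blast
  then have "V.homog_part p f \<in> typed True k l" for p
    using typed_subspace(2)[OF _ typed_subspace(3), of f True k l "pull V.K f" "(-1) ^ p"] f typed_subspace(3)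
    unfolding V.homog_part_def C_typed plus_fun_def by blast
  then show "V.homog_part 0 f \<in> C_par M W 0 k l" "V.homog_part 1 f \<in> C_par M W 1 k l"
    using V.homog_part_hcochain[OF fc] by (simp_all add: C_par_typed)
  show "f = V.homog_part 0 f + V.homog_part 1 f"
    by (rule V.homog_part_sum)
qed

lemma C_cochain: "f \<in> C M W k l \<Longrightarrow> f \<in> cochains V"
  by (simp add: C_def)

lemma C_subspace:
  "0 \<in> C M W k l" "f \<in> C M W k l \<Longrightarrow> g \<in> C M W k l \<Longrightarrow> f + g \<in> C M W k l"
  "f \<in> C M W k l \<Longrightarrow> g \<in> C M W k l \<Longrightarrow> f - g \<in> C M W k l"
  unfolding C_typed by (intro typed_subspace; assumption)+

lemma C_par_C: "f \<in> C_par M W p k l \<Longrightarrow> f \<in> C M W k l"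
  by (simp add: C_par_def)

lemma C_par_hcochain: "f \<in> C_par M W p k l \<Longrightarrow> f \<in> V.hcochains p"
  by (simp add: C_par_typed)

lemma C_par_type: "f \<in> C_par M W p k l \<Longrightarrow> f \<in> typed True k l"
  by (simp add: C_par_typed)

lemma pull_C: "g \<in> G_MW M W \<Longrightarrow> f \<in> C M W k l \<Longrightarrow> pull g f \<in> C M W k l"
  unfolding C_typed by (rule pull_typed)

section \<open>Components of a moved extension\<close>

definition W_data :: "('m, 'w) cochain set" where
  "W_data = typed False 0 2 \<inter> V.hcochains 1"

lemma W_data_odd: "D \<in> W_data \<Longrightarrow> D \<in> V.hcochains 1"
  by (simp add: W_data_def)

lemma pull_W_data: "g \<in> G_MW M W \<Longrightarrow> D \<in> W_data \<Longrightarrow> pull g D \<in> W_data"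
  by (simp add: W_data_def pull_typed V.pull_hcochain G_MW_GL)

lemma decomposition_unique:
  assumes "D \<in> W_data" "D' \<in> W_data" "\<mu> \<in> C_par M W 1 2 0" "\<mu>' \<in> C_par M W 1 2 0"
    "l \<in> C_par M W 1 1 1" "l' \<in> C_par M W 1 1 1" "\<psi> \<in> C_par M W 1 0 2" "\<psi>' \<in> C_par M W 1 0 2"
    and eq: "D + \<mu> + l + \<psi> = D' + \<mu>' + l' + \<psi>'"
  shows "D = D' \<and> \<mu> = \<mu>' \<and> l = l' \<and> \<psi> = \<psi>'"
proof -
  \<comment> \<open>The zero cochain fills the spare last place, with a bidegree different from the
    others.\<close>
  have "D - D' = 0 \<and> \<mu> - \<mu>' = 0 \<and> l - l' = 0 \<and> \<psi> - \<psi>' = 0 \<and> (0 :: ('m, 'w) cochain) = 0"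
  proof (rule direct_sum_zero)
    show "D - D' \<in> typed False 0 2" "\<mu> - \<mu>' \<in> typed True 2 0" "l - l' \<in> typed True 1 1"
      "\<psi> - \<psi>' \<in> typed True 0 2" "0 \<in> typed True 0 0"
      using assms by (auto simp: W_data_def C_par_typed intro!: typed_subspace)
    show "distinct [(2, 0), (1, 1), (0, 2), (0::nat, 0::nat)]" by simp
    show "D - D' + (\<mu> - \<mu>') + (l - l') + (\<psi> - \<psi>') + 0 = 0"
      using eq by (simp add: algebra_simps)
  qed
  then show ?thesis by simp
qed

definition new_l :: "('m, 'w) cochain \<Rightarrow> ('m \<times> 'w \<Rightarrow> 'm \<times> 'w) \<Rightarrow> ('m, 'w) cochain \<Rightarrow> ('m, 'w) cochain \<Rightarrow> ('m, 'w) cochain" where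
  "new_l \<mu> g \<beta> l = pull g l + bracket V \<mu> \<beta>"

text \<open>Pulling back along g exp(\<beta>) applies g first, so exp(\<beta>) already meets the
  moved \<delta>, \<mu> and \<lambda>; \<open>new_l\<close> and \<open>psi_shift\<close> therefore
  take \<open>pull g \<mu>\<close>.\<close>

lemma pull_gen:
  assumes g: "g \<in> G_MW M W" and b: "\<beta> \<in> Beta"
    and D: "D \<in> W_data" and mu: "\<mu> \<in> C_par M W 1 2 0"
    and l: "l \<in> C_par M W 1 1 1" and ps: "\<psi> \<in> C_par M W 1 0 2"
  shows "pull (g \<circ> expo \<beta>) (D + \<mu> + l + \<psi>) = pull g D + pull g \<mu> + new_l (pull g \<mu>) g \<beta> l
      + (pull g \<psi> + psi_shift (pull g \<mu>) (pull g D + new_l (pull g \<mu>) g \<beta> l) \<beta>)"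
    and "new_l (pull g \<mu>) g \<beta> l \<in> C_par M W 1 1 1"
    and "pull g \<psi> + psi_shift (pull g \<mu>) (pull g D + new_l (pull g \<mu>) g \<beta> l) \<beta> \<in> C_par M W 1 0 2"
proof -
  have *: "pull g D \<in> typed False 0 2" "pull g D \<in> V.hcochains 1"
    "pull g \<mu> \<in> typed True 2 0" "pull g \<mu> \<in> V.hcochains 1"
    "pull g l \<in> typed True 1 1" "pull g l \<in> V.hcochains 1"
    "pull g \<psi> \<in> typed True 0 2" "pull g \<psi> \<in> V.hcochains 1"
    using pull_W_data[OF g D] pull_C_par[OF g mu] pull_C_par[OF g l] pull_C_par[OF g ps]
    by (simp_all add: W_data_def C_par_typed)
  note e = pull_expo[OF * b]
  show "pull (g \<circ> expo \<beta>) (D + \<mu> + l + \<psi>) = pull g D + pull g \<mu> + new_l (pull g \<mu>) g \<beta> l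
      + (pull g \<psi> + psi_shift (pull g \<mu>) (pull g D + new_l (pull g \<mu>) g \<beta> l) \<beta>)"
    unfolding pull_comp[OF GL_bij[OF G_MW_GL[OF g]] expo_bij[OF b]] V.pull_add[OF G_MW_GL[OF g]] new_l_def
    by (rule e(1))
  show "new_l (pull g \<mu>) g \<beta> l \<in> C_par M W 1 1 1"
    using e(2,3) by (simp add: C_par_typed new_l_def)
  have "psi_shift (pull g \<mu>) (pull g D + new_l (pull g \<mu>) g \<beta> l) \<beta> \<in> C_par M W 1 0 2"
    using e(4,5) by (simp add: C_par_typed new_l_def)
  then show "pull g \<psi> + psi_shift (pull g \<mu>) (pull g D + new_l (pull g \<mu>) g \<beta> l) \<beta> \<in> C_par M W 1 0 2"
    by (rule C_par_subspace(2)[OF pull_C_par[OF g ps]])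
qed

section \<open>Cohomology classes as cosets\<close>

lemma cls_0: "cls M W \<mu> 0 l \<phi> = {\<phi>}"
  by (auto simp: cls_def B_mu_def elt_set_plus_def)

lemma Z02_iff: "\<tau> \<in> Z02 M W \<mu> \<alpha> \<longleftrightarrow> \<tau> \<in> C_par M W 1 0 2 \<and> bracket V \<mu> \<tau> = 0 \<and> bracket V \<alpha> \<tau> = 0"
  by (simp add: Z02_def D_bar_def cls_0)

text \<open>Since C^{-1,l} = 0, classes in row 0 are singletons, and a class in H^{0,2} becomes a
  coset made of singletons.\<close>

lemma cls2_eq: "cls2 M W \<mu> \<alpha> \<tau> = (\<lambda>\<phi>. {\<tau> + bracket V \<alpha> \<phi>}) ` {\<phi> \<in> C M W 0 1. bracket V \<mu> \<phi> = 0}"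
proof -
  have "{\<phi> :: ('m, 'w) cochain} + {\<psi>} = {\<phi> + \<psi>}" for \<phi> \<psi>
    by (auto simp: set_plus_def)
  then show ?thesis
    by (auto simp: cls2_def H_mu_def D_bar_def cls_0 elt_set_plus_def image_iff)
qed

text \<open>The point is that \<phi> can be chosen in \<open>Beta\<close>: an even \<phi>
  exponentiates to an automorphism of the graded space.\<close>

lemma cls2_eq_iff:
  assumes mu: "\<mu> \<in> V.hcochains 1" and al: "\<alpha> \<in> V.hcochains 1"
    and t: "\<tau> \<in> V.hcochains 1" "\<tau>' \<in> V.hcochains 1"
  shows "cls2 M W \<mu> \<alpha> \<tau> = cls2 M W \<mu> \<alpha> \<tau>' \<longleftrightarrow>
    (\<exists>\<phi>\<in>Beta. bracket V \<mu> \<phi> = 0 \<and> \<tau>' = \<tau> + bracket V \<alpha> \<phi>)"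
proof
  assume eq: "cls2 M W \<mu> \<alpha> \<tau> = cls2 M W \<mu> \<alpha> \<tau>'"
  have "{\<tau>'} \<in> cls2 M W \<mu> \<alpha> \<tau>'"
    unfolding cls2_eq using C_subspace(1) V.bracket_0_right[OF mu] V.bracket_0_right[OF al]
    by (auto simp: image_iff intro!: exI[of _ 0])
  then obtain \<phi> where phi: "\<phi> \<in> C M W 0 1" "bracket V \<mu> \<phi> = 0" "\<tau>' = \<tau> + bracket V \<alpha> \<phi>"
    unfolding eq[symmetric] unfolding cls2_eq by blast
  obtain f0 f1 where f: "\<phi> = f0 + f1" "f0 \<in> Beta" "f1 \<in> C_par M W 1 0 1"
    using C_split[OF phi(1)] by metis
  note h = C_par_hcochain[OF f(2)] C_par_hcochain[OF f(3)]
  have "bracket V \<alpha> \<phi> = \<tau>' - \<tau>" using phi(3) by simp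
  then have "bracket V \<alpha> \<phi> \<in> V.hcochains 1" using V.diff_hcochain t by simp
  \<comment> \<open>The zero cochain counts as odd, so [\<mu>, \<phi>] = 0 also descends to the even
    part \<open>f0\<close>.\<close>
  then have "bracket V \<alpha> \<phi> = bracket V \<alpha> f0" "bracket V \<mu> \<phi> = bracket V \<mu> f0"
    using V.bracket_odd_part(1)[OF al f(1) h] V.bracket_odd_part(1)[OF mu f(1) h] phi(2) V.zero_hcochain by auto
  then show "\<exists>\<phi>\<in>Beta. bracket V \<mu> \<phi> = 0 \<and> \<tau>' = \<tau> + bracket V \<alpha> \<phi>"
    using phi f(2) by auto
next
  assume "\<exists>\<phi>\<in>Beta. bracket V \<mu> \<phi> = 0 \<and> \<tau>' = \<tau> + bracket V \<alpha> \<phi>"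
  then obtain \<phi> where phi: "\<phi> \<in> C M W 0 1" "bracket V \<mu> \<phi> = 0" "\<tau>' = \<tau> + bracket V \<alpha> \<phi>"
    using C_par_C by blast
  show "cls2 M W \<mu> \<alpha> \<tau> = cls2 M W \<mu> \<alpha> \<tau>'"
    unfolding cls2_eq
  proof (intro equalityI image_subsetI)
    fix x assume "x \<in> {\<phi> \<in> C M W 0 1. bracket V \<mu> \<phi> = 0}"
    then have x: "x \<in> C M W 0 1" "bracket V \<mu> x = 0" by simp_all
    note c = C_cochain[OF x(1)] C_cochain[OF phi(1)]
    show "{\<tau> + bracket V \<alpha> x} \<in> (\<lambda>\<phi>. {\<tau>' + bracket V \<alpha> \<phi>}) ` {\<phi> \<in> C M W 0 1. bracket V \<mu> \<phi> = 0}"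
    proof (rule image_eqI)
      show "{\<tau> + bracket V \<alpha> x} = {\<tau>' + bracket V \<alpha> (x - \<phi>)}"
        by (simp add: phi(3) V.bracket_diff_right[OF al c])
      show "x - \<phi> \<in> {\<phi> \<in> C M W 0 1. bracket V \<mu> \<phi> = 0}"
        by (simp add: C_subspace(3)[OF x(1) phi(1)] V.bracket_diff_right[OF mu c] x(2) phi(2))
    qed
    show "{\<tau>' + bracket V \<alpha> x} \<in> (\<lambda>\<phi>. {\<tau> + bracket V \<alpha> \<phi>}) ` {\<phi> \<in> C M W 0 1. bracket V \<mu> \<phi> = 0}"
    proof (rule image_eqI)
      show "{\<tau>' + bracket V \<alpha> x} = {\<tau> + bracket V \<alpha> (x + \<phi>)}"
        unfolding phi(3) V.bracket_add_right[OF al c] by (simp only: ac_simps)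
      show "x + \<phi> \<in> {\<phi> \<in> C M W 0 1. bracket V \<mu> \<phi> = 0}"
        by (simp add: C_subspace(2)[OF x(1) phi(1)] V.bracket_add_right[OF mu c] x(2) phi(2))
    qed
  qed
qed

lemma B_mu_subgroup:
  assumes mu: "\<mu> \<in> V.hcochains 1"
  shows "0 \<in> bracket V \<mu> ` C M W k l"
    and "x \<in> bracket V \<mu> ` C M W k l \<Longrightarrow> y \<in> bracket V \<mu> ` C M W k l \<Longrightarrow> x - y \<in> bracket V \<mu> ` C M W k l"
proof -
  show "0 \<in> bracket V \<mu> ` C M W k l"
    using V.bracket_0_right[OF mu] C_subspace(1) by (rule image_eqI[OF sym])
  assume "x \<in> bracket V \<mu> ` C M W k l" "y \<in> bracket V \<mu> ` C M W k l"
  then obtain a b where ab: "a \<in> C M W k l" "b \<in> C M W k l" "x = bracket V \<mu> a" "y = bracket V \<mu> b"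
    by blast
  have "x - y = bracket V \<mu> (a - b)"
    unfolding ab(3,4) by (rule V.bracket_diff_right[OF mu C_cochain[OF ab(1)] C_cochain[OF ab(2)], symmetric])
  then show "x - y \<in> bracket V \<mu> ` C M W k l"
    using C_subspace(3)[OF ab(1,2)] by (rule image_eqI)
qed

lemma B_mu_1: "B_mu M W \<mu> 1 l = bracket V \<mu> ` C M W 0 l"
  by (simp add: B_mu_def One_nat_def)

lemma cls_11_eq_iff:
  assumes mu: "\<mu> \<in> V.hcochains 1"
  shows "cls M W \<mu> 1 1 l = cls M W \<mu> 1 1 l' \<longleftrightarrow> l' - l \<in> bracket V \<mu> ` C M W 0 1"
  using coset_eq_iff[OF B_mu_subgroup[OF mu]] by (simp add: cls_def B_mu_1)

text \<open>Supplies an even \<beta> whose exponential moves one odd representative of the class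
  onto another.\<close>

lemma cls_11_odd_iff:
  assumes mu: "\<mu> \<in> V.hcochains 1" and l: "l \<in> C_par M W 1 1 1" "l' \<in> C_par M W 1 1 1"
  shows "cls M W \<mu> 1 1 l = cls M W \<mu> 1 1 l' \<longleftrightarrow> (\<exists>\<beta>\<in>Beta. l' = l + bracket V \<mu> \<beta>)"
proof
  assume "cls M W \<mu> 1 1 l = cls M W \<mu> 1 1 l'"
  then obtain \<phi> where phi: "\<phi> \<in> C M W 0 1" "l' - l = bracket V \<mu> \<phi>"
    unfolding cls_11_eq_iff[OF mu] by auto
  obtain f0 f1 where f: "\<phi> = f0 + f1" "f0 \<in> Beta" "f1 \<in> C_par M W 1 0 1"
    using C_split[OF phi(1)] by metis
  have "bracket V \<mu> \<phi> \<in> V.hcochains 1"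
    unfolding phi(2)[symmetric] using V.diff_hcochain C_par_hcochain l by blast
  then have "l' = l + bracket V \<mu> f0"
    using V.bracket_odd_part(1)[OF mu f(1) C_par_hcochain[OF f(2)] C_par_hcochain[OF f(3)]] phi(2)
    by (simp add: diff_eq_eq add.commute)
  with f(2) show "\<exists>\<beta>\<in>Beta. l' = l + bracket V \<mu> \<beta>" by blast
next
  assume "\<exists>\<beta>\<in>Beta. l' = l + bracket V \<mu> \<beta>"
  then show "cls M W \<mu> 1 1 l = cls M W \<mu> 1 1 l'"
    unfolding cls_11_eq_iff[OF mu] using C_par_C by fastforce
qed

lemma cls_11_self: "\<mu> \<in> V.hcochains 1 \<Longrightarrow> l \<in> cls M W \<mu> 1 1 l"
  using B_mu_subgroup(1)[of \<mu> 0 1] by (auto simp: cls_def B_mu_1 elt_set_plus_def image_iff)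

lemma cls_11_mem:
  assumes mu: "\<mu> \<in> V.hcochains 1" and "l' \<in> cls M W \<mu> 1 1 l"
  shows "cls M W \<mu> 1 1 l' = cls M W \<mu> 1 1 l"
  using assms(2) unfolding cls_11_eq_iff[OF mu, symmetric] eq_commute[of "cls M W \<mu> 1 1 l'"]
  unfolding cls_11_eq_iff[OF mu] by (auto simp: cls_def B_mu_1 elt_set_plus_def)

text \<open>The union runs over all representatives, but g fixes \<mu> and so maps coboundaries to
  coboundaries; the union collapses to one coset.\<close>

lemma act_H_cls:
  assumes g: "g \<in> G_MW M W" "pull g \<mu> = \<mu>" and mu: "\<mu> \<in> V.hcochains 1"
  shows "act_H M W \<mu> 1 1 g (cls M W \<mu> 1 1 l) = cls M W \<mu> 1 1 (pull g l)"
proof -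
  have "cls M W \<mu> 1 1 (pull g l') = cls M W \<mu> 1 1 (pull g l)" if l': "l' \<in> cls M W \<mu> 1 1 l" for l'
  proof -
    obtain \<phi> where phi: "\<phi> \<in> C M W 0 1" "l' = l + bracket V \<mu> \<phi>"
      using l' unfolding cls_def B_mu_1 elt_set_plus_def by blast
    have "pull g l' = pull g l + bracket V \<mu> (pull g \<phi>)"
      using V.pull_bracket_cochain[OF G_MW_GL[OF g(1)] mu C_cochain[OF phi(1)]]
      by (simp add: phi(2) V.pull_add[OF G_MW_GL[OF g(1)]] g(2))
    then have "cls M W \<mu> 1 1 (pull g l) = cls M W \<mu> 1 1 (pull g l')"
      unfolding cls_11_eq_iff[OF mu] using pull_C[OF g(1) phi(1)] by simp
    then show ?thesis by (rule sym)
  qed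
  then show ?thesis
    using cls_11_self[OF mu, of l] unfolding act_H_def by blast
qed

lemma equivalentI: "h \<in> G_gen M W \<Longrightarrow> pull h d = d' \<Longrightarrow> equivalent d d'"
  by (auto simp: orbit_def)

end


section \<open>Extensions with given structures on the summands\<close>

text \<open>Both structures on the summands are fixed; \<open>D\<close> stands for \<delta> extended
  by zero to the direct sum.\<close>

locale extension_base = graded_pair M W
  for M :: "('k::field, 'm::ab_group_add) gspace" and W :: "('k, 'w::ab_group_add) gspace" +
  fixes D \<mu> :: "('m, 'w) cochain"
  assumes D: "D \<in> W_data" and mu: "\<mu> \<in> C_par M W 1 2 0"
    and DD: "bracket (dsum M W) D D = 0" and mm: "bracket (dsum M W) \<mu> \<mu> = 0"
begin

abbreviation is_ext :: "('m, 'w) cochain \<Rightarrow> ('m, 'w) cochain \<Rightarrow> bool" where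
  "is_ext l \<psi> \<equiv> D + \<mu> + l + \<psi> \<in> codifferentials V"

lemmas mu_odd = C_par_hcochain[OF mu]

lemma alpha_odd: "l \<in> C_par M W 1 1 1 \<Longrightarrow> D + l \<in> V.hcochains 1"
  by (rule V.add_hcochain[OF W_data_odd[OF D] C_par_hcochain])

lemma is_ext_iff:
  assumes l: "l \<in> C_par M W 1 1 1" and ps: "\<psi> \<in> C_par M W 1 0 2"
  shows "is_ext l \<psi> \<longleftrightarrow> bracket V \<mu> l = 0 \<and>
    bracket V (D + l) (D + l) + bracket V \<mu> \<psi> + bracket V \<mu> \<psi> = 0 \<and> bracket V (D + l) \<psi> = 0"
proof -
  have "D \<in> typed False 0 2" "D \<in> V.hcochains 1"
    using D by (simp_all add: W_data_def)
  from ext_codifferential_iff[OF this C_par_type[OF mu] mu_odd C_par_type[OF l] C_par_hcochain[OF l]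
      C_par_type[OF ps] C_par_hcochain[OF ps]]
  show ?thesis unfolding DD mm by simp
qed

lemma MC_eq_iff_image:
  assumes l: "l \<in> C_par M W 1 1 1"
  shows "MC_eq M W D \<mu> l \<longleftrightarrow>
    bracket V (D + l) (D + l) \<in> bracket V \<mu> ` {\<psi> \<in> C M W 0 2. bracket V (D + l) \<psi> = 0}" (is "_ \<longleftrightarrow> _ \<in> ?B")
proof -
  note al = alpha_odd[OF l]
  have 0: "0 \<in> ?B"
  proof (rule image_eqI)
    show "0 = bracket V \<mu> 0" by (rule V.bracket_0_right[OF mu_odd, symmetric])
    show "0 \<in> {\<psi> \<in> C M W 0 2. bracket V (D + l) \<psi> = 0}"
      using C_subspace(1) V.bracket_0_right[OF al] by blast
  qed
  have diff: "x - y \<in> ?B" if xy: "x \<in> ?B" "y \<in> ?B" for x y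
  proof -
    obtain a b where ab: "a \<in> C M W 0 2" "b \<in> C M W 0 2" "bracket V (D + l) a = 0" "bracket V (D + l) b = 0"
      "x = bracket V \<mu> a" "y = bracket V \<mu> b"
      using xy by blast
    note c = C_cochain[OF ab(1)] C_cochain[OF ab(2)]
    show ?thesis
    proof (rule image_eqI)
      show "x - y = bracket V \<mu> (a - b)"
        unfolding ab(5,6) V.bracket_diff_right[OF mu_odd c] ..
      show "a - b \<in> {\<psi> \<in> C M W 0 2. bracket V (D + l) \<psi> = 0}"
        by (simp add: C_subspace(3)[OF ab(1,2)] V.bracket_diff_right[OF al c] ab(3,4))
    qed
  qed
  have "MC_eq M W D \<mu> l \<longleftrightarrow> 0 +o ?B = bracket V (D + l) (D + l) +o ?B"
    unfolding MC_eq_def Let_def by (rule eq_commute)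
  also have "\<dots> \<longleftrightarrow> bracket V (D + l) (D + l) \<in> ?B"
    using coset_eq_iff[of ?B 0 "bracket V (D + l) (D + l)", OF 0 diff] unfolding diff_zero .
  finally show ?thesis .
qed

text \<open>Vanishing of the class means [\<delta> + \<lambda>, \<delta> + \<lambda>] =
  [\<mu>, \<psi>'] with [\<delta> + \<lambda>, \<psi>'] = 0. An extension needs -2 [\<mu>, \<psi>]
  on the right, so the two correspond by \<psi>' = -2 \<psi>.\<close>

lemma MC_eq_iff:
  assumes l: "l \<in> C_par M W 1 1 1" and ml: "bracket V \<mu> l = 0"
  shows "MC_eq M W D \<mu> l \<longleftrightarrow> (\<exists>\<psi>\<in>C_par M W 1 0 2. is_ext l \<psi>)"
proof
  note al = alpha_odd[OF l]
  assume "MC_eq M W D \<mu> l"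
  then obtain \<psi> where ps: "\<psi> \<in> C M W 0 2" "bracket V (D + l) \<psi> = 0" "bracket V (D + l) (D + l) = bracket V \<mu> \<psi>"
    unfolding MC_eq_iff_image[OF l] by blast
  obtain f0 f1 where f: "\<psi> = f0 + f1" "f0 \<in> C_par M W 0 0 2" "f1 \<in> C_par M W 1 0 2"
    using C_split[OF ps(1)] by metis
  note h = C_par_hcochain[OF f(2)] C_par_hcochain[OF f(3)]
  \<comment> \<open>A bracket of odd cochains is even, so here the odd part of \<psi> is the one
    that counts.\<close>
  have "bracket V (D + l) (D + l) \<in> V.hcochains 0"
    using V.bracket_hcochain[OF al al] by simp
  then have e: "bracket V (D + l) (D + l) = bracket V \<mu> f1"
    using V.bracket_odd_part(2)[OF mu_odd f(1) h] ps(3) by simp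
  have a: "bracket V (D + l) f1 = 0"
    using V.bracket_odd_part(2)[OF al f(1) h] ps(2) V.zero_hcochain by simp
  let ?p = "\<lambda>vs. scl V (- (1 / 2)) (f1 vs)"
  have p: "?p \<in> C_par M W 1 0 2"
    by (rule C_par_subspace(5)[OF f(3)])
  have "bracket V \<mu> ?p + bracket V \<mu> ?p = - bracket V \<mu> f1"
    unfolding V.bracket_scale_right[OF mu_odd V.hcochains_cochain[OF h(2)]]
  proof
    fix vs
    let ?b = "bracket V \<mu> f1 vs"
    have "scl V (- (1 / 2)) ?b + scl V (- (1 / 2)) ?b = - (scl V (1 / 2) ?b + scl V (1 / 2) ?b)"
      unfolding V.scale_minus_left by simp
    also have "\<dots> = - ?b" unfolding half_add ..
    finally show "((\<lambda>vs. scl V (- (1 / 2)) (bracket V \<mu> f1 vs)) + (\<lambda>vs. scl V (- (1 / 2)) (bracket V \<mu> f1 vs))) vs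
        = (- bracket V \<mu> f1) vs"
      unfolding plus_fun_apply uminus_apply .
  qed
  moreover have "bracket V (D + l) ?p = 0"
    unfolding V.bracket_scale_right[OF al V.hcochains_cochain[OF h(2)]] a zero_fun_def V.scale_zero_right ..
  ultimately have "is_ext l ?p"
    unfolding is_ext_iff[OF l p] using e ml by (simp add: add.assoc)
  with p show "\<exists>\<psi>\<in>C_par M W 1 0 2. is_ext l \<psi>" by (intro bexI)
next
  assume "\<exists>\<psi>\<in>C_par M W 1 0 2. is_ext l \<psi>"
  then obtain \<psi> where p: "\<psi> \<in> C_par M W 1 0 2" and ext: "is_ext l \<psi>" by blast
  note c = V.hcochains_cochain[OF C_par_hcochain[OF p]]
  have "\<psi> + \<psi> \<in> C M W 0 2" "bracket V (D + l) (\<psi> + \<psi>) = 0" 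
    using ext C_par_subspace(2)[OF p p] unfolding is_ext_iff[OF l p] V.bracket_add_right[OF alpha_odd[OF l] c c]
    by (auto simp: C_par_C)
  then have q: "- (\<psi> + \<psi>) \<in> C M W 0 2" "bracket V (D + l) (- (\<psi> + \<psi>)) = 0"
    unfolding V.bracket_minus_right[OF alpha_odd[OF l] V.add_cochain[OF c c]]
    using C_subspace(3)[OF C_subspace(1), of "\<psi> + \<psi>"] by simp_all
  have "bracket V (D + l) (D + l) + (bracket V \<mu> \<psi> + bracket V \<mu> \<psi>) = 0"
    using ext unfolding is_ext_iff[OF l p] by (simp add: add.assoc)
  then have "bracket V (D + l) (D + l) = bracket V \<mu> (- (\<psi> + \<psi>))"
    unfolding V.bracket_minus_right[OF mu_odd V.add_cochain[OF c c]] V.bracket_add_right[OF mu_odd c c]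
    by (rule eq_neg_iff_add_eq_0[THEN iffD2])
  with q show "MC_eq M W D \<mu> l"
    unfolding MC_eq_iff_image[OF l] by blast
qed

text \<open>In this form membership can be transported along automorphisms.\<close>

lemma MC_classes_iff:
  "L \<in> MC_classes M W D \<mu> \<longleftrightarrow>
    (\<exists>l\<in>C_par M W 1 1 1. \<exists>\<psi>\<in>C_par M W 1 0 2. is_ext l \<psi> \<and> L = cls M W \<mu> 1 1 l)"
proof
  assume "L \<in> MC_classes M W D \<mu>"
  then obtain l where "l \<in> C_par M W 1 1 1" "bracket V \<mu> l = 0" "MC_eq M W D \<mu> l" "L = cls M W \<mu> 1 1 l"
    by (auto simp: MC_classes_def)
  then show "\<exists>l\<in>C_par M W 1 1 1. \<exists>\<psi>\<in>C_par M W 1 0 2. is_ext l \<psi> \<and> L = cls M W \<mu> 1 1 l"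
    using MC_eq_iff by blast
next
  assume "\<exists>l\<in>C_par M W 1 1 1. \<exists>\<psi>\<in>C_par M W 1 0 2. is_ext l \<psi> \<and> L = cls M W \<mu> 1 1 l"
  then obtain l \<psi> where *: "l \<in> C_par M W 1 1 1" "\<psi> \<in> C_par M W 1 0 2" "is_ext l \<psi>" "L = cls M W \<mu> 1 1 l"
    by blast
  then have "bracket V \<mu> l = 0" using is_ext_iff by blast
  then show "L \<in> MC_classes M W D \<mu>"
    unfolding MC_classes_def *(4) using *(1-3) MC_eq_iff by (intro imageI) blast
qed

lemma pull_base:
  assumes g: "g \<in> G_MW M W" "pull g D = D" "pull g \<mu> = \<mu>" and b: "\<beta> \<in> Beta"
    and l: "l \<in> C_par M W 1 1 1" and ps: "\<psi> \<in> C_par M W 1 0 2"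
  shows "pull (g \<circ> expo \<beta>) (D + \<mu> + l + \<psi>) =
      D + \<mu> + (pull g l + bracket V \<mu> \<beta>) + (pull g \<psi> + psi_shift \<mu> (D + (pull g l + bracket V \<mu> \<beta>)) \<beta>)"
    and "pull g l + bracket V \<mu> \<beta> \<in> C_par M W 1 1 1"
    and "pull g \<psi> + psi_shift \<mu> (D + (pull g l + bracket V \<mu> \<beta>)) \<beta> \<in> C_par M W 1 0 2"
  using pull_gen[OF g(1) b D mu l ps] unfolding g(2,3) new_l_def by blast+

text \<open>Some representative of L has an extension; exp(\<beta>) moves this representative onto l
  and carries the whole extension along, which supplies \<psi> for l.\<close>

lemma class_member_ext:
  assumes L: "L \<in> MC_classes M W D \<mu>" and l: "l \<in> L \<inter> C_par M W 1 1 1"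
  shows "\<exists>\<psi>\<in>C_par M W 1 0 2. is_ext l \<psi>"
proof -
  obtain l0 \<psi>0 where l0: "l0 \<in> C_par M W 1 1 1" "\<psi>0 \<in> C_par M W 1 0 2" "is_ext l0 \<psi>0" "L = cls M W \<mu> 1 1 l0"
    using L unfolding MC_classes_iff by blast
  have lp: "l \<in> C_par M W 1 1 1" using l by simp
  have "cls M W \<mu> 1 1 l0 = cls M W \<mu> 1 1 l"
    using cls_11_mem[OF mu_odd, of l l0] l l0(4) by simp
  then obtain \<beta> where b: "\<beta> \<in> Beta" "l = l0 + bracket V \<mu> \<beta>"
    unfolding cls_11_odd_iff[OF mu_odd l0(1) lp] by blast
  note e = pull_base[OF id_G_MW pull_id pull_id b(1) l0(1,2), unfolded pull_id, folded b(2)]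
  have "pull (id \<circ> expo \<beta>) (D + \<mu> + l0 + \<psi>0) \<in> codifferentials V"
    by (rule V.pull_codifferential[OF G_gen_GL[OF G_genI[OF id_G_MW b(1)]] l0(3)])
  then have "is_ext l (\<psi>0 + psi_shift \<mu> (D + l) \<beta>)"
    unfolding e(1) .
  with e(3) show ?thesis by (intro bexI)
qed

text \<open>The equations for \<psi> are affine: subtracting the given solution leaves 2
  [\<mu>, \<tau>] = 0 and [\<delta> + \<lambda>, \<tau>] = 0, and 2 is cancelled.\<close>

lemma Z02_iff_ext:
  assumes l: "l \<in> C_par M W 1 1 1" and ps: "\<psi> \<in> C_par M W 1 0 2" and ext: "is_ext l \<psi>"
  shows "\<tau> \<in> Z02 M W \<mu> (D + l) \<longleftrightarrow> \<tau> \<in> C_par M W 1 0 2 \<and> is_ext l (\<psi> + \<tau>)"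
proof (cases "\<tau> \<in> C_par M W 1 0 2")
  case True
  note c = V.hcochains_cochain[OF C_par_hcochain[OF ps]] V.hcochains_cochain[OF C_par_hcochain[OF True]]
  have e: "bracket V \<mu> l = 0" "bracket V (D + l) (D + l) + bracket V \<mu> \<psi> + bracket V \<mu> \<psi> = 0" "bracket V (D + l) \<psi> = 0"
    using ext unfolding is_ext_iff[OF l ps] by simp_all
  have "bracket V (D + l) (D + l) + (bracket V \<mu> \<psi> + bracket V \<mu> \<tau>) + (bracket V \<mu> \<psi> + bracket V \<mu> \<tau>)
      = (bracket V (D + l) (D + l) + bracket V \<mu> \<psi> + bracket V \<mu> \<psi>) + (bracket V \<mu> \<tau> + bracket V \<mu> \<tau>)"
    by (simp only: ac_simps)
  also have "\<dots> = bracket V \<mu> \<tau> + bracket V \<mu> \<tau>"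
    unfolding e(2) by simp
  finally have e': "bracket V (D + l) (D + l) + (bracket V \<mu> \<psi> + bracket V \<mu> \<tau>) + (bracket V \<mu> \<psi> + bracket V \<mu> \<tau>)
      = bracket V \<mu> \<tau> + bracket V \<mu> \<tau>" .
  have m: "bracket V (D + l) (D + l) + (bracket V \<mu> \<psi> + bracket V \<mu> \<tau>) + (bracket V \<mu> \<psi> + bracket V \<mu> \<tau>) = 0
      \<longleftrightarrow> bracket V \<mu> \<tau> = 0"
    unfolding e'
  proof
    assume z: "bracket V \<mu> \<tau> + bracket V \<mu> \<tau> = 0"
    show "bracket V \<mu> \<tau> = 0"
    proof
      fix vs show "bracket V \<mu> \<tau> vs = 0 vs"
        using V.double_eq_0[of "bracket V \<mu> \<tau> vs"] fun_cong[OF z, of vs] by simp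
    qed
  qed simp
  show ?thesis
    unfolding Z02_iff is_ext_iff[OF l C_par_subspace(2)[OF ps True]]
      V.bracket_add_right[OF mu_odd c] V.bracket_add_right[OF alpha_odd[OF l] c] m e(1,3)
    using True by simp
qed (simp add: Z02_iff)

end

text \<open>The chosen \<psi> serves as origin: the extensions with components \<delta>, \<mu>,
  \<lambda> are those with last component \<psi> + \<tau>, where \<tau> lies in
  \<open>Z\<close>.\<close>

locale extension_point = extension_base M W D \<mu>
  for M :: "('k::field, 'm::ab_group_add) gspace" and W :: "('k, 'w::ab_group_add) gspace" and D \<mu> +
  fixes l \<psi> :: "('m, 'w) cochain"
  assumes l: "l \<in> C_par M W 1 1 1" and psi: "\<psi> \<in> C_par M W 1 0 2" and point: "is_ext l \<psi>"
begin

abbreviation "Z \<equiv> Z02 M W \<mu> (D + l)"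
abbreviation "cl \<equiv> cls2 M W \<mu> (D + l)"
abbreviation "G \<equiv> G_dml M W D \<mu> l"
abbreviation "act \<equiv> act_H02 M W D \<mu> l \<psi>"

text \<open>The affine action on the solutions \<psi> + \<tau>, written in the coordinate \<tau>;
  \<open>pull g \<psi> - \<psi>\<close> is the displacement of the origin by g.\<close>

definition shift :: "('m \<times> 'w \<Rightarrow> 'm \<times> 'w) \<Rightarrow> ('m, 'w) cochain \<Rightarrow> ('m, 'w) cochain \<Rightarrow> ('m, 'w) cochain" where
  "shift g \<beta> \<tau> = pull g \<psi> - \<psi> + pull g \<tau> + psi_shift \<mu> (D + l) \<beta>"

lemma G_iff: "(g, \<beta>) \<in> G \<longleftrightarrow> g \<in> G_MW M W \<and> pull g D = D \<and> pull g \<mu> = \<mu> \<and> \<beta> \<in> Beta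
    \<and> l = pull g l + bracket V \<mu> \<beta>"
  by (auto simp: G_dml_def G_dm_def)

lemma Z_par: "\<tau> \<in> Z \<Longrightarrow> \<tau> \<in> C_par M W 1 0 2"
  by (simp add: Z02_iff)

lemma Z_ext: "\<tau> \<in> Z \<Longrightarrow> is_ext l (\<psi> + \<tau>)"
  using Z02_iff_ext[OF l psi point] by simp

lemma shift_pull:
  assumes g: "(g, \<beta>) \<in> G" and t: "\<tau> \<in> Z"
  shows "pull (g \<circ> expo \<beta>) (D + \<mu> + l + (\<psi> + \<tau>)) = D + \<mu> + l + (\<psi> + shift g \<beta> \<tau>)"
    and "shift g \<beta> \<tau> \<in> Z"
proof -
  have g': "g \<in> G_MW M W" "pull g D = D" "pull g \<mu> = \<mu>" "\<beta> \<in> Beta" "l = pull g l + bracket V \<mu> \<beta>"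
    using g unfolding G_iff by blast+
  note e = pull_base[OF g'(1-4) l C_par_subspace(2)[OF psi Z_par[OF t]], folded g'(5)]
  have s: "pull g (\<psi> + \<tau>) + psi_shift \<mu> (D + l) \<beta> = \<psi> + shift g \<beta> \<tau>"
    by (simp add: shift_def V.pull_add[OF G_MW_GL[OF g'(1)]] ac_simps)
  show p: "pull (g \<circ> expo \<beta>) (D + \<mu> + l + (\<psi> + \<tau>)) = D + \<mu> + l + (\<psi> + shift g \<beta> \<tau>)"
    unfolding e(1) s ..
  have "is_ext l (\<psi> + shift g \<beta> \<tau>)"
    unfolding p[symmetric] by (rule V.pull_codifferential[OF G_gen_GL[OF G_genI[OF g'(1,4)]] Z_ext[OF t]])
  moreover have "shift g \<beta> \<tau> \<in> C_par M W 1 0 2"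
    using C_par_subspace(4)[OF e(3)[unfolded s] psi] by simp
  ultimately show "shift g \<beta> \<tau> \<in> Z"
    unfolding Z02_iff_ext[OF l psi point] by simp
qed

text \<open>Components are unique, so an element of \<open>G_gen\<close> linking two extensions over
  (\<delta>, \<mu>, \<lambda>) must stabilise all three; comparing the last components gives the
  formula.\<close>

lemma shift_conv:
  assumes t: "\<tau> \<in> Z" "\<tau>' \<in> Z" and g: "g \<in> G_MW M W" and b: "\<beta> \<in> Beta"
    and eq: "pull (g \<circ> expo \<beta>) (D + \<mu> + l + (\<psi> + \<tau>)) = D + \<mu> + l + (\<psi> + \<tau>')"
  shows "(g, \<beta>) \<in> G" "\<tau>' = shift g \<beta> \<tau>"
proof -
  note pt = C_par_subspace(2)[OF psi Z_par[OF t(1)]] C_par_subspace(2)[OF psi Z_par[OF t(2)]]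
  note e = pull_gen[OF g b D mu l pt(1)]
  have u: "pull g D = D \<and> pull g \<mu> = \<mu> \<and> new_l (pull g \<mu>) g \<beta> l = l \<and>
    pull g (\<psi> + \<tau>) + psi_shift (pull g \<mu>) (pull g D + new_l (pull g \<mu>) g \<beta> l) \<beta> = \<psi> + \<tau>'"
    by (rule decomposition_unique[OF pull_W_data[OF g D] D pull_C_par[OF g mu] mu e(2) l e(3) pt(2) eq[unfolded e(1)]])
  then show gG: "(g, \<beta>) \<in> G"
    unfolding G_iff using g b by (metis new_l_def)
  from u have "\<psi> + \<tau>' = pull g (\<psi> + \<tau>) + psi_shift \<mu> (D + l) \<beta>"
    by metis
  then have "\<tau>' = pull g (\<psi> + \<tau>) + psi_shift \<mu> (D + l) \<beta> - \<psi>"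
    by (metis add_diff_cancel_left')
  then show "\<tau>' = shift g \<beta> \<tau>"
    by (simp add: shift_def V.pull_add[OF G_MW_GL[OF g]] algebra_simps)
qed

text \<open>By this the action on \<open>H\<^sup>0\<^sup>,\<^sup>2\<close> does not depend on the representative \<open>\<tau>\<close>: \<open>g\<^sup>*(\<delta> + \<lambda>)\<close> and \<open>\<delta> + \<lambda>\<close>
  differ by \<open>[\<mu>, \<beta>]\<close>.\<close>

lemma bracket_bracket_0:
  assumes b: "\<beta> \<in> Beta" and p: "\<phi> \<in> Beta" and z: "bracket V \<mu> \<phi> = 0"
  shows "bracket V (bracket V \<mu> \<beta>) \<phi> = 0"
proof
  fix vs
  have t2: "\<mu> \<in> typed True (Suc 1) 0" using C_par_type[OF mu] by (simp add: numeral_2_eq_2 One_nat_def)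
  have m: "bracket V \<mu> \<beta> \<in> typed True (Suc 0) (Suc 0)" "bracket V \<mu> \<beta> \<in> V.hcochains 1"
    using bracket_beta_M[OF t2 mu_odd b] bracket_beta_odd[OF mu_odd b] by (simp_all add: One_nat_def)
  have len: "\<mu> vs = 0" "bracket V \<mu> \<beta> vs = 0" if "length vs \<noteq> 2" for vs
    using typed_length[OF C_par_type[OF mu], of vs] typed_length[OF m(1), of vs] that by simp_all
  have bf: "f \<in> typed True k n \<Longrightarrow> \<gamma> \<in> Beta \<Longrightarrow> \<gamma> [f vs] = 0" for f k n vs \<gamma>
    using typed_value[of f True k n vs] by (simp add: Beta_M)
  have bb: "\<gamma> \<in> Beta \<Longrightarrow> \<gamma>' \<in> Beta \<Longrightarrow> \<gamma> [\<gamma>' [x]] = 0" for \<gamma> \<gamma>' x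
    by (simp add: Beta_M Beta_snd)
  have m0: "\<mu> [0, y] = 0" "\<mu> [x, 0] = 0" for x y
    using V.cochain_zero_entry[OF V.hcochains_cochain[OF mu_odd]] by simp_all
  have zz: "\<mu> [\<phi> [x], y] + \<mu> [x, \<phi> [y]] = 0" for x y
    using bracket_beta[OF mu_odd len(1) p, of x y] z bf[OF t2 p] by simp
  \<comment> \<open>Putting a value of \<beta> into one slot of \<open>zz\<close> kills the summand
    in which \<phi> is applied to it.\<close>
  have z1: "\<mu> [\<phi> [x], \<beta> [y]] = 0" "\<mu> [\<beta> [x], \<phi> [y]] = 0" for x y
    using zz[of x "\<beta> [y]"] zz[of "\<beta> [x]" y] bb[OF p b] m0 by simp_all
  show "bracket V (bracket V \<mu> \<beta>) \<phi> vs = 0 vs"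
  proof (cases "length vs = 2")
    case True
    then obtain v w where vs: "vs = [v, w]"
      by (auto simp: numeral_2_eq_2 length_Suc_conv)
    have "bracket V \<mu> \<beta> [\<phi> [v], w] = 0" "bracket V \<mu> \<beta> [v, \<phi> [w]] = 0"
      using bracket_beta[OF mu_odd len(1) b] bf[OF t2 b] by (simp_all add: bb[OF b p] m0 z1)
    then show ?thesis
      using bracket_beta[OF m(2) len(2) p, of v w] bf[OF m(1) p, of "[v, w]"] by (simp add: vs)
  next
    case False
    then show ?thesis
      using typed_length[OF bracket_beta_M[OF m p], of vs] by simp
  qed
qed

text \<open>The union defining the action runs over all \<tau>' in the class. They differ from
  \<tau> by some [\<delta> + \<lambda>, \<phi>], which g turns into the bracket of \<delta> +
  \<lambda> - [\<mu>, \<beta>] with \<open>pull g \<phi>\<close>; the correction vanishes, so every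
  term is the same class.\<close>

lemma act_cl:
  assumes g: "(g, \<beta>) \<in> G" and t: "\<tau> \<in> Z"
  shows "act (g, \<beta>) (cl \<tau>) = cl (shift g \<beta> \<tau>)"
proof -
  have g': "g \<in> G_MW M W" "pull g D = D" "pull g \<mu> = \<mu>" "\<beta> \<in> Beta" "l = pull g l + bracket V \<mu> \<beta>"
    using g unfolding G_iff by blast+
  note GL = G_MW_GL[OF g'(1)] and al = alpha_odd[OF l]
  have *: "cl (shift g \<beta> \<tau>') = cl (shift g \<beta> \<tau>)" if t': "\<tau>' \<in> Z" and c: "cl \<tau>' = cl \<tau>" for \<tau>'
  proof -
    obtain \<phi> where phi: "\<phi> \<in> Beta" "bracket V \<mu> \<phi> = 0" "\<tau>' = \<tau> + bracket V (D + l) \<phi>"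
      using c[symmetric] unfolding cls2_eq_iff[OF mu_odd al C_par_hcochain[OF Z_par[OF t]] C_par_hcochain[OF Z_par[OF t']]]
      by blast
    have gp: "pull g \<phi> \<in> Beta" by (rule pull_C_par[OF g'(1) phi(1)])
    have z: "bracket V \<mu> (pull g \<phi>) = 0"
      using V.pull_bracket_cochain[OF GL mu_odd Beta_cochain[OF phi(1)]] by (simp add: phi(2) g'(3) V.pull_0[OF GL])
    have mb: "bracket V \<mu> \<beta> \<in> V.hcochains 1" by (rule bracket_beta_odd[OF mu_odd g'(4)])
    have "pull g (D + l) = (D + l) - bracket V \<mu> \<beta>"
      unfolding V.pull_add[OF GL] g'(2) by (subst (2) g'(5)) simp
    then have "pull g (bracket V (D + l) \<phi>) = bracket V ((D + l) - bracket V \<mu> \<beta>) (pull g \<phi>)"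
      using V.pull_bracket_cochain[OF GL al Beta_cochain[OF phi(1)]] by simp
    also have "\<dots> = bracket V (D + l) (pull g \<phi>)"
      using V.bracket_diff_left[OF al mb Beta_even[OF gp]] bracket_bracket_0[OF g'(4) gp z] by simp
    finally have "shift g \<beta> \<tau>' = shift g \<beta> \<tau> + bracket V (D + l) (pull g \<phi>)"
      unfolding shift_def phi(3) V.pull_add[OF GL] by (simp add: ac_simps)
    then have "cl (shift g \<beta> \<tau>) = cl (shift g \<beta> \<tau>')"
      unfolding cls2_eq_iff[OF mu_odd al C_par_hcochain[OF Z_par[OF shift_pull(2)[OF g t]]]
          C_par_hcochain[OF Z_par[OF shift_pull(2)[OF g t']]]]
      using gp z by blast
    then show ?thesis by (rule sym)
  qed
  have "act (g, \<beta>) (cl \<tau>) = (\<Union>\<tau>'\<in>{\<tau>' \<in> Z. cl \<tau>' = cl \<tau>}. cl (shift g \<beta> \<tau>'))"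
    unfolding act_H02_def shift_def psi_shift_def Let_def split ..
  also have "\<dots> = (\<Union>\<tau>'\<in>{\<tau>' \<in> Z. cl \<tau>' = cl \<tau>}. cl (shift g \<beta> \<tau>))"
    using * by (intro SUP_cong) auto
  also have "\<dots> = cl (shift g \<beta> \<tau>)"
    using t by auto
  finally show ?thesis .
qed

lemma id_in_G: "\<phi> \<in> Beta \<Longrightarrow> bracket V \<mu> \<phi> = 0 \<Longrightarrow> (id, \<phi>) \<in> G"
  by (simp add: G_iff id_G_MW pull_id)

lemma cl_equivalent:
  assumes t: "\<tau> \<in> Z" "\<tau>' \<in> Z" and c: "cl \<tau> = cl \<tau>'"
  shows "equivalent (D + \<mu> + l + (\<psi> + \<tau>)) (D + \<mu> + l + (\<psi> + \<tau>'))"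
proof -
  obtain \<phi> where phi: "\<phi> \<in> Beta" "bracket V \<mu> \<phi> = 0" "\<tau>' = \<tau> + bracket V (D + l) \<phi>"
    using c unfolding cls2_eq_iff[OF mu_odd alpha_odd[OF l] C_par_hcochain[OF Z_par[OF t(1)]] C_par_hcochain[OF Z_par[OF t(2)]]]
    by blast
  \<comment> \<open>The half bracket drops out because [\<mu>, \<phi>] = 0.\<close>
  have "psi_shift \<mu> (D + l) \<phi> = bracket V (D + l) \<phi>"
  proof -
    have "(\<lambda>vs. scl V (1 / 2) ((0 :: ('m, 'w) cochain) vs)) = 0"
      by (rule ext) (simp del: dsum_simps)
    then show ?thesis
      unfolding psi_shift_def phi(2) by simp
  qed
  then have "shift id \<phi> \<tau> = \<tau>'"
    by (simp add: shift_def pull_id phi(3))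
  then have "pull (id \<circ> expo \<phi>) (D + \<mu> + l + (\<psi> + \<tau>)) = D + \<mu> + l + (\<psi> + \<tau>')"
    using shift_pull(1)[OF id_in_G[OF phi(1,2)] t(1)] by simp
  then show ?thesis
    by (rule equivalentI[OF G_genI[OF id_G_MW phi(1)]])
qed

text \<open>\<open>shift_pull\<close> and \<open>shift_conv\<close> match the stabiliser with the
  equivalences between extensions over (\<delta>, \<mu>, \<lambda>). Orbits thus inherit symmetry
  and transitivity from \<open>equivalent\<close>.\<close>

lemma orbit_eq:
  assumes t: "\<tau> \<in> Z"
  shows "orbit G act (cl \<tau>) = {cl \<tau>' | \<tau>'. \<tau>' \<in> Z \<and> equivalent (D + \<mu> + l + (\<psi> + \<tau>)) (D + \<mu> + l + (\<psi> + \<tau>'))}"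
proof (intro equalityI subsetI)
  fix x assume "x \<in> orbit G act (cl \<tau>)"
  then obtain g \<beta> where g: "(g, \<beta>) \<in> G" "x = act (g, \<beta>) (cl \<tau>)"
    by (auto simp: orbit_def)
  have "equivalent (D + \<mu> + l + (\<psi> + \<tau>)) (D + \<mu> + l + (\<psi> + shift g \<beta> \<tau>))"
    using G_genI g(1) unfolding G_iff by (intro equivalentI[OF _ shift_pull(1)[OF g(1) t]]) blast
  then show "x \<in> {cl \<tau>' | \<tau>'. \<tau>' \<in> Z \<and> equivalent (D + \<mu> + l + (\<psi> + \<tau>)) (D + \<mu> + l + (\<psi> + \<tau>'))}"
    unfolding g(2) act_cl[OF g(1) t] using shift_pull(2)[OF g(1) t] by blast
next
  fix x assume "x \<in> {cl \<tau>' | \<tau>'. \<tau>' \<in> Z \<and> equivalent (D + \<mu> + l + (\<psi> + \<tau>)) (D + \<mu> + l + (\<psi> + \<tau>'))}"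
  then obtain \<tau>' h where t': "x = cl \<tau>'" "\<tau>' \<in> Z" and h: "h \<in> G_gen M W"
    "pull h (D + \<mu> + l + (\<psi> + \<tau>)) = D + \<mu> + l + (\<psi> + \<tau>')"
    unfolding orbit_def by auto
  obtain g \<beta> where g: "g \<in> G_MW M W" "\<beta> \<in> Beta" "h = g \<circ> expo \<beta>"
    using h(1) by (auto simp: G_gen_def)
  note c = shift_conv[OF t t'(2) g(1,2) h(2)[unfolded g(3)]]
  show "x \<in> orbit G act (cl \<tau>)"
    unfolding orbit_def t'(1) c(2) using act_cl[OF c(1) t] c(1) by force
qed

text \<open>A class determines \<tau> only up to a coboundary, and \<open>cl_equivalent\<close>
  absorbs the difference.\<close>

lemma cl_mem_orbit_iff:
  assumes "\<tau>0 \<in> Z" "\<tau> \<in> Z"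
  shows "cl \<tau> \<in> orbit G act (cl \<tau>0) \<longleftrightarrow> equivalent (D + \<mu> + l + (\<psi> + \<tau>0)) (D + \<mu> + l + (\<psi> + \<tau>))"
proof
  assume "cl \<tau> \<in> orbit G act (cl \<tau>0)"
  then obtain \<tau>' where t': "\<tau>' \<in> Z" "cl \<tau>' = cl \<tau>"
    and e: "equivalent (D + \<mu> + l + (\<psi> + \<tau>0)) (D + \<mu> + l + (\<psi> + \<tau>'))"
    unfolding orbit_eq[OF assms(1)] by auto
  show "equivalent (D + \<mu> + l + (\<psi> + \<tau>0)) (D + \<mu> + l + (\<psi> + \<tau>))"
    by (rule equivalent_trans[OF e cl_equivalent[OF t'(1) assms(2) t'(2)]])
next
  assume "equivalent (D + \<mu> + l + (\<psi> + \<tau>0)) (D + \<mu> + l + (\<psi> + \<tau>))"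
  then show "cl \<tau> \<in> orbit G act (cl \<tau>0)"
    unfolding orbit_eq[OF assms(1)] using assms(2) by blast
qed

lemma H02_orbitsE:
  assumes "\<O> \<in> H02_orbits M W D \<mu> l \<psi>"
  obtains \<tau>0 where "\<tau>0 \<in> Z" "\<O> = orbit G act (cl \<tau>0)"
  using assms unfolding H02_orbits_def orbits_def H02_def by blast

lemma orbit_in_H02_orbits: "\<tau> \<in> Z \<Longrightarrow> orbit G act (cl \<tau>) \<in> H02_orbits M W D \<mu> l \<psi>"
  unfolding H02_orbits_def orbits_def H02_def by (intro imageI)

lemma H02_orbits_eq:
  assumes "\<O> \<in> H02_orbits M W D \<mu> l \<psi>" "\<O>' \<in> H02_orbits M W D \<mu> l \<psi>"
    and t: "\<tau> \<in> Z" "\<tau>' \<in> Z" "cl \<tau> \<in> \<O>" "cl \<tau>' \<in> \<O>'"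
    and e: "equivalent (D + \<mu> + l + (\<psi> + \<tau>)) (D + \<mu> + l + (\<psi> + \<tau>'))"
  shows "\<O> = \<O>'"
proof -
  obtain \<tau>0 where t0: "\<tau>0 \<in> Z" "\<O> = orbit G act (cl \<tau>0)" by (rule H02_orbitsE[OF assms(1)])
  obtain \<tau>1 where t1: "\<tau>1 \<in> Z" "\<O>' = orbit G act (cl \<tau>1)" by (rule H02_orbitsE[OF assms(2)])
  have "equivalent (D + \<mu> + l + (\<psi> + \<tau>0)) (D + \<mu> + l + (\<psi> + \<tau>))"
    using t(3) unfolding t0(2) cl_mem_orbit_iff[OF t0(1) t(1)] .
  moreover have "equivalent (D + \<mu> + l + (\<psi> + \<tau>1)) (D + \<mu> + l + (\<psi> + \<tau>'))"
    using t(4) unfolding t1(2) cl_mem_orbit_iff[OF t1(1) t(2)] .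
  ultimately have e01: "equivalent (D + \<mu> + l + (\<psi> + \<tau>0)) (D + \<mu> + l + (\<psi> + \<tau>1))"
    by (rule equivalent_trans[OF equivalent_trans[OF _ e] equivalent_sym])
  \<comment> \<open>Both orbits are cut out by one and the same equivalence class of
    extensions.\<close>
  have "equivalent (D + \<mu> + l + (\<psi> + \<tau>0)) d \<longleftrightarrow> equivalent (D + \<mu> + l + (\<psi> + \<tau>1)) d" for d
    using equivalent_trans[OF e01] equivalent_trans[OF equivalent_sym[OF e01]] by (intro iffI)
  then show ?thesis
    unfolding t0(2) t1(2) orbit_eq[OF t0(1)] orbit_eq[OF t1(1)] by simp
qed

lemma H02_orbit_nonempty:
  assumes "\<O> \<in> H02_orbits M W D \<mu> l \<psi>"
  shows "\<exists>\<tau>\<in>Z. cl \<tau> \<in> \<O>"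
proof -
  obtain \<tau>0 where t0: "\<tau>0 \<in> Z" "\<O> = orbit G act (cl \<tau>0)" by (rule H02_orbitsE[OF assms])
  have "cl \<tau>0 \<in> \<O>"
    unfolding t0(2) cl_mem_orbit_iff[OF t0(1) t0(1)] by (rule equivalent_refl)
  with t0(1) show ?thesis by (intro bexI)
qed

lemma H02_orbit_equivalent:
  assumes "\<O> \<in> H02_orbits M W D \<mu> l \<psi>" and t: "\<tau> \<in> Z" "\<tau>' \<in> Z" "cl \<tau> \<in> \<O>" "cl \<tau>' \<in> \<O>"
  shows "equivalent (D + \<mu> + l + (\<psi> + \<tau>)) (D + \<mu> + l + (\<psi> + \<tau>'))"
proof -
  obtain \<tau>0 where t0: "\<tau>0 \<in> Z" "\<O> = orbit G act (cl \<tau>0)" by (rule H02_orbitsE[OF assms(1)])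
  have "equivalent (D + \<mu> + l + (\<psi> + \<tau>0)) (D + \<mu> + l + (\<psi> + \<tau>))"
    "equivalent (D + \<mu> + l + (\<psi> + \<tau>0)) (D + \<mu> + l + (\<psi> + \<tau>'))"
    using t(3,4) unfolding t0(2) cl_mem_orbit_iff[OF t0(1) t(1)] cl_mem_orbit_iff[OF t0(1) t(2)] .
  then show ?thesis
    by (rule equivalent_trans[OF equivalent_sym])
qed

end


section \<open>The classification\<close>

context graded_pair
begin

section \<open>Extensions in terms of structures on M and W\<close>

lemma inW_W_data: "\<delta> \<in> codifferentials W \<Longrightarrow> inW \<delta> \<in> W_data"
  unfolding W_data_def inW_codifferential using inW_typed inW_hcochain by blast

lemma inM_C_par: "\<mu> \<in> codifferentials M \<Longrightarrow> inM \<mu> \<in> C_par M W 1 2 0"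
  unfolding C_par_typed inM_codifferential using inM_typed inM_hcochain by blast

lemma extension_base: "\<delta> \<in> codifferentials W \<Longrightarrow> \<mu> \<in> codifferentials M \<Longrightarrow>
    extension_base M W (inW \<delta>) (inM \<mu>)"
  by unfold_locales (simp_all add: inW_W_data inM_C_par inM_codifferential inW_codifferential)

lemma extensions_iff:
  assumes "\<delta> \<in> codifferentials W" "\<mu> \<in> codifferentials M" "l \<in> C_par M W 1 1 1" "\<psi> \<in> C_par M W 1 0 2"
  shows "inW \<delta> + inM \<mu> + l + \<psi> \<in> extensions M W \<longleftrightarrow> inW \<delta> + inM \<mu> + l + \<psi> \<in> codifferentials V"
proof
  assume *: "inW \<delta> + inM \<mu> + l + \<psi> \<in> codifferentials V"
  have "\<delta> \<in> {\<delta> \<in> Hom W 2. has_parity W 1 \<delta>}"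
    using assms(1) by (simp add: inW_codifferential)
  with * assms(3,4) inM_C_par[OF assms(2)] show "inW \<delta> + inM \<mu> + l + \<psi> \<in> extensions M W"
    unfolding extensions_def by blast
qed (simp add: extensions_def)

text \<open>The W-valued part of [d, d] = 0 and its part of bidegree (3,0) say that \<delta> and
  \<mu> are codifferentials themselves.\<close>

lemma extensions_decomp:
  assumes d: "d \<in> extensions M W"
  obtains \<delta> \<mu> l \<psi> where "\<delta> \<in> codifferentials W" "\<mu> \<in> codifferentials M"
    "l \<in> C_par M W 1 1 1" "\<psi> \<in> C_par M W 1 0 2" "d = inW \<delta> + inM \<mu> + l + \<psi>"
proof -
  obtain \<delta> m l \<psi> where *: "\<delta> \<in> Hom W 2" "has_parity W 1 \<delta>" "m \<in> C_par M W 1 2 0" "l \<in> C_par M W 1 1 1"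
    "\<psi> \<in> C_par M W 1 0 2" "d = inW \<delta> + m + l + \<psi>" and dc: "d \<in> codifferentials V"
    using d unfolding extensions_def by blast
  obtain \<mu> where mu: "\<mu> \<in> Hom M 2" "has_parity M 1 \<mu>" "m = inM \<mu>"
    using inM_surj[OF C_par_type[OF *(3)] C_par_hcochain[OF *(3)]] by metis
  have "bracket V (inW \<delta>) (inW \<delta>) = 0 \<and> bracket V m m = 0"
    using dc unfolding *(6) ext_codifferential_iff[OF inW_typed[OF *(1)] inW_hcochain[OF *(1,2)]
        C_par_type[OF *(3)] C_par_hcochain[OF *(3)] C_par_type[OF *(4)] C_par_hcochain[OF *(4)]
        C_par_type[OF *(5)] C_par_hcochain[OF *(5)]] by simp
  then have "\<delta> \<in> codifferentials W" "\<mu> \<in> codifferentials M"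
    using *(1,2) mu unfolding inM_codifferential inW_codifferential by simp_all
  with *(4-6) mu(3) show ?thesis using that by simp
qed

end

theorem theorem7p1:
  fixes M :: "('k::field, 'm::ab_group_add) gspace"
    and W :: "('k, 'w::ab_group_add) gspace"
    and RD :: "('w list \<Rightarrow> 'w) set"
    and RM :: "('m list \<Rightarrow> 'm) set"
    and RL :: "('w list \<Rightarrow> 'w) \<Rightarrow> ('m list \<Rightarrow> 'm) \<Rightarrow> ('m, 'w) cochain set set"
    and lam psi :: "('w list \<Rightarrow> 'w) \<Rightarrow> ('m list \<Rightarrow> 'm) \<Rightarrow> ('m, 'w) cochain set \<Rightarrow>
                    ('m, 'w) cochain"
  assumes char: "(2::'k) \<noteq> 0" "(3::'k) \<noteq> 0"
    and graded: "graded_space M" "graded_space W"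
    and rep_delta: "representatives (GL W) pull (codifferentials W) RD"
    and rep_mu: "representatives (GL M) pull (codifferentials M) RM"
    and rep_lambda: "\<And>\<delta> \<mu>. \<delta> \<in> RD \<Longrightarrow> \<mu> \<in> RM \<Longrightarrow>
      representatives (G_dm M W (inW \<delta>) (inM \<mu>)) (act_H M W (inM \<mu>) 1 1)
        (MC_classes M W (inW \<delta>) (inM \<mu>)) (RL \<delta> \<mu>)"
    and lam: "\<And>\<delta> \<mu> L. \<delta> \<in> RD \<Longrightarrow> \<mu> \<in> RM \<Longrightarrow> L \<in> RL \<delta> \<mu> \<Longrightarrow>
      lam \<delta> \<mu> L \<in> L \<inter> C_par M W 1 1 1"
    and psi: "\<And>\<delta> \<mu> L. \<delta> \<in> RD \<Longrightarrow> \<mu> \<in> RM \<Longrightarrow> L \<in> RL \<delta> \<mu> \<Longrightarrow>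
      psi \<delta> \<mu> L \<in> C_par M W 1 0 2 \<and> inW \<delta> + inM \<mu> + lam \<delta> \<mu> L + psi \<delta> \<mu> L \<in> extensions M W"
  shows
    "(\<forall>\<delta>\<in>codifferentials W. \<forall>\<mu>\<in>codifferentials M. \<forall>L\<in>MC_classes M W (inW \<delta>) (inM \<mu>).
        \<forall>l\<in>L \<inter> C_par M W 1 1 1. \<exists>\<psi>\<in>C_par M W 1 0 2. inW \<delta> + inM \<mu> + l + \<psi> \<in> extensions M W)
   \<and> (\<forall>d\<in>extensions M W. \<exists>!x. case x of (\<delta>, \<mu>, L, \<O>) \<Rightarrow>
        \<delta> \<in> RD \<and> \<mu> \<in> RM \<and> L \<in> RL \<delta> \<mu>
        \<and> \<O> \<in> H02_orbits M W (inW \<delta>) (inM \<mu>) (lam \<delta> \<mu> L) (psi \<delta> \<mu> L)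
        \<and> (\<exists>\<tau>\<in>Z02 M W (inM \<mu>) (inW \<delta> + lam \<delta> \<mu> L).
              cls2 M W (inM \<mu>) (inW \<delta> + lam \<delta> \<mu> L) \<tau> \<in> \<O>
            \<and> inW \<delta> + inM \<mu> + lam \<delta> \<mu> L + psi \<delta> \<mu> L + \<tau> \<in> orbit (G_gen M W) pull d))
   \<and> (\<forall>\<delta>\<in>RD. \<forall>\<mu>\<in>RM. \<forall>L\<in>RL \<delta> \<mu>.
        \<forall>\<O>\<in>H02_orbits M W (inW \<delta>) (inM \<mu>) (lam \<delta> \<mu> L) (psi \<delta> \<mu> L).
        let d = inW \<delta> + inM \<mu> + lam \<delta> \<mu> L + psi \<delta> \<mu> L;
            T = {\<tau> \<in> Z02 M W (inM \<mu>) (inW \<delta> + lam \<delta> \<mu> L).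
                   cls2 M W (inM \<mu>) (inW \<delta> + lam \<delta> \<mu> L) \<tau> \<in> \<O>}
        in T \<noteq> {} \<and> (\<forall>\<tau>\<in>T. d + \<tau> \<in> extensions M W)
          \<and> (\<forall>\<tau>\<in>T. \<forall>\<tau>'\<in>T. d + \<tau>' \<in> orbit (G_gen M W) pull (d + \<tau>)))"
proof -
  interpret graded_pair M W
    using graded char(1) by (simp add: graded_pair_def graded_def)
  have RD: "\<delta> \<in> codifferentials W" if "\<delta> \<in> RD" for \<delta>
    by (rule representatives_subset[OF rep_delta that])
  have RM: "\<mu> \<in> codifferentials M" if "\<mu> \<in> RM" for \<mu>
    by (rule representatives_subset[OF rep_mu that])
  have base: "extension_base M W (inW \<delta>) (inM \<mu>)" if "\<delta> \<in> RD" "\<mu> \<in> RM" for \<delta> \<mu>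
    by (rule extension_base[OF RD[OF that(1)] RM[OF that(2)]])
  have point: "extension_point M W (inW \<delta>) (inM \<mu>) (lam \<delta> \<mu> L) (psi \<delta> \<mu> L)"
    if r: "\<delta> \<in> RD" "\<mu> \<in> RM" "L \<in> RL \<delta> \<mu>" for \<delta> \<mu> L
  proof -
    interpret extension_base M W "inW \<delta>" "inM \<mu>" by (rule base[OF r(1,2)])
    show ?thesis
      using lam[OF r] psi[OF r] by unfold_locales (auto simp: extensions_def)
  qed
  \<comment> \<open>A class is determined by any of its members, so L is recovered from the chosen
    cochain.\<close>
  have lam_cls: "cls M W (inM \<mu>) 1 1 (lam \<delta> \<mu> L) = L" if r: "\<delta> \<in> RD" "\<mu> \<in> RM" "L \<in> RL \<delta> \<mu>" for \<delta> \<mu> L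
  proof -
    interpret extension_base M W "inW \<delta>" "inM \<mu>" by (rule base[OF r(1,2)])
    obtain l0 where "L = cls M W (inM \<mu>) 1 1 l0"
      using representatives_subset[OF rep_lambda[OF r(1,2)] r(3)] unfolding MC_classes_iff by blast
    then show ?thesis
      using cls_11_mem[OF mu_odd] lam[OF r] by blast
  qed
  have ex_psi: "\<exists>\<psi>\<in>C_par M W 1 0 2. inW \<delta> + inM \<mu> + l + \<psi> \<in> extensions M W"
    if dm: "\<delta> \<in> codifferentials W" "\<mu> \<in> codifferentials M" and L: "L \<in> MC_classes M W (inW \<delta>) (inM \<mu>)"
      and l: "l \<in> L \<inter> C_par M W 1 1 1" for \<delta> \<mu> L l
  proof -
    interpret extension_base M W "inW \<delta>" "inM \<mu>" by (rule extension_base[OF dm])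
    obtain \<psi> where p: "\<psi> \<in> C_par M W 1 0 2" "is_ext l \<psi>"
      using class_member_ext[OF L l] by blast
    have "inW \<delta> + inM \<mu> + l + \<psi> \<in> extensions M W"
      unfolding extensions_iff[OF dm IntD2[OF l] p(1)] by (rule p(2))
    with p(1) show ?thesis by (intro bexI)
  qed
  let ?P = "\<lambda>d \<delta> \<mu> L \<O>. \<delta> \<in> RD \<and> \<mu> \<in> RM \<and> L \<in> RL \<delta> \<mu>
        \<and> \<O> \<in> H02_orbits M W (inW \<delta>) (inM \<mu>) (lam \<delta> \<mu> L) (psi \<delta> \<mu> L)
        \<and> (\<exists>\<tau>\<in>Z02 M W (inM \<mu>) (inW \<delta> + lam \<delta> \<mu> L).
              cls2 M W (inM \<mu>) (inW \<delta> + lam \<delta> \<mu> L) \<tau> \<in> \<O>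
            \<and> inW \<delta> + inM \<mu> + lam \<delta> \<mu> L + psi \<delta> \<mu> L + \<tau> \<in> orbit (G_gen M W) pull d)"
  have exist: "\<exists>\<delta> \<mu> L \<O>. ?P d \<delta> \<mu> L \<O>" if d: "d \<in> extensions M W" for d
  proof -
    obtain \<delta>0 \<mu>0 l0 \<psi>0 where d0: "\<delta>0 \<in> codifferentials W" "\<mu>0 \<in> codifferentials M"
      "l0 \<in> C_par M W 1 1 1" "\<psi>0 \<in> C_par M W 1 0 2" "d = inW \<delta>0 + inM \<mu>0 + l0 + \<psi>0"
      by (rule extensions_decomp[OF d])
    obtain b where b: "b \<in> GL W" "pull b \<delta>0 \<in> RD"
      by (rule representatives_obtain[OF rep_delta d0(1)])
    obtain a where a: "a \<in> GL M" "pull a \<mu>0 \<in> RM"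
      by (rule representatives_obtain[OF rep_mu d0(2)])
    define \<delta> \<mu> g1 where "\<delta> = pull b \<delta>0" "\<mu> = pull a \<mu>0" "g1 = map_prod a b"
    have r: "\<delta> \<in> RD" "\<mu> \<in> RM" using a b by (simp_all add: \<delta>_\<mu>_g1_def)
    have g1: "g1 \<in> G_MW M W" using a b by (auto simp: \<delta>_\<mu>_g1_def G_MW_def)
    interpret extension_base M W "inW \<delta>" "inM \<mu>" by (rule base[OF r])
    define l1 \<psi>1 where "l1 = pull g1 l0" "\<psi>1 = pull g1 \<psi>0"
    have p1: "l1 \<in> C_par M W 1 1 1" "\<psi>1 \<in> C_par M W 1 0 2"
      unfolding l1_\<psi>1_def using pull_C_par[OF g1] d0(3,4) by blast+
    have d1: "pull g1 d = inW \<delta> + inM \<mu> + l1 + \<psi>1"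
      unfolding d0(5) l1_\<psi>1_def V.pull_add[OF G_MW_GL[OF g1]]
      unfolding \<delta>_\<mu>_g1_def pull_inM[OF a(1) b(1)] pull_inW[OF a(1) b(1)] ..
    have e1: "is_ext l1 \<psi>1"
      unfolding d1[symmetric] using d by (intro V.pull_codifferential[OF G_MW_GL[OF g1]]) (simp add: extensions_def)
    \<comment> \<open>The moved d is an extension with these components, so the class of its
      \<lambda> satisfies the MC-equation and its orbit meets the chosen representatives.\<close>
    have "cls M W (inM \<mu>) 1 1 l1 \<in> MC_classes M W (inW \<delta>) (inM \<mu>)"
      unfolding MC_classes_iff using p1 e1 by blast
    then obtain g2 where g2: "g2 \<in> G_dm M W (inW \<delta>) (inM \<mu>)"
      "act_H M W (inM \<mu>) 1 1 g2 (cls M W (inM \<mu>) 1 1 l1) \<in> RL \<delta> \<mu>"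
      by (rule representatives_obtain[OF rep_lambda[OF r]])
    have g2': "g2 \<in> G_MW M W" "pull g2 (inW \<delta>) = inW \<delta>" "pull g2 (inM \<mu>) = inM \<mu>"
      using g2(1) by (simp_all add: G_dm_def)
    define L where "L = cls M W (inM \<mu>) 1 1 (pull g2 l1)"
    have L: "L \<in> RL \<delta> \<mu>"
      using g2(2) unfolding act_H_cls[OF g2'(1,3) mu_odd] L_def .
    interpret extension_point M W "inW \<delta>" "inM \<mu>" "lam \<delta> \<mu> L" "psi \<delta> \<mu> L" by (rule point[OF r L])
    \<comment> \<open>The class is now the chosen one, but the cochain still differs by a
      coboundary; its even primitive \<beta> moves it onto the chosen \<lambda>.\<close>
    obtain \<beta> where be: "\<beta> \<in> Beta" "lam \<delta> \<mu> L = pull g2 l1 + bracket V (inM \<mu>) \<beta>"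
      using cls_11_odd_iff[OF mu_odd pull_C_par[OF g2'(1) p1(1)] l] lam_cls[OF r L] unfolding L_def by auto
    define \<psi>2 where "\<psi>2 = pull g2 \<psi>1 + psi_shift (inM \<mu>) (inW \<delta> + lam \<delta> \<mu> L) \<beta>"
    note e = pull_base[OF g2' be(1) p1, folded be(2), folded \<psi>2_def]
    have eq2: "equivalent d (inW \<delta> + inM \<mu> + lam \<delta> \<mu> L + \<psi>2)"
      by (rule equivalent_trans[OF equivalentI[OF G_MW_G_gen[OF g1] d1] equivalentI[OF G_genI[OF g2'(1) be(1)] e(1)]])
    have e2: "is_ext (lam \<delta> \<mu> L) \<psi>2"
      unfolding e(1)[symmetric] by (rule V.pull_codifferential[OF G_gen_GL[OF G_genI[OF g2'(1) be(1)]] e1])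
    \<comment> \<open>The normalised extension is measured from the chosen origin.\<close>
    define \<tau> where "\<tau> = \<psi>2 - psi \<delta> \<mu> L"
    have pt: "psi \<delta> \<mu> L + \<tau> = \<psi>2" by (simp add: \<tau>_def)
    have t: "\<tau> \<in> Z"
      unfolding Z02_iff_ext[OF l psi point] pt using e2 C_par_subspace(4)[OF e(3) psi] by (simp add: \<tau>_def)
    have "cl \<tau> \<in> orbit G act (cl \<tau>)"
      unfolding cl_mem_orbit_iff[OF t t] by (rule equivalent_refl)
    moreover have "inW \<delta> + inM \<mu> + lam \<delta> \<mu> L + psi \<delta> \<mu> L + \<tau> \<in> orbit (G_gen M W) pull d"
      using eq2 unfolding pt[symmetric] add.assoc .
    ultimately show ?thesis
      using r L t orbit_in_H02_orbits[OF t] by blast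
  qed
  have unique: "\<delta> = \<delta>' \<and> \<mu> = \<mu>' \<and> L = L' \<and> \<O> = \<O>'"
    if P: "?P d \<delta> \<mu> L \<O>" "?P d \<delta>' \<mu>' L' \<O>'" for d \<delta> \<mu> L \<O> \<delta>' \<mu>' L' \<O>'
  proof -
    have r: "\<delta> \<in> RD" "\<mu> \<in> RM" "L \<in> RL \<delta> \<mu>" and r': "\<delta>' \<in> RD" "\<mu>' \<in> RM" "L' \<in> RL \<delta>' \<mu>'"
      using P by simp_all
    interpret A: extension_point M W "inW \<delta>" "inM \<mu>" "lam \<delta> \<mu> L" "psi \<delta> \<mu> L" by (rule point[OF r])
    interpret B: extension_point M W "inW \<delta>'" "inM \<mu>'" "lam \<delta>' \<mu>' L'" "psi \<delta>' \<mu>' L'" by (rule point[OF r'])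
    obtain \<tau> where t: "\<tau> \<in> A.Z" "A.cl \<tau> \<in> \<O>"
      and eq: "equivalent d (inW \<delta> + inM \<mu> + lam \<delta> \<mu> L + psi \<delta> \<mu> L + \<tau>)"
      using P(1) by blast
    obtain \<tau>' where t': "\<tau>' \<in> B.Z" "B.cl \<tau>' \<in> \<O>'"
      and eq': "equivalent d (inW \<delta>' + inM \<mu>' + lam \<delta>' \<mu>' L' + psi \<delta>' \<mu>' L' + \<tau>')"
      using P(2) by blast
    let ?e = "inW \<delta> + inM \<mu> + lam \<delta> \<mu> L + (psi \<delta> \<mu> L + \<tau>)"
    let ?e' = "inW \<delta>' + inM \<mu>' + lam \<delta>' \<mu>' L' + (psi \<delta>' \<mu>' L' + \<tau>')"
    have ee: "equivalent ?e ?e'"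
      using equivalent_trans[OF equivalent_sym[OF eq] eq'] by (simp only: add.assoc)
    then obtain h where h: "h \<in> G_gen M W" "pull h ?e = ?e'"
      unfolding orbit_def by auto
    obtain g \<beta> where g: "g \<in> G_MW M W" and be: "\<beta> \<in> Beta" and hg: "h = g \<circ> expo \<beta>"
      using h(1) by (auto simp: G_gen_def)
    obtain a b where ab: "g = map_prod a b" "a \<in> GL M" "b \<in> GL W"
      using g by (auto simp: G_MW_def)
    note pt = C_par_subspace(2)[OF A.psi A.Z_par[OF t(1)]] C_par_subspace(2)[OF B.psi B.Z_par[OF t'(1)]]
    note e = pull_gen[OF g be A.D A.mu A.l pt(1)]
    \<comment> \<open>The moved first extension and the second one are the same cochain, so their
      components agree one by one.\<close>
    have u: "pull g (inW \<delta>) = inW \<delta>' \<and> pull g (inM \<mu>) = inM \<mu>' \<and>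
        new_l (pull g (inM \<mu>)) g \<beta> (lam \<delta> \<mu> L) = lam \<delta>' \<mu>' L' \<and>
        pull g (psi \<delta> \<mu> L + \<tau>) + psi_shift (pull g (inM \<mu>))
          (pull g (inW \<delta>) + new_l (pull g (inM \<mu>)) g \<beta> (lam \<delta> \<mu> L)) \<beta> = psi \<delta>' \<mu>' L' + \<tau>'"
      by (rule decomposition_unique[OF pull_W_data[OF g A.D] B.D pull_C_par[OF g A.mu] B.mu e(2) B.l e(3) pt(2)
            h(2)[unfolded hg e(1)]])
    have "\<delta>' = pull b \<delta>" "\<mu>' = pull a \<mu>"
      using u inW_inject inM_inject unfolding ab(1) pull_inW[OF ab(2,3)] pull_inM[OF ab(2,3)] by metis+
    then have "\<delta>' \<in> orbit (GL W) pull \<delta>" "\<mu>' \<in> orbit (GL M) pull \<mu>"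
      using ab(2,3) by (auto simp: orbit_def)
    moreover have "\<delta> \<in> orbit (GL W) pull \<delta>" "\<mu> \<in> orbit (GL M) pull \<mu>"
      by (rule orbitI[where act = pull, OF W.id_GL pull_id] orbitI[where act = pull, OF M.id_GL pull_id])+
    ultimately have dm: "\<delta> = \<delta>'" "\<mu> = \<mu>'"
      using representatives_unique[OF rep_delta r(1) r'(1)] representatives_unique[OF rep_mu r(2) r'(2)] by blast+
    have gd: "g \<in> G_dm M W (inW \<delta>) (inM \<mu>)" and gm: "pull g (inM \<mu>) = inM \<mu>"
      using u g dm by (simp_all add: G_dm_def)
    \<comment> \<open>As \<delta> and \<mu> agree with their primed versions, the second \<lambda>
      differs from the moved first one by a \<mu>-coboundary, so g maps the class L to L'.\<close>
    have l': "lam \<delta> \<mu> L' = pull g (lam \<delta> \<mu> L) + bracket V (inM \<mu>) \<beta>"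
      using u unfolding dm[symmetric] gm new_l_def by simp
    have "L' = cls M W (inM \<mu>) 1 1 (lam \<delta> \<mu> L')"
      using lam_cls[OF r'] dm by simp
    also have "\<dots> = cls M W (inM \<mu>) 1 1 (pull g (lam \<delta> \<mu> L))"
      using cls_11_odd_iff[OF A.mu_odd pull_C_par[OF g A.l] B.l[folded dm]] be l' by blast
    also have "\<dots> = act_H M W (inM \<mu>) 1 1 g L"
      using act_H_cls[OF g gm A.mu_odd, of "lam \<delta> \<mu> L"] lam_cls[OF r] by simp
    finally have "L' \<in> orbit (G_dm M W (inW \<delta>) (inM \<mu>)) (act_H M W (inM \<mu>) 1 1) L"
      using gd by (auto simp: orbit_def)
    moreover have "L = act_H M W (inM \<mu>) 1 1 id L"
      using act_H_cls[OF id_G_MW pull_id A.mu_odd, of "lam \<delta> \<mu> L"] lam_cls[OF r] by (simp add: pull_id)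
    then have "L \<in> orbit (G_dm M W (inW \<delta>) (inM \<mu>)) (act_H M W (inM \<mu>) 1 1) L"
      unfolding orbit_def G_dm_def using id_G_MW pull_id by blast
    ultimately have LL: "L = L'"
      using representatives_unique[OF rep_lambda[OF r(1,2)] r(3)] r'(3) dm by blast
    \<comment> \<open>With equal representatives both orbits lie over the same origin, and the
      equivalence of the two extensions identifies them.\<close>
    have "\<O> = \<O>'"
      using A.H02_orbits_eq[of \<O> \<O>' \<tau> \<tau>'] P t t' ee unfolding dm[symmetric] LL[symmetric] by blast
    with dm LL show ?thesis by blast
  qed
  have last: "let d = inW \<delta> + inM \<mu> + lam \<delta> \<mu> L + psi \<delta> \<mu> L;
            T = {\<tau> \<in> Z02 M W (inM \<mu>) (inW \<delta> + lam \<delta> \<mu> L).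
                   cls2 M W (inM \<mu>) (inW \<delta> + lam \<delta> \<mu> L) \<tau> \<in> \<O>}
        in T \<noteq> {} \<and> (\<forall>\<tau>\<in>T. d + \<tau> \<in> extensions M W)
          \<and> (\<forall>\<tau>\<in>T. \<forall>\<tau>'\<in>T. d + \<tau>' \<in> orbit (G_gen M W) pull (d + \<tau>))"
    if r: "\<delta> \<in> RD" "\<mu> \<in> RM" "L \<in> RL \<delta> \<mu>"
      and O: "\<O> \<in> H02_orbits M W (inW \<delta>) (inM \<mu>) (lam \<delta> \<mu> L) (psi \<delta> \<mu> L)" for \<delta> \<mu> L \<O>
  proof -
    interpret extension_point M W "inW \<delta>" "inM \<mu>" "lam \<delta> \<mu> L" "psi \<delta> \<mu> L" by (rule point[OF r])
    have "inW \<delta> + inM \<mu> + lam \<delta> \<mu> L + (psi \<delta> \<mu> L + \<tau>) \<in> extensions M W" if t: "\<tau> \<in> Z" for \<tau>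
      unfolding extensions_iff[OF RD[OF r(1)] RM[OF r(2)] l C_par_subspace(2)[OF psi Z_par[OF t]]]
      by (rule Z_ext[OF t])
    then show ?thesis
      unfolding Let_def add.assoc[of _ "psi \<delta> \<mu> L"]
      using H02_orbit_nonempty[OF O] H02_orbit_equivalent[OF O] by blast
  qed
  have "\<exists>!x. case x of (\<delta>, \<mu>, L, \<O>) \<Rightarrow> ?P d \<delta> \<mu> L \<O>" if d: "d \<in> extensions M W" for d
  proof -
    obtain \<delta> \<mu> L \<O> where P: "?P d \<delta> \<mu> L \<O>" using exist[OF d] by blast
    show ?thesis
    proof (rule ex1I[of _ "(\<delta>, \<mu>, L, \<O>)"])
      show "case (\<delta>, \<mu>, L, \<O>) of (\<delta>, \<mu>, L, \<O>) \<Rightarrow> ?P d \<delta> \<mu> L \<O>"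
        unfolding split by (rule P)
      fix x assume x: "case x of (\<delta>, \<mu>, L, \<O>) \<Rightarrow> ?P d \<delta> \<mu> L \<O>"
      obtain \<delta>' \<mu>' L' \<O>' where x': "x = (\<delta>', \<mu>', L', \<O>')" by (cases x)
      show "x = (\<delta>, \<mu>, L, \<O>)"
        using unique[OF x[unfolded x' split] P] unfolding x' by simp
    qed
  qed
  then show ?thesis
    using ex_psi last by (intro conjI ballI)
qed

end
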